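(* Let $\mathfrak g$ be a $2n$-dimensional real Lie algebra with a complex product structure $\{J,E\}$, let $\hat{\mathfrak g}=(\mathfrak g^{\mathbb C})_{\mathbb R}$ carry the induced hypercomplex structure, and let $G$ and $\hat G$ be the simply connected Lie groups with Lie algebras $\mathfrak g$ and $\hat{\mathfrak g}$. Let $\operatorname{Hol}^{\mathrm{CP}}$ be the holonomy group of $\nabla^{\mathrm{CP}}$ on $G$ and $\operatorname{Hol}^{\mathrm{Ob}}$ the holonomy group of the Obata connection on the $4n$-dimensional group $\hat G$. (i) $\operatorname{Hol}^{\mathrm{Ob}}$ is contained in a proper subgroup of $\mathrm{GL}(n,\mathbb H)$ which is isomorphic to $\mathrm{GL}(n,\mathbb C)$. (ii) $\operatorname{Hol}^{\mathrm{Ob}}$ lies in $\mathrm{SL}(n,\mathbb H)$ if and only if $\operatorname{Hol}^{\mathrm{CP}}$ is contained in $\mathrm{SL}(n,\mathbb R)$, where $\mathrm{SL}(n,\mathbb R)$ is considered as a Lie subgroup of $\mathrm{GL}(2n,\mathbb R)$ via $A\mapsto\begin{bmatrix}A&0\\0&A\end{bmatrix}$. In this case, $\operatorname{Hol}^{\mathrm{Ob}}$ is contained in a proper subgroup of $\mathrm{SL}(n,\mathbb H)$, isomorphic to $\mathrm{SL}(n,\mathbb C)$.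
   Context: A complex product structure $\{J,E\}$ on $\mathfrak g$ consists of an integrable $J$ ($J^2=-\mathrm{Id}$, $[x,y]+J([Jx,y]+[x,Jy])-[Jx,Jy]=0$) and $E$ with $E^2=\mathrm{Id}$, $JE=-EJ$, whose $(\pm1)$-eigenspaces $\mathfrak g_\pm$ are Lie subalgebras; then $\mathfrak g=\mathfrak g_+\oplus\mathfrak g_-$ and $J\mathfrak g_+=\mathfrak g_-$. $\nabla^{\mathrm{CP}}$ is the unique torsion-free left-invariant connection on $G$ with $\nabla^{\mathrm{CP}}J=\nabla^{\mathrm{CP}}E=0$. $\hat{\mathfrak g}$ is the complexification of $\mathfrak g$ viewed as a real Lie algebra, with hypercomplex structure $J_1(x+iy)=Jx+iJy$; $J_2(x+iy)=i(x+iy)$ for $x,y\in\mathfrak g_+$, $J_2(x+iy)=-i(x+iy)$ for $x,y\in\mathfrak g_-$; $J_3=J_1J_2$. The Obata connection is the unique torsion-free left-invariant connection on $\hat G$ with $J_1,J_2,J_3$ parallel. Matrices are taken with respect to a basis $\{e_1,\dots,e_n,Je_1,\dots,Je_n\}$ of $\mathfrak g$ with $e_j\in\mathfrak g_+$ and the basis $\{e_j\},\{ie_j\},\{Je_j\},\{iJe_j\}$ of $\hat{\mathfrak g}$. $\mathrm{GL}(n,\mathbb H)$ is the group of invertible real endomorphisms of $\hat{\mathfrak g}\cong\mathbb R^{4n}$ commuting with $J_1,J_2,J_3$, and $\mathrm{SL}(n,\mathbb H)$ is its commutator subgroup. *)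

theory Defs
  imports "HOL-Analysis.Analysis" "HOL-Algebra.Generated_Groups"
begin

section \<open>Smooth manifolds and Lie groups\<close>

text \<open>Only used for open sets \<open>S\<close> in finite-dimensional spaces, where it is the usual notion of
  a map of class \<open>C\<^sup>k\<close>.\<close>

primrec Ck_on :: "nat \<Rightarrow> 'a::euclidean_space set \<Rightarrow> ('a \<Rightarrow> 'b::real_normed_vector) \<Rightarrow> bool" where
  "Ck_on 0 S f \<longleftrightarrow> continuous_on S f"
| "Ck_on (Suc k) S f \<longleftrightarrow>
     (\<forall>x\<in>S. f differentiable (at x)) \<and> (\<forall>v. Ck_on k S (\<lambda>x. frechet_derivative f (at x) v))"

definition smooth_on :: "'a::euclidean_space set \<Rightarrow> ('a \<Rightarrow> 'b::real_normed_vector) \<Rightarrow> bool" where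
  "smooth_on S f \<longleftrightarrow> (\<forall>k. Ck_on k S f)"

text \<open>A chart is a pair \<open>(U, \<phi>)\<close>; only the values of \<open>\<phi>\<close> on \<open>U\<close> matter, and its inverse is
  \<open>inv_into U \<phi>\<close>.\<close>

type_synonym ('m, 'e) chart = "'m set \<times> ('m \<Rightarrow> 'e)"

definition smooth_atlas :: "('m::topological_space, 'e::euclidean_space) chart set \<Rightarrow> bool" where
  "smooth_atlas \<A> \<longleftrightarrow>
     (\<forall>(U, \<phi>)\<in>\<A>. open U \<and> open (\<phi> ` U) \<and> homeomorphism U (\<phi> ` U) \<phi> (inv_into U \<phi>)) \<and>
     (\<Union>(U, \<phi>)\<in>\<A>. U) = UNIV \<and>
     (\<forall>(U, \<phi>)\<in>\<A>. \<forall>(V, \<psi>)\<in>\<A>. smooth_on (\<phi> ` (U \<inter> V)) (\<psi> \<circ> inv_into U \<phi>))"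

definition prod_atlas :: "('m, 'e) chart set \<Rightarrow> ('l, 'f) chart set \<Rightarrow> ('m \<times> 'l, 'e \<times> 'f) chart set" where
  "prod_atlas \<A> \<B> = {(U \<times> V, map_prod \<phi> \<psi>) |U \<phi> V \<psi>. (U, \<phi>) \<in> \<A> \<and> (V, \<psi>) \<in> \<B>}"

definition smooth_map :: "('m::topological_space, 'e::euclidean_space) chart set \<Rightarrow>
    ('l::topological_space, 'f::euclidean_space) chart set \<Rightarrow> ('m \<Rightarrow> 'l) \<Rightarrow> bool" where
  "smooth_map \<A> \<B> F \<longleftrightarrow> continuous_on UNIV F \<and>
     (\<forall>(U, \<phi>)\<in>\<A>. \<forall>(V, \<psi>)\<in>\<B>. smooth_on (\<phi> ` (U \<inter> F -` V)) (\<psi> \<circ> F \<circ> inv_into U \<phi>))"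

definition smooth_fun :: "('m::topological_space, 'e::euclidean_space) chart set \<Rightarrow>
    'm set \<Rightarrow> ('m \<Rightarrow> real) \<Rightarrow> bool" where
  "smooth_fun \<A> W f \<longleftrightarrow> open W \<and> (\<forall>(U, \<phi>)\<in>\<A>. smooth_on (\<phi> ` (U \<inter> W)) (f \<circ> inv_into U \<phi>))"

definition smooth_near :: "('m::topological_space, 'e::euclidean_space) chart set \<Rightarrow>
    'm \<Rightarrow> ('m \<Rightarrow> real) \<Rightarrow> bool" where
  "smooth_near \<A> p f \<longleftrightarrow> (\<exists>W. p \<in> W \<and> smooth_fun \<A> W f)"

text \<open>A tangent vector at \<open>p\<close> is a directional derivative, in a chart around \<open>p\<close>, acting on the
  functions that are smooth near \<open>p\<close>. It is \<open>0\<close> on all other functions, so that equality of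
  tangent vectors is equality of HOL functions.\<close>

definition tangent_space :: "('m::topological_space, 'e::euclidean_space) chart set \<Rightarrow>
    'm \<Rightarrow> (('m \<Rightarrow> real) \<Rightarrow> real) set" where
  "tangent_space \<A> p = {v.
     (\<forall>f. \<not> smooth_near \<A> p f \<longrightarrow> v f = 0) \<and>
     (\<exists>(U, \<phi>)\<in>\<A>. p \<in> U \<and> (\<exists>a. \<forall>f. smooth_near \<A> p f \<longrightarrow>
        v f = frechet_derivative (f \<circ> inv_into U \<phi>) (at (\<phi> p)) a))}"

type_synonym 'm vfield = "'m \<Rightarrow> ('m \<Rightarrow> real) \<Rightarrow> real"

definition vector_fields :: "('m::topological_space, 'e::euclidean_space) chart set \<Rightarrow> 'm vfield set" where
  "vector_fields \<A> = {X. (\<forall>p. X p \<in> tangent_space \<A> p) \<and>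
     (\<forall>W f. smooth_fun \<A> W f \<longrightarrow> smooth_fun \<A> W (\<lambda>p. X p f))}"

definition vf_add :: "'m vfield \<Rightarrow> 'm vfield \<Rightarrow> 'm vfield" where
  "vf_add X Y = (\<lambda>p f. X p f + Y p f)"

definition vf_scale :: "('m \<Rightarrow> real) \<Rightarrow> 'm vfield \<Rightarrow> 'm vfield" where
  "vf_scale h X = (\<lambda>p f. h p * X p f)"

definition vf_bracket :: "('m::topological_space, 'e::euclidean_space) chart set \<Rightarrow>
    'm vfield \<Rightarrow> 'm vfield \<Rightarrow> 'm vfield" where
  "vf_bracket \<A> X Y = (\<lambda>p f.
     if smooth_near \<A> p f then X p (\<lambda>q. Y q f) - Y p (\<lambda>q. X q f) else 0)"

definition lie_group :: "('m::{t2_space, second_countable_topology}, 'e::euclidean_space) chart set \<Rightarrow>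
    'm monoid \<Rightarrow> bool" where
  "lie_group \<A> G \<longleftrightarrow> smooth_atlas \<A> \<and> group G \<and> carrier G = UNIV \<and>
     smooth_map (prod_atlas \<A> \<A>) \<A> (\<lambda>(a, b). a \<otimes>\<^bsub>G\<^esub> b) \<and>
     smooth_map \<A> \<A> (\<lambda>a. inv\<^bsub>G\<^esub> a)"

text \<open>Pushforward of a vector field by the left translation by \<open>a\<close>.\<close>

definition left_push :: "'m monoid \<Rightarrow> 'm \<Rightarrow> 'm vfield \<Rightarrow> 'm vfield" where
  "left_push G a X = (\<lambda>p f. X (inv\<^bsub>G\<^esub> a \<otimes>\<^bsub>G\<^esub> p) (\<lambda>q. f (a \<otimes>\<^bsub>G\<^esub> q)))"

definition left_invariant_fields :: "('m::topological_space, 'e::euclidean_space) chart set \<Rightarrow>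
    'm monoid \<Rightarrow> 'm vfield set" where
  "left_invariant_fields \<A> G = {X \<in> vector_fields \<A>. \<forall>a. left_push G a X = X}"


section \<open>Lie algebras\<close>

definition lie_algebra :: "('g::real_vector \<Rightarrow> 'g \<Rightarrow> 'g) \<Rightarrow> bool" where
  "lie_algebra br \<longleftrightarrow> (\<forall>x. linear (br x)) \<and> (\<forall>y. linear (\<lambda>x. br x y)) \<and>
     (\<forall>x. br x x = 0) \<and>
     (\<forall>x y z. br x (br y z) + br y (br z x) + br z (br x y) = 0)"

text \<open>\<open>\<iota>\<close> identifies the Lie algebra \<open>('g, br)\<close> with the Lie algebra of left-invariant
  vector fields on \<open>G\<close>.\<close>

definition lie_algebra_of :: "('m::topological_space, 'e::euclidean_space) chart set \<Rightarrow> 'm monoid \<Rightarrow>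
    ('g::real_vector \<Rightarrow> 'g \<Rightarrow> 'g) \<Rightarrow> ('g \<Rightarrow> 'm vfield) \<Rightarrow> bool" where
  "lie_algebra_of \<A> G br \<iota> \<longleftrightarrow>
     bij_betw \<iota> UNIV (left_invariant_fields \<A> G) \<and>
     (\<forall>x y. \<iota> (x + y) = vf_add (\<iota> x) (\<iota> y)) \<and>
     (\<forall>c x. \<iota> (c *\<^sub>R x) = vf_scale (\<lambda>_. c) (\<iota> x)) \<and>
     (\<forall>x y. \<iota> (br x y) = vf_bracket \<A> (\<iota> x) (\<iota> y))"


section \<open>Connections\<close>

definition affine_connection :: "('m::topological_space, 'e::euclidean_space) chart set \<Rightarrow>
    ('m vfield \<Rightarrow> 'm vfield \<Rightarrow> 'm vfield) \<Rightarrow> bool" where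
  "affine_connection \<A> N \<longleftrightarrow>
     (\<forall>X\<in>vector_fields \<A>. \<forall>Y\<in>vector_fields \<A>. N X Y \<in> vector_fields \<A> \<and>
       (\<forall>Z\<in>vector_fields \<A>.
          N (vf_add X Z) Y = vf_add (N X Y) (N Z Y) \<and>
          N X (vf_add Y Z) = vf_add (N X Y) (N X Z)) \<and>
       (\<forall>h. smooth_fun \<A> UNIV h \<longrightarrow>
          N (vf_scale h X) Y = vf_scale h (N X Y) \<and>
          N X (vf_scale h Y) = vf_add (vf_scale (\<lambda>p. X p h) Y) (vf_scale h (N X Y))))"

definition left_invariant_connection :: "('m::topological_space, 'e::euclidean_space) chart set \<Rightarrow>
    'm monoid \<Rightarrow> ('m vfield \<Rightarrow> 'm vfield \<Rightarrow> 'm vfield) \<Rightarrow> bool" where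
  "left_invariant_connection \<A> G N \<longleftrightarrow> affine_connection \<A> N \<and>
     (\<forall>a. \<forall>X\<in>vector_fields \<A>. \<forall>Y\<in>vector_fields \<A>.
        N (left_push G a X) (left_push G a Y) = left_push G a (N X Y))"

definition torsion_free :: "('m::topological_space, 'e::euclidean_space) chart set \<Rightarrow>
    ('m vfield \<Rightarrow> 'm vfield \<Rightarrow> 'm vfield) \<Rightarrow> bool" where
  "torsion_free \<A> N \<longleftrightarrow> (\<forall>X\<in>vector_fields \<A>. \<forall>Y\<in>vector_fields \<A>.
     N X Y = vf_add (N Y X) (vf_bracket \<A> X Y))"

text \<open>The left-invariant \<open>(1,1)\<close>-tensor field on \<open>G\<close> determined by an endomorphism \<open>T\<close> of the
  Lie algebra: every tangent vector at \<open>p\<close> is \<open>\<iota> x p\<close> for exactly one \<open>x\<close>.\<close>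

definition left_invariant_tensor :: "('g \<Rightarrow> 'm vfield) \<Rightarrow> ('g \<Rightarrow> 'g) \<Rightarrow> 'm vfield \<Rightarrow> 'm vfield" where
  "left_invariant_tensor \<iota> T Y = (\<lambda>p. \<iota> (T (THE x. \<iota> x p = Y p)) p)"

definition parallel_tensor :: "('m::topological_space, 'e::euclidean_space) chart set \<Rightarrow>
    ('m vfield \<Rightarrow> 'm vfield \<Rightarrow> 'm vfield) \<Rightarrow> ('m vfield \<Rightarrow> 'm vfield) \<Rightarrow> bool" where
  "parallel_tensor \<A> N \<T> \<longleftrightarrow>
     (\<forall>X\<in>vector_fields \<A>. \<forall>Y\<in>vector_fields \<A>. N X (\<T> Y) = \<T> (N X Y))"


section \<open>Parallel transport and holonomy\<close>

text \<open>\<open>\<gamma> : [0,1] \<rightarrow> G\<close> is a curve of class \<open>C\<^sup>1\<close> with velocity \<open>\<gamma>'(t) = \<iota> (u t) (\<gamma> t)\<close>.\<close>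

definition C1_curve :: "('m::topological_space, 'e::euclidean_space) chart set \<Rightarrow>
    ('g::real_normed_vector \<Rightarrow> 'm vfield) \<Rightarrow> (real \<Rightarrow> 'm) \<Rightarrow> (real \<Rightarrow> 'g) \<Rightarrow> bool" where
  "C1_curve \<A> \<iota> \<gamma> u \<longleftrightarrow> continuous_on {0..1} \<gamma> \<and> continuous_on {0..1} u \<and>
     (\<forall>t\<in>{0..1}. \<forall>f. smooth_near \<A> (\<gamma> t) f \<longrightarrow>
        ((\<lambda>s. f (\<gamma> s)) has_real_derivative \<iota> (u t) (\<gamma> t) f) (at t within {0..1}))"

text \<open>A vector field along \<open>\<gamma>\<close> is written \<open>t \<mapsto> \<iota> (X t) (\<gamma> t)\<close>. If \<open>X t = (\<Sum>i. c i t *\<^sub>R b i)\<close> for a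
  basis \<open>b\<close> of the Lie algebra, its covariant derivative is
  \<open>\<Sum>i. c i' t *\<^sub>R \<iota> (b i) (\<gamma> t) + c i t *\<^sub>R N (\<iota> (u t)) (\<iota> (b i)) (\<gamma> t)\<close>; here \<open>N\<close> needs only be
  evaluated on left-invariant fields, and by linearity the second summands add up to
  \<open>N (\<iota> (u t)) (\<iota> (X t)) (\<gamma> t)\<close>, with \<open>t\<close> frozen inside \<open>\<iota> (u t)\<close> and \<open>\<iota> (X t)\<close>.\<close>

definition parallel_along :: "('g::real_normed_vector \<Rightarrow> 'm vfield) \<Rightarrow>
    ('m vfield \<Rightarrow> 'm vfield \<Rightarrow> 'm vfield) \<Rightarrow> (real \<Rightarrow> 'm) \<Rightarrow> (real \<Rightarrow> 'g) \<Rightarrow> (real \<Rightarrow> 'g) \<Rightarrow> bool" where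
  "parallel_along \<iota> N \<gamma> u X \<longleftrightarrow> (\<forall>t\<in>{0..1}. \<exists>X'.
     (X has_vector_derivative X') (at t within {0..1}) \<and>
     (\<forall>f. \<iota> X' (\<gamma> t) f + N (\<iota> (u t)) (\<iota> (X t)) (\<gamma> t) f = 0))"

text \<open>\<open>parallel_transport \<A> \<iota> N p q P\<close>: parallel transport along some piecewise \<open>C\<^sup>1\<close> curve (a finite
  concatenation of \<open>C\<^sup>1\<close> curves) from \<open>p\<close> to \<open>q\<close> is the map \<open>\<iota> x p \<mapsto> \<iota> (P x) q\<close>.\<close>

inductive parallel_transport :: "('m::topological_space, 'e::euclidean_space) chart set \<Rightarrow>
    ('g::real_normed_vector \<Rightarrow> 'm vfield) \<Rightarrow> ('m vfield \<Rightarrow> 'm vfield \<Rightarrow> 'm vfield) \<Rightarrow>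
    'm \<Rightarrow> 'm \<Rightarrow> ('g \<Rightarrow> 'g) \<Rightarrow> bool"
  for \<A> \<iota> N p where
  const: "parallel_transport \<A> \<iota> N p p id"
| append: "\<lbrakk>parallel_transport \<A> \<iota> N p (\<gamma> 0) P; C1_curve \<A> \<iota> \<gamma> u;
     \<forall>x. \<exists>X. parallel_along \<iota> N \<gamma> u X \<and> X 0 = x \<and> X 1 = Q x\<rbrakk>
     \<Longrightarrow> parallel_transport \<A> \<iota> N p (\<gamma> 1) (Q \<circ> P)"

text \<open>Holonomy group at the identity, acting on the Lie algebra through the identification of \<open>x\<close>
  with the tangent vector \<open>\<iota> x \<one>\<close>.\<close>

definition holonomy :: "('m::topological_space, 'e::euclidean_space) chart set \<Rightarrow> 'm monoid \<Rightarrow>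
    ('g::real_normed_vector \<Rightarrow> 'm vfield) \<Rightarrow> ('m vfield \<Rightarrow> 'm vfield \<Rightarrow> 'm vfield) \<Rightarrow> ('g \<Rightarrow> 'g) set" where
  "holonomy \<A> G \<iota> N = {P. parallel_transport \<A> \<iota> N \<one>\<^bsub>G\<^esub> \<one>\<^bsub>G\<^esub> P}"


section \<open>Complex product structures and the complexification\<close>

definition lie_subalgebra :: "('g::real_vector \<Rightarrow> 'g \<Rightarrow> 'g) \<Rightarrow> 'g set \<Rightarrow> bool" where
  "lie_subalgebra br S \<longleftrightarrow> subspace S \<and> (\<forall>x\<in>S. \<forall>y\<in>S. br x y \<in> S)"

definition complex_product_structure :: "('g::real_vector \<Rightarrow> 'g \<Rightarrow> 'g) \<Rightarrow> ('g \<Rightarrow> 'g) \<Rightarrow> ('g \<Rightarrow> 'g) \<Rightarrow> bool" where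
  "complex_product_structure br J E \<longleftrightarrow> linear J \<and> linear E \<and>
     (\<forall>x. J (J x) = - x) \<and>
     (\<forall>x y. br x y + J (br (J x) y + br x (J y)) - br (J x) (J y) = 0) \<and>
     (\<forall>x. E (E x) = x) \<and> (\<forall>x. J (E x) = - E (J x)) \<and>
     lie_subalgebra br {x. E x = x} \<and> lie_subalgebra br {x. E x = - x}"

definition is_CP_connection :: "('m::topological_space, 'e::euclidean_space) chart set \<Rightarrow> 'm monoid \<Rightarrow>
    ('g \<Rightarrow> 'm vfield) \<Rightarrow> ('g \<Rightarrow> 'g) \<Rightarrow> ('g \<Rightarrow> 'g) \<Rightarrow> ('m vfield \<Rightarrow> 'm vfield \<Rightarrow> 'm vfield) \<Rightarrow> bool" where
  "is_CP_connection \<A> G \<iota> J E N \<longleftrightarrow>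
     left_invariant_connection \<A> G N \<and> torsion_free \<A> N \<and>
     parallel_tensor \<A> N (left_invariant_tensor \<iota> J) \<and>
     parallel_tensor \<A> N (left_invariant_tensor \<iota> E)"

text \<open>The pair \<open>(x, y)\<close> stands for \<open>x + iy\<close>.\<close>

definition complexify_bracket :: "('g::real_vector \<Rightarrow> 'g \<Rightarrow> 'g) \<Rightarrow> 'g \<times> 'g \<Rightarrow> 'g \<times> 'g \<Rightarrow> 'g \<times> 'g" where
  "complexify_bracket br = (\<lambda>(a, b) (c, d). (br a c - br b d, br a d + br b c))"

definition mult_i :: "'g::real_vector \<times> 'g \<Rightarrow> 'g \<times> 'g" where
  "mult_i = (\<lambda>(x, y). (- y, x))"

definition J1 :: "('g \<Rightarrow> 'g) \<Rightarrow> 'g \<times> 'g \<Rightarrow> 'g \<times> 'g" where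
  "J1 J = map_prod J J"

text \<open>The real-linear map that is multiplication by \<open>i\<close> on the complexification of the
  \<open>+1\<close>-eigenspace of \<open>E\<close> and by \<open>-i\<close> on that of the \<open>-1\<close>-eigenspace.\<close>

definition J2 :: "('g::real_vector \<Rightarrow> 'g) \<Rightarrow> 'g \<times> 'g \<Rightarrow> 'g \<times> 'g" where
  "J2 E = mult_i \<circ> map_prod E E"

lemma J2_plus: "E x = x \<Longrightarrow> E y = y \<Longrightarrow> J2 E (x, y) = mult_i (x, y)"
  by (simp add: J2_def)

lemma J2_minus: "E x = - x \<Longrightarrow> E y = - y \<Longrightarrow> J2 E (x, y) = - mult_i (x, y)"
  by (simp add: J2_def mult_i_def)

definition J3 :: "('g::real_vector \<Rightarrow> 'g) \<Rightarrow> ('g \<Rightarrow> 'g) \<Rightarrow> 'g \<times> 'g \<Rightarrow> 'g \<times> 'g" where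
  "J3 J E = J1 J \<circ> J2 E"

definition is_Obata_connection :: "('m::topological_space, 'e::euclidean_space) chart set \<Rightarrow> 'm monoid \<Rightarrow>
    ('g::real_vector \<times> 'g \<Rightarrow> 'm vfield) \<Rightarrow> ('g \<Rightarrow> 'g) \<Rightarrow> ('g \<Rightarrow> 'g) \<Rightarrow>
    ('m vfield \<Rightarrow> 'm vfield \<Rightarrow> 'm vfield) \<Rightarrow> bool" where
  "is_Obata_connection \<A> G \<iota> J E N \<longleftrightarrow>
     left_invariant_connection \<A> G N \<and> torsion_free \<A> N \<and>
     parallel_tensor \<A> N (left_invariant_tensor \<iota> (J1 J)) \<and>
     parallel_tensor \<A> N (left_invariant_tensor \<iota> (J2 E)) \<and>
     parallel_tensor \<A> N (left_invariant_tensor \<iota> (J3 J E))"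


section \<open>Linear groups\<close>

definition GL_H :: "('g::real_vector \<Rightarrow> 'g) \<Rightarrow> ('g \<Rightarrow> 'g) \<Rightarrow> ('g \<times> 'g \<Rightarrow> 'g \<times> 'g) monoid" where
  "GL_H J E = \<lparr>carrier = {T. linear T \<and> bij T \<and>
     T \<circ> J1 J = J1 J \<circ> T \<and> T \<circ> J2 E = J2 E \<circ> T \<and> T \<circ> J3 J E = J3 J E \<circ> T},
     monoid.mult = (\<circ>), one = id\<rparr>"

definition SL_H :: "('g::real_vector \<Rightarrow> 'g) \<Rightarrow> ('g \<Rightarrow> 'g) \<Rightarrow> ('g \<times> 'g \<Rightarrow> 'g \<times> 'g) monoid" where
  "SL_H J E = (GL_H J E)\<lparr>carrier := derived (GL_H J E) (carrier (GL_H J E))\<rparr>"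

definition GL_C :: "(complex^'n^'n) monoid" where
  "GL_C = \<lparr>carrier = {A. invertible A}, monoid.mult = (**), one = mat 1\<rparr>"

definition SL_C :: "(complex^'n^'n) monoid" where
  "SL_C = \<lparr>carrier = {A. det A = 1}, monoid.mult = (**), one = mat 1\<rparr>"

text \<open>\<open>e\<close> is a basis \<open>e\<^sub>1, \<dots>, e\<^sub>n\<close> of the \<open>+1\<close>-eigenspace such that
  \<open>e\<^sub>1, \<dots>, e\<^sub>n, J e\<^sub>1, \<dots>, J e\<^sub>n\<close> is a basis of the whole space.\<close>

definition adapted_basis :: "('g::real_vector \<Rightarrow> 'g) \<Rightarrow> ('g \<Rightarrow> 'g) \<Rightarrow> ('n::finite \<Rightarrow> 'g) \<Rightarrow> bool" where
  "adapted_basis J E e \<longleftrightarrow> (\<forall>j. E (e j) = e j) \<and> inj e \<and>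
     independent (range e \<union> range (J \<circ> e)) \<and> span (range e \<union> range (J \<circ> e)) = UNIV"

text \<open>The endomorphisms whose matrix in the basis \<open>e\<^sub>1, \<dots>, e\<^sub>n, J e\<^sub>1, \<dots>, J e\<^sub>n\<close> is
  block diagonal with two equal blocks \<open>A\<close> of determinant \<open>1\<close>.\<close>

definition SL_R_diag :: "('g::real_vector \<Rightarrow> 'g) \<Rightarrow> ('n::finite \<Rightarrow> 'g) \<Rightarrow> ('g \<Rightarrow> 'g) set" where
  "SL_R_diag J e = {T. linear T \<and> (\<exists>A::real^'n^'n. det A = 1 \<and>
     (\<forall>j. T (e j) = (\<Sum>i\<in>UNIV. A $ i $ j *\<^sub>R e i) \<and>
          T (J (e j)) = (\<Sum>i\<in>UNIV. A $ i $ j *\<^sub>R J (e i))))}"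

text \<open>Isomorphism of topological groups; between linear Lie groups this is the same as isomorphism
  of Lie groups. On linear endomorphisms of a finite-dimensional space the topology of the function
  type (pointwise convergence) is the usual one.\<close>

definition topological_group_iso :: "'a::topological_space monoid \<Rightarrow> 'b::topological_space monoid \<Rightarrow> bool" where
  "topological_group_iso K L \<longleftrightarrow>
     (\<exists>h\<in>iso K L. homeomorphism (carrier K) (carrier L) h (inv_into (carrier K) h))"

definition proper_subgroup :: "'a set \<Rightarrow> 'a monoid \<Rightarrow> bool" where
  "proper_subgroup K G \<longleftrightarrow> subgroup K G \<and> K \<noteq> carrier G"

end

theory Submission
  imports Defs
begin

text \<open>A left-invariant connection is the same thing as a bilinear product on the Lie algebra. The
  product \<open>D\<close> of the complex product connection commutes with \<open>J\<close> and \<open>E\<close>, so that in the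
  decomposition of \<open>\<gg>\<close> into the eigenspaces of \<open>E\<close> each \<open>D x\<close> is block diagonal with two equal
  real blocks \<open>\<Gamma> x\<close>. The complex-bilinear extension of \<open>D\<close> to the complexification is torsion
  free and commutes with \<open>J\<^sub>1\<close>, \<open>J\<^sub>2\<close> and \<open>J\<^sub>3\<close>; since the difference of two such products is a
  symmetric tensor which must vanish (\<open>obata_unique\<close>), it is the Obata product. It is block
  diagonal with equal complex blocks (\<open>complexify_connection_block\<close>). Parallel transport solves a
  linear differential equation with these coefficients, hence is block diagonal with a block in
  \<open>GL(n, \<complex>)\<close>. These block matrices form a proper subgroup of the quaternionic group \<open>GL(n, H)\<close>: a
  conjugate-linear variant of \<open>J\<close> is quaternionic, but does not commute with \<open>i\<close>.

  For the special linear groups, the determinant of the block of the transport along a curve is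
  \<open>exp (- c)\<close>, where \<open>c\<close> is the integral along the curve of the left-invariant form
  \<open>x \<mapsto> trace (\<Gamma> x)\<close> (\<open>transport\<close>, \<open>parallel_transport_block\<close>). On a simply connected group the
  integrals of a left-invariant form \<open>\<alpha>\<close> over all loops vanish if and only if \<open>\<alpha>\<close> vanishes on
  brackets, that is, if and only if \<open>\<alpha>\<close> is closed (\<open>closed_form_loop_integral\<close>,
  \<open>loop_integrals_vanish_imp_closed\<close>). So the holonomy of the complex product connection lies in
  \<open>SL(n, \<real>)\<close> exactly if \<open>\<tau> = trace \<circ> \<Gamma>\<close> vanishes on brackets of \<open>\<gg>\<close>.

  On the quaternionic side, a block of determinant \<open>1\<close> lies in the commutator subgroup because
  \<open>SL(n, \<complex>)\<close> is generated by commutators (\<open>GL_C_decomposition\<close>). In the other direction,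
  membership in the commutator subgroup only forces \<open>\<bar>det A\<bar> = 1\<close>, since the complex
  determinant of the block endomorphism is \<open>\<bar>det A\<bar>\<^sup>2\<close> (\<open>block_derived_norm_det\<close>). This is enough:
  with \<open>\<theta>\<close> the complex-linear extension of \<open>\<tau>\<close>, it says that all loop integrals of
  \<open>Re \<theta>\<close> vanish, so \<open>Re \<theta>\<close> vanishes on brackets; the restriction of \<open>Re \<theta>\<close> to \<open>\<gg>\<close> is \<open>\<tau>\<close>, so \<open>\<tau>\<close>
  vanishes on brackets, hence so does all of \<open>\<theta>\<close>, and the determinants are \<open>1\<close>.\<close>


section \<open>Calculus of smooth maps\<close>

lemma Ck_on_cong:
  assumes "open S" "\<And>x. x \<in> S \<Longrightarrow> f x = g x" "Ck_on k S f"
  shows "Ck_on k S g"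
  using assms(2,3)
proof (induction k arbitrary: f g)
  case 0
  then show ?case
    using continuous_on_cong[of S S f g] by simp
next
  case (Suc k)
  have diff: "f differentiable (at x)" if "x \<in> S" for x
    using Suc.prems(2) that by simp
  have "g differentiable (at x)" if "x \<in> S" for x
    using diff[OF that] has_derivative_transform_within_open[OF _ assms(1) that, where f = f and g = g] Suc.prems(1)
    unfolding differentiable_def by metis
  moreover have "Ck_on k S (\<lambda>x. frechet_derivative g (at x) v)" for v
  proof (rule Suc.IH)
    show "frechet_derivative f (at x) v = frechet_derivative g (at x) v" if "x \<in> S" for x
      using frechet_derivative_transform_within_open[OF diff[OF that] assms(1) that Suc.prems(1)] by simp
    show "Ck_on k S (\<lambda>x. frechet_derivative f (at x) v)"
      using Suc.prems(2) by simp
  qed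
  ultimately show ?case
    by simp
qed

lemma Ck_on_subset: "Ck_on k S f \<Longrightarrow> T \<subseteq> S \<Longrightarrow> Ck_on k T f"
  by (induction k arbitrary: f) (auto elim: continuous_on_subset)

lemma Ck_on_SucD: "Ck_on (Suc k) S f \<Longrightarrow> Ck_on k S f"
proof (induction k arbitrary: f)
  case 0
  then show ?case
    by (auto intro!: continuous_at_imp_continuous_on differentiable_imp_continuous_within)
qed (simp only: Ck_on.simps(2), blast)

lemma Ck_on_SucI:
  assumes "open S" "\<And>x. x \<in> S \<Longrightarrow> (f has_derivative f' x) (at x)" "\<And>v. Ck_on k S (\<lambda>x. f' x v)"
  shows "Ck_on (Suc k) S f"
proof -
  have "Ck_on k S (\<lambda>x. frechet_derivative f (at x) v)" for v
    by (rule Ck_on_cong[OF assms(1) _ assms(3)]) (use frechet_derivative_at[OF assms(2)] in simp)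
  then show ?thesis
    using assms(2) by (auto simp: differentiable_def)
qed

lemma Ck_on_Suc_derivative:
  assumes "Ck_on (Suc k) S f" "x \<in> S"
  shows "(f has_derivative frechet_derivative f (at x)) (at x)"
  using assms frechet_derivative_works by auto

lemma Ck_on_const: "Ck_on k S (\<lambda>_. c)"
proof (induction k arbitrary: c)
  case (Suc k)
  have "frechet_derivative (\<lambda>_. c) (at x) = (\<lambda>_. 0)" for x
    by (rule frechet_derivative_at[symmetric]) simp
  then show ?case
    using Suc[of 0] by simp
qed simp

lemma Ck_on_linear_compose:
  assumes S: "open S" and L: "bounded_linear L"
  shows "Ck_on k S f \<Longrightarrow> Ck_on k S (\<lambda>x. L (f x))"
proof (induction k arbitrary: f)
  case 0
  then show ?case
    by (simp add: bounded_linear.continuous_on[OF L])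
next
  case (Suc k)
  show ?case
  proof (rule Ck_on_SucI[OF S])
    show "((\<lambda>x. L (f x)) has_derivative (\<lambda>v. L (frechet_derivative f (at x) v))) (at x)" if "x \<in> S" for x
      by (rule bounded_linear.has_derivative[OF L Ck_on_Suc_derivative[OF Suc.prems that]])
    show "Ck_on k S (\<lambda>x. L (frechet_derivative f (at x) v))" for v
      by (rule Suc.IH) (use Suc.prems in simp)
  qed
qed

lemma Ck_on_add:
  assumes S: "open S"
  shows "Ck_on k S f \<Longrightarrow> Ck_on k S g \<Longrightarrow> Ck_on k S (\<lambda>x. f x + g x)"
proof (induction k arbitrary: f g)
  case 0
  then show ?case
    by (simp add: continuous_on_add)
next
  case (Suc k)
  show ?case
  proof (rule Ck_on_SucI[OF S])
    show "((\<lambda>x. f x + g x) has_derivative (\<lambda>v. frechet_derivative f (at x) v + frechet_derivative g (at x) v)) (at x)"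
      if "x \<in> S" for x
      using Suc.prems that by (intro has_derivative_add Ck_on_Suc_derivative)
    show "Ck_on k S (\<lambda>x. frechet_derivative f (at x) v + frechet_derivative g (at x) v)" for v
      by (rule Suc.IH) (use Suc.prems in simp_all)
  qed
qed

lemma Ck_on_sum:
  assumes "open S" "\<And>i. i \<in> I \<Longrightarrow> Ck_on k S (f i)"
  shows "Ck_on k S (\<lambda>x. \<Sum>i\<in>I. f i x)"
  using assms(2)
  by (induction I rule: infinite_finite_induct) (auto intro: Ck_on_const Ck_on_add[OF assms(1)])

lemma Ck_on_scaleR:
  assumes S: "open S"
  shows "Ck_on k S c \<Longrightarrow> Ck_on k S f \<Longrightarrow> Ck_on k S (\<lambda>x. c x *\<^sub>R f x)"
proof (induction k arbitrary: c f)
  case 0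
  then show ?case
    by (simp add: continuous_on_scaleR)
next
  case (Suc k)
  show ?case
  proof (rule Ck_on_SucI[OF S])
    show "((\<lambda>x. c x *\<^sub>R f x) has_derivative
        (\<lambda>v. c x *\<^sub>R frechet_derivative f (at x) v + frechet_derivative c (at x) v *\<^sub>R f x)) (at x)"
      if "x \<in> S" for x
      using Suc.prems that by (intro has_derivative_scaleR Ck_on_Suc_derivative)
    show "Ck_on k S (\<lambda>x. c x *\<^sub>R frechet_derivative f (at x) v + frechet_derivative c (at x) v *\<^sub>R f x)" for v
      using Suc.prems by (intro Ck_on_add[OF S] Suc.IH) (simp_all add: Ck_on_SucD)
  qed
qed

text \<open>The induction on the order needs the derivative of a composition in terms of maps to which the
  product and composition rules for order \<open>k\<close> apply. Its coefficient \<open>f' (g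
  x)\<close> is applied to a vector that depends on \<open>x\<close>; expanding this vector in
  the basis leaves only partial derivatives in constant directions.\<close>

lemma Ck_on_compose:
  fixes g :: "'a::euclidean_space \<Rightarrow> 'b::euclidean_space"
  assumes S: "open S" and gS: "g ` S \<subseteq> T"
  shows "Ck_on k T f \<Longrightarrow> Ck_on k S g \<Longrightarrow> Ck_on k S (\<lambda>x. f (g x))"
proof (induction k arbitrary: f)
  case 0
  then show ?case
    using continuous_on_compose2[OF _ _ gS] by auto
next
  case (Suc k)
  let ?f' = "\<lambda>x. frechet_derivative f (at (g x))" and ?g' = "\<lambda>x. frechet_derivative g (at x)"
  show ?case
  proof (rule Ck_on_SucI[OF S])
    fix x assume x: "x \<in> S"
    have f: "(f has_derivative ?f' x) (at (g x))"
      using Suc.prems(1) x gS by (intro Ck_on_Suc_derivative) auto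
    have g: "(g has_derivative ?g' x) (at x)"
      by (rule Ck_on_Suc_derivative[OF Suc.prems(2) x])
    have chain: "((\<lambda>x. f (g x)) has_derivative (\<lambda>v. ?f' x (?g' x v))) (at x)"
      using diff_chain_at[OF g f] by (simp add: o_def)
    have eq: "?f' x w = (\<Sum>b\<in>Basis. (w \<bullet> b) *\<^sub>R ?f' x b)" for w
    proof -
      have lin: "linear (?f' x)"
        using f by (rule has_derivative_linear)
      have "?f' x w = ?f' x (\<Sum>b\<in>Basis. (w \<bullet> b) *\<^sub>R b)"
        by (simp add: euclidean_representation)
      then show ?thesis
        by (simp add: linear_sum[OF lin] linear_scale[OF lin])
    qed
    have "(\<lambda>v. ?f' x (?g' x v)) = (\<lambda>v. \<Sum>b\<in>Basis. (?g' x v \<bullet> b) *\<^sub>R ?f' x b)"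
      using eq by (intro ext)
    from chain[unfolded this]
    show "((\<lambda>x. f (g x)) has_derivative (\<lambda>v. \<Sum>b\<in>Basis. (?g' x v \<bullet> b) *\<^sub>R ?f' x b)) (at x)" .
  next
    fix v
    have "Ck_on k S (\<lambda>x. ?g' x v \<bullet> b)" for b
      by (rule Ck_on_linear_compose[OF S bounded_linear_inner_left]) (use Suc.prems in simp)
    moreover have "Ck_on k S (\<lambda>x. ?f' x b)" for b
      by (rule Suc.IH[of "\<lambda>y. frechet_derivative f (at y) b"])
        (use Suc.prems(1) Ck_on_SucD[OF Suc.prems(2)] in simp_all)
    ultimately show "Ck_on k S (\<lambda>x. \<Sum>b\<in>Basis. (?g' x v \<bullet> b) *\<^sub>R ?f' x b)"
      by (intro Ck_on_sum Ck_on_scaleR S)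
  qed
qed

lemma Ck_on_local:
  assumes "\<And>x. x \<in> S \<Longrightarrow> \<exists>T. open T \<and> x \<in> T \<and> Ck_on k T f"
  shows "Ck_on k S f"
  using assms
proof (induction k arbitrary: f)
  case 0
  have "isCont f x" if "x \<in> S" for x
    using 0[OF that] by (auto simp: continuous_on_eq_continuous_at)
  then show ?case
    by (simp add: continuous_at_imp_continuous_on)
next
  case (Suc k)
  have "f differentiable (at x)" if "x \<in> S" for x
    using Suc.prems[OF that] by auto
  moreover have "Ck_on k S (\<lambda>x. frechet_derivative f (at x) v)" for v
  proof (rule Suc.IH)
    fix x assume "x \<in> S"
    from Suc.prems[OF this] obtain T where "open T" "x \<in> T" "Ck_on (Suc k) T f"
      by blast
    then show "\<exists>T. open T \<and> x \<in> T \<and> Ck_on k T (\<lambda>x. frechet_derivative f (at x) v)"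
      by auto
  qed
  ultimately show ?case
    by simp
qed

lemma smooth_on_cong:
  assumes "open S" "\<And>x. x \<in> S \<Longrightarrow> f x = g x" "smooth_on S f"
  shows "smooth_on S g"
  unfolding smooth_on_def
  by (intro allI Ck_on_cong[where f = f and g = g, OF assms(1)]) (use assms(2,3) in \<open>auto simp: smooth_on_def\<close>)

lemma smooth_on_subset: "smooth_on S f \<Longrightarrow> T \<subseteq> S \<Longrightarrow> smooth_on T f"
  unfolding smooth_on_def using Ck_on_subset by blast

lemma smooth_on_linear_compose:
  "open S \<Longrightarrow> bounded_linear L \<Longrightarrow> smooth_on S f \<Longrightarrow> smooth_on S (\<lambda>x. L (f x))"
  unfolding smooth_on_def using Ck_on_linear_compose by blast

lemma smooth_on_compose:
  fixes g :: "'a::euclidean_space \<Rightarrow> 'b::euclidean_space"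
  assumes "open S" "smooth_on T f" "smooth_on S g" "g ` S \<subseteq> T"
  shows "smooth_on S (\<lambda>x. f (g x))"
  using Ck_on_compose[OF assms(1,4)] assms(2,3) unfolding smooth_on_def by blast

lemma smooth_on_local:
  assumes "\<And>x. x \<in> S \<Longrightarrow> \<exists>T. open T \<and> x \<in> T \<and> smooth_on T f"
  shows "smooth_on S f"
  unfolding smooth_on_def using Ck_on_local[of S _ f] assms unfolding smooth_on_def by meson

lemma smooth_on_frechet_derivative:
  "smooth_on S f \<Longrightarrow> smooth_on S (\<lambda>x. frechet_derivative f (at x) v)"
  unfolding smooth_on_def by (metis Ck_on.simps(2))

lemma smooth_on_derivative:
  "smooth_on S f \<Longrightarrow> x \<in> S \<Longrightarrow> (f has_derivative frechet_derivative f (at x)) (at x)"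
  unfolding smooth_on_def using Ck_on_Suc_derivative by blast

lemma smooth_on_continuous: "smooth_on S f \<Longrightarrow> continuous_on S f"
  unfolding smooth_on_def by (metis Ck_on.simps(1))

lemma smooth_on_affine:
  assumes "open S" "bounded_linear L"
  shows "smooth_on S (\<lambda>x. c + L x)"
proof -
  have "Ck_on k S (\<lambda>x. c + L x)" for k
  proof (cases k)
    case 0
    then show ?thesis
      by (simp add: continuous_on_add bounded_linear.continuous_on[OF assms(2)])
  next
    case (Suc j)
    have "Ck_on (Suc j) S (\<lambda>x. c + L x)"
    proof (rule Ck_on_SucI[OF assms(1)])
      show "((\<lambda>x. c + L x) has_derivative L) (at x)" for x
        using has_derivative_add[OF has_derivative_const bounded_linear_imp_has_derivative[OF assms(2)]] by simp
    qed (rule Ck_on_const)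
    then show ?thesis
      using Suc by simp
  qed
  then show ?thesis
    by (simp add: smooth_on_def)
qed


section \<open>Primitives along continuous maps\<close>

text \<open>A closed form is represented by its primitives: functions on open sets that cover the space
  and differ by locally constant functions. In this form the monodromy argument is purely
  topological.\<close>

definition local_primitives :: "('m::topological_space set \<times> ('m \<Rightarrow> real)) set \<Rightarrow> bool" where
  "local_primitives \<V> \<longleftrightarrow>
     (\<forall>V F. (V, F) \<in> \<V> \<longrightarrow> open V) \<and> (\<forall>p. \<exists>V F. (V, F) \<in> \<V> \<and> p \<in> V) \<and>
     (\<forall>V F W H p. (V, F) \<in> \<V> \<longrightarrow> (W, H) \<in> \<V> \<longrightarrow> p \<in> V \<longrightarrow> p \<in> W \<longrightarrow>
        (\<exists>U. open U \<and> p \<in> U \<and> (\<lambda>q. F q - H q) constant_on U))"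

text \<open>The primitive of the pull-back of the form under \<open>h\<close>. It is a function on the
  parameter space \<open>S\<close>, not on the target, so that it can be many-valued along the
  image and exists for maps \<open>h\<close> that are merely continuous.\<close>

definition primitive_along :: "('m::topological_space set \<times> ('m \<Rightarrow> real)) set \<Rightarrow>
    ('z::topological_space \<Rightarrow> 'm) \<Rightarrow> 'z set \<Rightarrow> ('z \<Rightarrow> real) \<Rightarrow> bool" where
  "primitive_along \<V> h S \<Phi> \<longleftrightarrow> (\<forall>z\<in>S. \<exists>N V F. open N \<and> z \<in> N \<and> (V, F) \<in> \<V> \<and> h ` (N \<inter> S) \<subseteq> V \<and>
     (\<lambda>w. \<Phi> w - F (h w)) constant_on (N \<inter> S))"

lemma constant_onD: "f constant_on S \<Longrightarrow> x \<in> S \<Longrightarrow> y \<in> S \<Longrightarrow> f x = f y"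
  unfolding constant_on_def by metis

lemma primitive_alongE:
  assumes "primitive_along \<V> h S \<Phi>" "z \<in> S"
  obtains N V F where "open N" "z \<in> N" "(V, F) \<in> \<V>" "h ` (N \<inter> S) \<subseteq> V"
    "(\<lambda>w. \<Phi> w - F (h w)) constant_on (N \<inter> S)"
proof -
  from bspec[OF assms(1)[unfolded primitive_along_def] assms(2)] show ?thesis
    by (elim exE conjE) (rule that; assumption)
qed

text \<open>Near a point any member of the system may serve as the comparison function, not only the one
  supplied by the definition, because members differ by locally constant functions.\<close>

lemma primitive_along_any:
  assumes \<V>: "local_primitives \<V>" and \<Phi>: "primitive_along \<V> h S \<Phi>" and h: "continuous_on S h"
    and VF: "(V, F) \<in> \<V>" and z: "z \<in> S" "h z \<in> V"
  obtains N where "open N" "z \<in> N" "h ` (N \<inter> S) \<subseteq> V" "(\<lambda>w. \<Phi> w - F (h w)) constant_on (N \<inter> S)"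
proof -
  obtain N W H where N: "open N" "z \<in> N" "(W, H) \<in> \<V>" "h ` (N \<inter> S) \<subseteq> W"
    "(\<lambda>w. \<Phi> w - H (h w)) constant_on (N \<inter> S)"
    by (rule primitive_alongE[OF \<Phi> z(1)])
  have "h z \<in> W"
    using N z by auto
  then obtain U where U: "open U" "h z \<in> U" "(\<lambda>q. F q - H q) constant_on U"
    using \<V> VF N(3) z(2) unfolding local_primitives_def by blast
  have "open V"
    using \<V> VF unfolding local_primitives_def by blast
  then have "open (U \<inter> V)"
    using U by blast
  then obtain M where M: "open M" "M \<inter> S = h -` (U \<inter> V) \<inter> S"
    using h unfolding continuous_on_open_invariant by blast
  show ?thesis
  proof (rule that[of "N \<inter> M"])
    show "open (N \<inter> M)"
      using N M by blast
    show "z \<in> N \<inter> M"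
      using M(2) U(2) N(2) z by blast
    show "h ` (N \<inter> M \<inter> S) \<subseteq> V"
      using M(2) by blast
    obtain c d where c: "\<And>w. w \<in> N \<inter> S \<Longrightarrow> \<Phi> w - H (h w) = c" and d: "\<And>q. q \<in> U \<Longrightarrow> F q - H q = d"
      using N(5) U(3) unfolding constant_on_def by blast
    have "\<Phi> w - F (h w) = c - d" if "w \<in> N \<inter> M \<inter> S" for w
    proof -
      have "h w \<in> U"
        using M(2) that by blast
      from c[of w] d[OF this] that show ?thesis
        by simp
    qed
    then show "(\<lambda>w. \<Phi> w - F (h w)) constant_on (N \<inter> M \<inter> S)"
      unfolding constant_on_def by blast
  qed
qed

lemma primitive_along_unique:
  assumes \<V>: "local_primitives \<V>" and \<Phi>: "primitive_along \<V> h S \<Phi>" and \<Psi>: "primitive_along \<V> h S \<Psi>"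
    and h: "continuous_on S h" and S: "connected S" and zw: "z \<in> S" "w \<in> S"
  shows "\<Phi> w - \<Phi> z = \<Psi> w - \<Psi> z"
proof -
  have "(\<lambda>x. \<Phi> x - \<Psi> x) constant_on S"
  proof (rule locally_constant_imp_constant[OF S])
    fix x assume x: "x \<in> S"
    obtain N V F where N: "open N" "x \<in> N" "(V, F) \<in> \<V>" "h ` (N \<inter> S) \<subseteq> V"
      "(\<lambda>w. \<Phi> w - F (h w)) constant_on (N \<inter> S)"
      by (rule primitive_alongE[OF \<Phi> x])
    have "h x \<in> V"
      using N(2,4) x by auto
    then obtain M where M: "open M" "x \<in> M" "(\<lambda>w. \<Psi> w - F (h w)) constant_on (M \<inter> S)"
      by (rule primitive_along_any[OF \<V> \<Psi> h N(3) x])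
    have *: "\<forall>y\<in>S \<inter> (N \<inter> M). \<Phi> y - \<Psi> y = \<Phi> x - \<Psi> x"
    proof
      fix y assume that: "y \<in> S \<inter> (N \<inter> M)"
      have "\<Phi> x - F (h x) = \<Phi> y - F (h y)"
        by (rule constant_onD[OF N(5)]) (use that N(2) x in blast)+
      moreover have "\<Psi> x - F (h x) = \<Psi> y - F (h y)"
        by (rule constant_onD[OF M(3)]) (use that M(2) x in blast)+
      ultimately show "\<Phi> y - \<Psi> y = \<Phi> x - \<Psi> x"
        by linarith
    qed
    have "openin (top_of_set S) (S \<inter> (N \<inter> M))" "x \<in> S \<inter> (N \<inter> M)"
      using N(1,2) M(1,2) x by (auto intro: openin_open_Int)
    with * show "\<exists>T. openin (top_of_set S) T \<and> x \<in> T \<and> (\<forall>y\<in>T. \<Phi> y - \<Psi> y = \<Phi> x - \<Psi> x)"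
      by (intro exI[of _ "S \<inter> (N \<inter> M)"] conjI)
  qed
  from constant_onD[OF this zw] show ?thesis
    by simp
qed

lemma primitive_along_compose:
  assumes \<Phi>: "primitive_along \<V> h S \<Phi>" and k: "continuous_on T k" "k ` T \<subseteq> S"
  shows "primitive_along \<V> (h \<circ> k) T (\<Phi> \<circ> k)"
proof -
  have "\<exists>N V F. open N \<and> x \<in> N \<and> (V, F) \<in> \<V> \<and> (h \<circ> k) ` (N \<inter> T) \<subseteq> V \<and>
      (\<lambda>w. (\<Phi> \<circ> k) w - F ((h \<circ> k) w)) constant_on (N \<inter> T)" if x: "x \<in> T" for x
  proof -
    have "k x \<in> S"
      using k x by blast
    from primitive_alongE[OF \<Phi> this]
    obtain N V F where N: "open N" "k x \<in> N" "(V, F) \<in> \<V>" "h ` (N \<inter> S) \<subseteq> V"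
      "(\<lambda>w. \<Phi> w - F (h w)) constant_on (N \<inter> S)"
      by metis
    obtain M where M: "open M" "M \<inter> T = k -` N \<inter> T"
      using k(1) N(1) unfolding continuous_on_open_invariant by blast
    have kM: "k w \<in> N \<inter> S" if "w \<in> M \<inter> T" for w
      using M(2) k(2) that by blast
    have "x \<in> M"
      using M(2) N(2) x by blast
    moreover have "(h \<circ> k) ` (M \<inter> T) \<subseteq> V"
      using N(4) kM by auto
    moreover obtain c where c: "\<And>w. w \<in> N \<inter> S \<Longrightarrow> \<Phi> w - F (h w) = c"
      using N(5) unfolding constant_on_def by metis
    have "(\<Phi> \<circ> k) w - F ((h \<circ> k) w) = c" if "w \<in> M \<inter> T" for w
      using c[OF kM[OF that]] by simp
    then have "(\<lambda>w. (\<Phi> \<circ> k) w - F ((h \<circ> k) w)) constant_on (M \<inter> T)"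
      unfolding constant_on_def by (intro exI[of _ c] ballI)
    ultimately show ?thesis
      using M(1) N(3) by (intro exI[of _ M] exI[of _ V] exI[of _ F] conjI)
  qed
  then show ?thesis
    unfolding primitive_along_def by (rule ballI)
qed

lemma primitive_along_cong:
  assumes "\<And>x. x \<in> S \<Longrightarrow> f x = g x" "primitive_along \<V> f S \<Phi>"
  shows "primitive_along \<V> g S \<Phi>"
proof -
  have "f ` (N \<inter> S) = g ` (N \<inter> S)" for N
    using assms(1) by (intro image_cong) auto
  moreover have "(\<lambda>w. \<Phi> w - F (f w)) constant_on (N \<inter> S) \<longleftrightarrow> (\<lambda>w. \<Phi> w - F (g w)) constant_on (N \<inter> S)" for N F
    using assms(1) unfolding constant_on_def by simp
  ultimately show ?thesis
    using assms(2) unfolding primitive_along_def by simp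
qed

text \<open>On the connected overlap the two primitives differ by a constant, which can be absorbed into
  one of them. Closedness of both pieces guarantees that a point outside one piece has a
  neighbourhood that misses this piece.\<close>

lemma primitive_along_glue:
  assumes \<V>: "local_primitives \<V>" and \<Phi>: "primitive_along \<V> h S \<Phi>" and \<Psi>: "primitive_along \<V> h T \<Psi>"
    and h: "continuous_on (S \<union> T) h" and cl: "closed S" "closed T"
    and ST: "connected (S \<inter> T)" "S \<inter> T \<noteq> {}"
  shows "\<exists>\<Theta>. primitive_along \<V> h (S \<union> T) \<Theta>"
proof -
  obtain z0 where z0: "z0 \<in> S" "z0 \<in> T"
    using ST by blast
  have hS: "continuous_on S h" and hT: "continuous_on T h" and hST: "continuous_on (S \<inter> T) h"
    using h by (auto elim!: continuous_on_subset)
  have res: "primitive_along \<V> h (S \<inter> T) \<Phi>" "primitive_along \<V> h (S \<inter> T) \<Psi>"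
    using primitive_along_compose[OF \<Phi>, of "S \<inter> T" id] primitive_along_compose[OF \<Psi>, of "S \<inter> T" id]
    by (auto simp: o_def)
  define \<Theta> where "\<Theta> = (\<lambda>w. if w \<in> S then \<Phi> w else \<Psi> w + (\<Phi> z0 - \<Psi> z0))"
  have \<Theta>S: "\<Theta> w = \<Phi> w" if "w \<in> S" for w
    using that by (simp add: \<Theta>_def)
  have \<Theta>T: "\<Theta> w = \<Psi> w + (\<Phi> z0 - \<Psi> z0)" if "w \<in> T" for w
    using that primitive_along_unique[OF \<V> res hST ST(1), of z0 w] z0 by (auto simp: \<Theta>_def)
  have \<Theta>: "primitive_along \<V> h S \<Theta>" "primitive_along \<V> h T \<Theta>"
  proof -
    have "(\<lambda>w. \<Theta> w - F (h w)) constant_on (N \<inter> S) \<longleftrightarrow> (\<lambda>w. \<Phi> w - F (h w)) constant_on (N \<inter> S)" for N F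
      using \<Theta>S by (simp add: constant_on_def)
    then show "primitive_along \<V> h S \<Theta>"
      using \<Phi> unfolding primitive_along_def by (simp only:)
    have "(\<lambda>w. \<Psi> w - F (h w)) constant_on (N \<inter> T) \<Longrightarrow> (\<lambda>w. \<Theta> w - F (h w)) constant_on (N \<inter> T)" for N F
    proof -
      assume "(\<lambda>w. \<Psi> w - F (h w)) constant_on (N \<inter> T)"
      then obtain c where c: "\<And>w. w \<in> N \<inter> T \<Longrightarrow> \<Psi> w - F (h w) = c"
        unfolding constant_on_def by blast
      have "\<Theta> w - F (h w) = c + (\<Phi> z0 - \<Psi> z0)" if "w \<in> N \<inter> T" for w
        using \<Theta>T[of w] c[OF that] that by simp
      then show ?thesis
        unfolding constant_on_def by blast
    qed
    then show "primitive_along \<V> h T \<Theta>"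
      using \<Psi> unfolding primitive_along_def by meson
  qed
  have "\<exists>N V F. open N \<and> z \<in> N \<and> (V, F) \<in> \<V> \<and> h ` (N \<inter> (S \<union> T)) \<subseteq> V \<and>
      (\<lambda>w. \<Theta> w - F (h w)) constant_on (N \<inter> (S \<union> T))" if z: "z \<in> S \<union> T" for z
  proof -
    obtain V F where VF: "(V, F) \<in> \<V>" "h z \<in> V"
      using \<V> unfolding local_primitives_def by blast
    have near: "\<exists>N. open N \<and> z \<in> N \<and> h ` (N \<inter> R) \<subseteq> V \<and> (\<forall>w\<in>N \<inter> R. \<Theta> w - F (h w) = \<Theta> z - F (h z))"
      if R: "primitive_along \<V> h R \<Theta>" "continuous_on R h" "closed R" for R
    proof (cases "z \<in> R")
      case True
      obtain N where N: "open N" "z \<in> N" "h ` (N \<inter> R) \<subseteq> V" "(\<lambda>w. \<Theta> w - F (h w)) constant_on (N \<inter> R)"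
        by (rule primitive_along_any[OF \<V> R(1,2) VF(1) True VF(2)])
      have "\<forall>w\<in>N \<inter> R. \<Theta> w - F (h w) = \<Theta> z - F (h z)"
        using constant_onD[OF N(4), of _ z] N(2) True by blast
      then show ?thesis
        using N(1-3) by metis
    next
      case False
      then show ?thesis
        using R(3) by (intro exI[of _ "- R"]) auto
    qed
    obtain N where N: "open N" "z \<in> N" "h ` (N \<inter> S) \<subseteq> V" "\<forall>w\<in>N \<inter> S. \<Theta> w - F (h w) = \<Theta> z - F (h z)"
      using near[OF \<Theta>(1) hS cl(1)] by metis
    obtain M where M: "open M" "z \<in> M" "h ` (M \<inter> T) \<subseteq> V" "\<forall>w\<in>M \<inter> T. \<Theta> w - F (h w) = \<Theta> z - F (h z)"
      using near[OF \<Theta>(2) hT cl(2)] by metis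
    have "(\<lambda>w. \<Theta> w - F (h w)) constant_on (N \<inter> M \<inter> (S \<union> T))"
      unfolding constant_on_def using N(4) M(4) by (intro exI[of _ "\<Theta> z - F (h z)"]) auto
    moreover have "h ` (N \<inter> M \<inter> (S \<union> T)) \<subseteq> V"
      using N(3) M(3) by blast
    ultimately show ?thesis
      using N(1,2) M(1,2) VF(1) by (intro exI[of _ "N \<inter> M"] exI[of _ V] exI[of _ F]) auto
  qed
  then have "primitive_along \<V> h (S \<union> T) \<Theta>"
    unfolding primitive_along_def by (rule ballI)
  then show ?thesis
    by (rule exI[of _ \<Theta>])
qed

text \<open>A Lebesgue number gives a grid so fine that every cell is mapped into the domain of one local
  primitive. Glue the cells of each column along horizontal edges, then the columns along
  vertical edges.\<close>

lemma primitive_along_square: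
  fixes h :: "real \<times> real \<Rightarrow> 'm::topological_space"
  assumes \<V>: "local_primitives \<V>" and h: "continuous_on ({0..1} \<times> {0..1}) h"
  shows "\<exists>\<Phi>. primitive_along \<V> h ({0..1} \<times> {0..1}) \<Phi>"
proof -
  let ?I = "{0..1::real} \<times> {0..1::real}"
  define \<C> where "\<C> = {M. open M \<and> (\<exists>(V, F)\<in>\<V>. h ` (M \<inter> ?I) \<subseteq> V)}"
  have cov: "\<exists>M\<in>\<C>. z \<in> M" if "z \<in> ?I" for z
  proof -
    obtain V F where VF: "(V, F) \<in> \<V>" "h z \<in> V"
      using \<V> unfolding local_primitives_def by blast
    then have "open V"
      using \<V> unfolding local_primitives_def by blast
    then obtain M where M: "open M" "M \<inter> ?I = h -` V \<inter> ?I"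
      using h unfolding continuous_on_open_invariant by blast
    have "h ` (M \<inter> ?I) \<subseteq> V" "z \<in> M"
      using M(2) that VF by blast+
    then show ?thesis
      using M(1) VF(1) unfolding \<C>_def by blast
  qed
  have "(0, 0) \<in> ?I"
    by simp
  then have "\<C> \<noteq> {}"
    using cov by blast
  moreover have "compact ?I" "?I \<subseteq> \<Union>\<C>" "\<And>M. M \<in> \<C> \<Longrightarrow> open M"
    using cov by (auto simp: \<C>_def intro!: compact_Times)
  ultimately obtain \<delta> where \<delta>: "\<delta> > 0" "\<And>T. T \<subseteq> ?I \<Longrightarrow> diameter T < \<delta> \<Longrightarrow> \<exists>M\<in>\<C>. T \<subseteq> M"
    using Lebesgue_number_lemma[of ?I \<C>] by metis
  obtain n :: nat where n: "2 / \<delta> < real n"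
    using reals_Archimedean2 by blast
  then have n0: "real n > 0"
    using \<delta>(1) by (meson divide_pos_pos order_less_trans zero_less_numeral)
  define t where "t = (\<lambda>i. real i / real n)"
  have tle: "i \<le> j \<Longrightarrow> t i \<le> t j" and t1: "i \<le> n \<Longrightarrow> t i \<le> 1" and t0: "0 \<le> t i" for i j
    using n0 by (auto simp: t_def divide_right_mono)
  have cell: "\<exists>\<Phi>. primitive_along \<V> h ({t i..t (Suc i)} \<times> {t j..t (Suc j)}) \<Phi>"
    if ij: "i < n" "j < n" for i j
  proof -
    let ?T = "{t i..t (Suc i)} \<times> {t j..t (Suc j)}"
    have sub: "?T \<subseteq> ?I"
    proof -
      have "t (Suc i) \<le> 1" "t (Suc j) \<le> 1"
        using t1[of "Suc i"] t1[of "Suc j"] ij by simp_all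
      then show ?thesis
        using t0[of i] t0[of j] by auto
    qed
    have "dist x y \<le> 2 / real n" if "x \<in> ?T" "y \<in> ?T" for x y
    proof -
      have "\<bar>fst x - fst y\<bar> \<le> 1 / real n" "\<bar>snd x - snd y\<bar> \<le> 1 / real n"
        using that by (auto simp: t_def add_divide_distrib)
      moreover have "dist x y \<le> \<bar>fst x - fst y\<bar> + \<bar>snd x - snd y\<bar>"
        by (metis dist_Pair_Pair dist_real_def prod.collapse sqrt_sum_squares_le_sum_abs abs_abs power2_abs)
      ultimately show ?thesis
        by simp
    qed
    then have "diameter ?T \<le> 2 / real n"
      using n0 by (intro diameter_le) (auto simp: dist_norm)
    also have "2 / real n < \<delta>"
      using n n0 \<delta>(1) by (simp add: field_simps)
    finally obtain M where "M \<in> \<C>" "?T \<subseteq> M"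
      using \<delta>(2)[OF sub] by blast
    then obtain V F where "(V, F) \<in> \<V>" "h ` ?T \<subseteq> V"
      using sub unfolding \<C>_def by (auto; blast)
    then have "primitive_along \<V> h ?T (F \<circ> h)"
      unfolding primitive_along_def by (intro ballI exI[of _ UNIV] exI[of _ V] exI[of _ F]) (auto simp: constant_on_def)
    then show ?thesis
      by (rule exI[of _ "F \<circ> h"])
  qed
  have column: "\<exists>\<Phi>. primitive_along \<V> h ({t i..t (Suc i)} \<times> {0..t j}) \<Phi>"
    if i: "i < n" and j: "0 < j" "j \<le> n" for i j
    using j
  proof (induction j rule: nat_induct_non_zero)
    case 1
    then show ?case
      using cell[of i 0] i by (simp add: t_def)
  next
    case (Suc j)
    obtain \<Phi> \<Psi> where *: "primitive_along \<V> h ({t i..t (Suc i)} \<times> {0..t j}) \<Phi>"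
      "primitive_along \<V> h ({t i..t (Suc i)} \<times> {t j..t (Suc j)}) \<Psi>"
      using Suc cell[of i j] i by auto
    have un: "{t i..t (Suc i)} \<times> {0..t j} \<union> {t i..t (Suc i)} \<times> {t j..t (Suc j)}
        = {t i..t (Suc i)} \<times> {0..t (Suc j)}"
      using tle[of j "Suc j"] t0[of j] by auto
    have int: "{t i..t (Suc i)} \<times> {0..t j} \<inter> {t i..t (Suc i)} \<times> {t j..t (Suc j)} = {t i..t (Suc i)} \<times> {t j}"
      using tle[of j "Suc j"] t0[of j] by auto
    have "{t i..t (Suc i)} \<times> {0..t (Suc j)} \<subseteq> ?I"
      using t1[of "Suc i"] t1[of "Suc j"] t0[of i] i Suc(3) by auto
    then have "continuous_on ({t i..t (Suc i)} \<times> {0..t (Suc j)}) h"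
      using h continuous_on_subset by blast
    then show ?case
      using primitive_along_glue[OF \<V> *] tle[of i "Suc i"] unfolding un int
      by (auto intro!: closed_Times connected_Times)
  qed
  have "\<exists>\<Phi>. primitive_along \<V> h ({0..t i} \<times> {0..t n}) \<Phi>"
    if i: "0 < i" "i \<le> n" for i
    using i
  proof (induction i rule: nat_induct_non_zero)
    case 1
    then show ?case
      using column[of 0 n] by (simp add: t_def)
  next
    case (Suc i)
    obtain \<Phi> \<Psi> where *: "primitive_along \<V> h ({0..t i} \<times> {0..t n}) \<Phi>"
      "primitive_along \<V> h ({t i..t (Suc i)} \<times> {0..t n}) \<Psi>"
      using Suc column[of i n] by auto
    have un: "{0..t i} \<times> {0..t n} \<union> {t i..t (Suc i)} \<times> {0..t n} = {0..t (Suc i)} \<times> {0..t n}"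
      using tle[of i "Suc i"] t0[of i] by auto
    have int: "{0..t i} \<times> {0..t n} \<inter> {t i..t (Suc i)} \<times> {0..t n} = {t i} \<times> {0..t n}"
      using tle[of i "Suc i"] t0[of i] by auto
    have "{0..t (Suc i)} \<times> {0..t n} \<subseteq> ?I"
      using t1[of "Suc i"] t1[of n] Suc(3) by auto
    then have "continuous_on ({0..t (Suc i)} \<times> {0..t n}) h"
      using h continuous_on_subset by blast
    then show ?case
      using primitive_along_glue[OF \<V> *] t0[of n] unfolding un int
      by (auto intro!: closed_Times connected_Times)
  qed
  from this[of n] show ?thesis
    using n0 by (simp add: t_def)
qed

lemma primitive_along_path:
  assumes \<V>: "local_primitives \<V>" and \<gamma>: "path \<gamma>"
  shows "\<exists>\<Phi>. primitive_along \<V> \<gamma> {0..1} \<Phi>"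
proof -
  have \<gamma>': "continuous_on {0..1} \<gamma>"
    using \<gamma> by (simp add: path_def)
  have *: "continuous_on ({0..1} \<times> {0..1::real}) (\<gamma> \<circ> fst)"
    unfolding o_def by (rule continuous_on_compose2[OF \<gamma>' continuous_on_fst[OF continuous_on_id]]) auto
  obtain \<Phi> where \<Phi>: "primitive_along \<V> (\<gamma> \<circ> fst) ({0..1} \<times> {0..1::real}) \<Phi>"
    by (rule exE[OF primitive_along_square[OF \<V> *]])
  have k: "continuous_on {0..1::real} (\<lambda>t. (t, 0::real))" "(\<lambda>t. (t, 0)) ` {0..1} \<subseteq> {0..1} \<times> {0..1::real}"
    by (auto intro!: continuous_intros)
  show ?thesis
    by (rule exI[of _ "\<Phi> \<circ> (\<lambda>t. (t, 0))"])
      (use primitive_along_compose[OF \<Phi> k] in \<open>simp only: o_def fst_conv\<close>)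
qed

text \<open>Contract the loop by a homotopy of loops and take a primitive along the whole square. Its
  increments along the two edges traced by the base point agree, as the homotopy takes the same
  values there; the increment along the edge of the constant loop is zero, and hence so is the
  one along the original loop.\<close>

lemma primitive_along_loop:
  assumes \<V>: "local_primitives \<V>" and sc: "simply_connected (UNIV :: 'm::topological_space set)"
    and \<gamma>: "path (\<gamma> :: real \<Rightarrow> 'm)" "\<gamma> 1 = \<gamma> 0" and \<Phi>: "primitive_along \<V> \<gamma> {0..1} \<Phi>"
  shows "\<Phi> 1 = \<Phi> 0"
proof -
  have "homotopic_loops UNIV \<gamma> (\<lambda>_. \<gamma> 0)"
    using sc \<gamma> unfolding simply_connected_def
    by (simp add: path_def pathstart_def pathfinish_def continuous_on_const)
  then obtain h where h: "continuous_on ({0..1::real} \<times> {0..1::real}) h"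
    "\<And>x. x \<in> {0..1} \<Longrightarrow> h (0, x) = \<gamma> x" "\<And>x. x \<in> {0..1} \<Longrightarrow> h (1, x) = \<gamma> 0"
    "\<And>t. t \<in> {0..1} \<Longrightarrow> h (t, 1) = h (t, 0)"
    unfolding homotopic_loops by (auto simp: pathstart_def pathfinish_def)
  obtain \<Theta> where \<Theta>: "primitive_along \<V> h ({0..1} \<times> {0..1}) \<Theta>"
    by (rule exE[OF primitive_along_square[OF \<V> h(1)]])
  have cont: "continuous_on {0..1} (h \<circ> k)" if "continuous_on {0..1} k" "k ` {0..1} \<subseteq> {0..1} \<times> {0..1}"
    for k :: "real \<Rightarrow> real \<times> real"
    by (rule continuous_on_compose[OF that(1) continuous_on_subset[OF h(1) that(2)]])
  have edge: "primitive_along \<V> (h \<circ> k) {0..1} (\<Theta> \<circ> k)"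
    if "continuous_on {0..1} k" "k ` {0..1} \<subseteq> {0..1} \<times> {0..1}" for k :: "real \<Rightarrow> real \<times> real"
    using primitive_along_compose[OF \<Theta> that] .
  have cong: "primitive_along \<V> g {0..1} \<Psi> \<longleftrightarrow> primitive_along \<V> f {0..1} \<Psi>"
    if "\<And>x. x \<in> {0..1::real} \<Longrightarrow> f x = g x" for f g :: "real \<Rightarrow> 'm" and \<Psi>
    using that unfolding primitive_along_def constant_on_def
    by (intro ball_cong ex_cong1 conj_cong) (auto simp: image_subset_iff)
  \<comment> \<open>\<open>k s\<close> is the loop at time \<open>s\<close> of the homotopy, \<open>l s\<close>
    the track of the point with parameter \<open>s\<close>.\<close>
  define k where "k = (\<lambda>(s :: real) (t :: real). (s, t))"
  define l where "l = (\<lambda>(s :: real) (t :: real). (t, s))"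
  have k: "continuous_on {0..1} (k s)" "continuous_on {0..1} (l s)" for s
    by (auto simp: k_def l_def intro!: continuous_intros)
  have im: "k s ` {0..1} \<subseteq> {0..1} \<times> {0..1}" "l s ` {0..1} \<subseteq> {0..1} \<times> {0..1}" if "s \<in> {0..1}" for s
    using that by (auto simp: k_def l_def)
  have "primitive_along \<V> \<gamma> {0..1} (\<Theta> \<circ> k 0)"
    using edge[OF k(1) im(1), of 0] cong[of \<gamma> "h \<circ> k 0"] h(2) by (auto simp: k_def)
  then have "\<Phi> 1 - \<Phi> 0 = (\<Theta> \<circ> k 0) 1 - (\<Theta> \<circ> k 0) 0"
    using primitive_along_unique[OF \<V> \<Phi>, of "\<Theta> \<circ> k 0" 0 1] \<gamma>(1) unfolding path_def by auto
  also have "\<dots> = (\<Theta> \<circ> l 1) 0 - (\<Theta> \<circ> l 0) 0"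
    by (simp add: k_def l_def)
  also have "\<dots> = (\<Theta> \<circ> l 1) 1 - (\<Theta> \<circ> l 0) 1"
  proof -
    have "primitive_along \<V> (h \<circ> l 0) {0..1} (\<Theta> \<circ> l 1)"
      using edge[OF k(2) im(2), of 1] cong[of "h \<circ> l 0" "h \<circ> l 1"] h(4) by (auto simp: l_def)
    from primitive_along_unique[OF \<V> this edge[OF k(2) im(2)] cont[OF k(2) im(2)], of 0 1]
    show ?thesis
      by simp
  qed
  also have "\<dots> = (\<Theta> \<circ> k 1) 1 - (\<Theta> \<circ> k 1) 0"
    by (simp add: k_def l_def)
  also have "\<dots> = 0"
  proof -
    obtain V F where "(V, F) \<in> \<V>" "\<gamma> 0 \<in> V"
      using \<V> unfolding local_primitives_def by blast
    then have "primitive_along \<V> (h \<circ> k 1) {0..1} (\<lambda>_. 0)"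
      unfolding primitive_along_def using h(3)
      by (intro ballI exI[of _ UNIV] exI[of _ V] exI[of _ F]) (auto simp: k_def constant_on_def)
    from primitive_along_unique[OF \<V> edge[OF k(1) im(1)[of 1]] this cont[OF k(1) im(1)[of 1]], of 0 1]
    show ?thesis
      by simp
  qed
  finally show ?thesis
    by simp
qed


section \<open>Linear differential equations and Liouville's formula\<close>

lemma linear_eq_sum_Basis:
  fixes A :: "'e::euclidean_space \<Rightarrow> 'f::real_vector"
  assumes "linear A"
  shows "A x = (\<Sum>b\<in>Basis. (x \<bullet> b) *\<^sub>R A b)"
proof -
  have "A x = A (\<Sum>b\<in>Basis. (x \<bullet> b) *\<^sub>R b)"
    by (simp add: euclidean_representation)
  also have "\<dots> = (\<Sum>b\<in>Basis. (x \<bullet> b) *\<^sub>R A b)"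
    by (simp add: linear_sum[OF assms] linear_scale[OF assms])
  finally show ?thesis .
qed

lemma continuous_on_linear_family:
  fixes A :: "'t::topological_space \<Rightarrow> 'e::euclidean_space \<Rightarrow> 'f::real_normed_vector"
  assumes "\<And>t. t \<in> S \<Longrightarrow> linear (A t)" "\<And>x. continuous_on S (\<lambda>t. A t x)" "continuous_on S Y"
  shows "continuous_on S (\<lambda>t. A t (Y t))"
proof -
  have "continuous_on S (\<lambda>t. \<Sum>b\<in>Basis. (Y t \<bullet> b) *\<^sub>R A t b)"
    by (intro continuous_intros assms)
  then show ?thesis
    by (rule continuous_on_cong[THEN iffD1, rotated -1]) (use assms(1) linear_eq_sum_Basis in metis)+
qed

lemma linear_family_bound:
  fixes A :: "'t::topological_space \<Rightarrow> 'e::euclidean_space \<Rightarrow> 'f::real_normed_vector"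
  assumes S: "compact S" and A: "\<And>t. t \<in> S \<Longrightarrow> linear (A t)" "\<And>x. continuous_on S (\<lambda>t. A t x)"
  obtains C where "C > 0" "\<And>t x. t \<in> S \<Longrightarrow> norm (A t x) \<le> C * norm x"
proof -
  have "\<exists>c. \<forall>t\<in>S. norm (A t b) \<le> c" for b
    using compact_imp_bounded[OF compact_continuous_image[OF A(2) S]] unfolding bounded_iff by auto
  then obtain c where c: "\<And>b t. t \<in> S \<Longrightarrow> norm (A t b) \<le> c b"
    by metis
  define C where "C = 1 + (\<Sum>b\<in>Basis. \<bar>c b\<bar>)"
  have "C > 0"
    unfolding C_def by (intro add_pos_nonneg sum_nonneg) auto
  moreover have "norm (A t x) \<le> C * norm x" if t: "t \<in> S" for t x
  proof -
    have "norm (A t x) \<le> (\<Sum>b\<in>Basis. norm ((x \<bullet> b) *\<^sub>R A t b))"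
      unfolding linear_eq_sum_Basis[OF A(1)[OF t], of x] by (rule norm_sum)
    also have "\<dots> \<le> (\<Sum>b\<in>Basis. \<bar>c b\<bar> * norm x)"
    proof (rule sum_mono)
      fix b :: 'e assume "b \<in> Basis"
      then have "\<bar>x \<bullet> b\<bar> \<le> norm x"
        by (rule Basis_le_norm)
      moreover have "norm (A t b) \<le> \<bar>c b\<bar>"
        using c[OF t, of b] by simp
      ultimately have "\<bar>x \<bullet> b\<bar> * norm (A t b) \<le> norm x * \<bar>c b\<bar>"
        by (intro mult_mono) auto
      then show "norm ((x \<bullet> b) *\<^sub>R A t b) \<le> \<bar>c b\<bar> * norm x"
        by (simp add: mult.commute)
    qed
    also have "\<dots> \<le> C * norm x"
      unfolding C_def by (simp add: sum_distrib_right distrib_right)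
    finally show ?thesis .
  qed
  ultimately show ?thesis
    using that by blast
qed

text \<open>These are the increments of the Picard iteration: for a linear equation the solution is the
  sum of the series whose terms arise from each other by integrating against \<open>A\<close>.\<close>

primrec picard :: "(real \<Rightarrow> 'e::euclidean_space \<Rightarrow> 'e) \<Rightarrow> 'e \<Rightarrow> nat \<Rightarrow> real \<Rightarrow> 'e" where
  "picard A x 0 = (\<lambda>_. x)"
| "picard A x (Suc k) = (\<lambda>t. integral {0..t} (\<lambda>s. A s (picard A x k s)))"

text \<open>The terms of the Picard series are bounded by those of an exponential series, and the derived
  series is \<open>A\<close> applied to the partial sums. Hence it converges uniformly as well
  and may be differentiated term by term on all of \<open>[0, 1]\<close>.\<close>

lemma linear_ode_exists:
  fixes A :: "real \<Rightarrow> 'e::euclidean_space \<Rightarrow> 'e"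
  assumes A: "\<And>t. t \<in> {0..1} \<Longrightarrow> linear (A t)" "\<And>x. continuous_on {0..1} (\<lambda>t. A t x)"
  shows "\<exists>X. X 0 = x \<and> (\<forall>t\<in>{0..1}. (X has_vector_derivative A t (X t)) (at t within {0..1}))"
proof -
  define Y where "Y = picard A x"
  have Y0: "Y 0 = (\<lambda>_. x)" and YS: "Y (Suc k) = (\<lambda>t. integral {0..t} (\<lambda>s. A s (Y k s)))" for k
    by (auto simp: Y_def)
  obtain C where C: "C > 0" "\<And>t x. t \<in> {0..1} \<Longrightarrow> norm (A t x) \<le> C * norm x"
    by (rule linear_family_bound[of "{0..1}" A]) (use A in auto)
  have contY: "continuous_on {0..1} (Y k)" for k
  proof (induction k)
    case 0
    then show ?case by (simp add: Y0)
  next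
    case (Suc k)
    have "(\<lambda>s. A s (Y k s)) integrable_on {0..1}"
      by (rule integrable_continuous_real[OF continuous_on_linear_family[OF A Suc]])
    then show ?case
      unfolding YS by (rule indefinite_integral_continuous_1)
  qed
  have contAY: "continuous_on {0..1} (\<lambda>s. A s (Y k s))" for k
    by (rule continuous_on_linear_family[OF A contY])
  \<comment> \<open>The derivative of each term is \<open>A\<close> applied to the previous one; the constant
    term has derivative \<open>0\<close>.\<close>
  define Y' where "Y' k t = (case k of 0 \<Rightarrow> 0 | Suc j \<Rightarrow> A t (Y j t))" for k t
  have derY: "(Y k has_vector_derivative Y' k t) (at t within {0..1})" if "t \<in> {0..1}" for k t
  proof (cases k)
    case 0
    then show ?thesis by (simp add: Y0 Y'_def)
  next
    case (Suc j)
    then show ?thesis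
      using integral_has_vector_derivative[OF contAY that] by (simp add: YS Y'_def)
  qed
  have bound: "norm (Y k t) \<le> (C ^ k / fact k * norm x) * t ^ k" if "t \<in> {0..1}" for k t
    using that
  proof (induction k arbitrary: t)
    case 0
    then show ?case by (simp add: Y0)
  next
    case (Suc k)
    let ?g = "\<lambda>s. (C ^ Suc k / fact k * norm x) * s ^ k"
    let ?G = "\<lambda>s. (C ^ Suc k / fact (Suc k) * norm x) * s ^ Suc k"
    have "(?G has_vector_derivative ?g s) (at s within {0..t})" for s
    proof -
      have "(?G has_real_derivative (C ^ Suc k / fact (Suc k) * norm x) * (real (Suc k) * s ^ k)) (at s within {0..t})"
        using DERIV_cmult[OF DERIV_pow[of "Suc k" s], where c = "C ^ Suc k / fact (Suc k) * norm x"]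
        by (simp only: diff_Suc_Suc diff_zero)
      moreover have "(C ^ Suc k / fact (Suc k) * norm x) * (real (Suc k) * s ^ k) = ?g s"
        unfolding fact_Suc by (simp add: field_simps del: of_nat_Suc)
      ultimately show ?thesis
        by (simp only: has_real_derivative_iff_has_vector_derivative)
    qed
    then have int: "(?g has_integral (?G t - ?G 0)) {0..t}"
      using Suc.prems by (intro fundamental_theorem_of_calculus) auto
    have sub: "{0..t} \<subseteq> {0..1}"
      using Suc.prems by auto
    have "norm (integral {0..t} (\<lambda>s. A s (Y k s))) \<le> integral {0..t} ?g"
    proof (rule integral_norm_bound_integral)
      show "(\<lambda>s. A s (Y k s)) integrable_on {0..t}"
        by (rule integrable_continuous_real[OF continuous_on_subset[OF contAY sub]])
      show "?g integrable_on {0..t}"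
        using int by blast
      fix s assume s: "s \<in> {0..t}"
      then have s1: "s \<in> {0..1}"
        using sub by blast
      have "norm (A s (Y k s)) \<le> C * norm (Y k s)"
        by (rule C(2)[OF s1])
      also have "\<dots> \<le> C * ((C ^ k / fact k * norm x) * s ^ k)"
        using C(1) Suc.IH[OF s1] by (intro mult_left_mono) auto
      finally show "norm (A s (Y k s)) \<le> ?g s"
        by (simp add: field_simps)
    qed
    then show ?case
      using integral_unique[OF int] by (simp add: YS del: fact_Suc)
  qed
  have bound1: "norm (Y k t) \<le> norm x * (C ^ k / fact k)" if t: "t \<in> {0..1}" for k t
  proof -
    have "(C ^ k / fact k * norm x) * t ^ k \<le> (C ^ k / fact k * norm x) * 1"
      using t C(1) by (intro mult_left_mono power_le_one) auto
    with bound[OF t, of k] show ?thesis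
      by (simp add: mult.commute)
  qed
  have summ: "summable (\<lambda>k. norm x * (C ^ k / fact k))"
    using summable_exp[of C] by (intro summable_mult) (simp add: field_simps)
  define X where "X t = (\<Sum>k. Y k t)" for t
  have unif: "uniform_limit {0..1} (\<lambda>n t. \<Sum>k<n. Y k t) X sequentially"
    unfolding X_def by (rule Weierstrass_m_test[OF bound1 summ])
  have "\<exists>g. \<forall>t\<in>{0..1}. (\<lambda>k. Y k t) sums g t \<and> (g has_derivative (\<lambda>h. h *\<^sub>R A t (X t))) (at t within {0..1})"
  proof (rule has_derivative_series[where f' = "\<lambda>k t h. h *\<^sub>R Y' k t"])
    show "convex {0..1::real}" "(0::real) \<in> {0..1}"
      by auto
    show "(Y k has_derivative (\<lambda>h. h *\<^sub>R Y' k t)) (at t within {0..1})" if "t \<in> {0..1}" for k t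
      using derY[OF that] by (simp add: has_vector_derivative_def)
    show "(\<lambda>k. Y k 0) sums (\<Sum>k. Y k 0)"
    proof (rule summable_sums)
      show "summable (\<lambda>k. Y k 0)"
        by (rule summable_comparison_test'[OF summ]) (use bound1[of 0] in auto)
    qed
    fix \<epsilon> :: real assume \<epsilon>: "\<epsilon> > 0"
    have "\<forall>\<^sub>F n in sequentially. \<forall>t\<in>{0..1}. dist (\<Sum>k<n. Y k t) (X t) < \<epsilon> / C"
      using unif \<epsilon> C(1) unfolding uniform_limit_iff by auto
    then obtain N where N: "\<And>n t. n \<ge> N \<Longrightarrow> t \<in> {0..1} \<Longrightarrow> dist (\<Sum>k<n. Y k t) (X t) < \<epsilon> / C"
      unfolding eventually_sequentially by blast
    have "norm ((\<Sum>i<n. h *\<^sub>R Y' i t) - h *\<^sub>R A t (X t)) \<le> \<epsilon> * norm h"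
      if n: "n \<ge> Suc N" and t: "t \<in> {0..1}" for n t h
    proof -
      obtain m where m: "n = Suc m" "m \<ge> N"
        using n by (cases n) auto
      have "(\<Sum>i<n. h *\<^sub>R Y' i t) - h *\<^sub>R A t (X t) = h *\<^sub>R ((\<Sum>i<m. A t (Y i t)) - A t (X t))"
        unfolding m by (simp add: sum.lessThan_Suc_shift Y'_def scaleR_sum_right scaleR_diff_right
            del: sum.lessThan_Suc)
      also have "\<dots> = h *\<^sub>R A t ((\<Sum>i<m. Y i t) - X t)"
        by (simp add: linear_diff[OF A(1)[OF t]] linear_sum[OF A(1)[OF t]])
      finally have "norm ((\<Sum>i<n. h *\<^sub>R Y' i t) - h *\<^sub>R A t (X t)) = norm h * norm (A t ((\<Sum>i<m. Y i t) - X t))"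
        by simp
      also have "\<dots> \<le> norm h * (C * norm ((\<Sum>i<m. Y i t) - X t))"
        by (intro mult_left_mono C(2)[OF t]) auto
      also have "\<dots> \<le> norm h * (C * (\<epsilon> / C))"
        using N[OF m(2) t] C(1) by (intro mult_left_mono) (auto simp: dist_norm)
      finally show ?thesis
        using C(1) by (simp add: mult.commute)
    qed
    then show "\<forall>\<^sub>F n in sequentially. \<forall>t\<in>{0..1}. \<forall>h.
        norm ((\<Sum>i<n. h *\<^sub>R Y' i t) - h *\<^sub>R A t (X t)) \<le> \<epsilon> * norm h"
      unfolding eventually_sequentially by blast
  qed
  then obtain g where g: "\<And>t. t \<in> {0..1} \<Longrightarrow> (\<lambda>k. Y k t) sums g t"
    "\<And>t. t \<in> {0..1} \<Longrightarrow> (g has_derivative (\<lambda>h. h *\<^sub>R A t (X t))) (at t within {0..1})"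
    by metis
  have gX: "g t = X t" if "t \<in> {0..1}" for t
    using g(1)[OF that] unfolding X_def by (simp add: sums_iff)
  have "(\<lambda>k. Y k 0) sums x"
  proof -
    have "Y k 0 = 0" if "k \<notin> {0}" for k
      using that by (cases k) (auto simp: YS)
    then show ?thesis
      using sums_finite[of "{0}" "\<lambda>k. Y k 0"] by (simp add: Y0)
  qed
  then have "g 0 = x"
    using g(1)[of 0] sums_unique2 by fastforce
  moreover have "(g has_vector_derivative A t (g t)) (at t within {0..1})" if "t \<in> {0..1}" for t
    using g(2)[OF that] gX[OF that] by (simp add: has_vector_derivative_def)
  ultimately show ?thesis
    by (intro exI[of _ g]) auto
qed

text \<open>For the difference \<open>Z\<close> of two solutions, \<open>exp (- 2 C t)
  \<bar>Z\<bar>\<^sup>2\<close> decreases once \<open>C\<close> bounds the operators, and it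
  starts at \<open>0\<close>.\<close>

lemma linear_ode_unique:
  fixes A :: "real \<Rightarrow> 'e::euclidean_space \<Rightarrow> 'e"
  assumes A: "\<And>t. t \<in> {0..1} \<Longrightarrow> linear (A t)" "\<And>x. continuous_on {0..1} (\<lambda>t. A t x)"
    and X: "\<And>t. t \<in> {0..1} \<Longrightarrow> (X has_vector_derivative A t (X t)) (at t within {0..1})"
    and Y: "\<And>t. t \<in> {0..1} \<Longrightarrow> (Y has_vector_derivative A t (Y t)) (at t within {0..1})"
    and 0: "X 0 = Y 0" and t: "t \<in> {0..1}"
  shows "X t = Y t"
proof -
  obtain C where C: "C > 0" "\<And>t x. t \<in> {0..1} \<Longrightarrow> norm (A t x) \<le> C * norm x"
    by (rule linear_family_bound[of "{0..1}" A]) (use A in auto)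
  define Z where "Z s = X s - Y s" for s
  have Z: "(Z has_vector_derivative A s (Z s)) (at s within {0..1})" if "s \<in> {0..1}" for s
    unfolding Z_def using has_vector_derivative_diff[OF X[OF that] Y[OF that]]
    by (simp add: linear_diff[OF A(1)[OF that]])
  define f where "f s = exp (- 2 * C * s) * (Z s \<bullet> Z s)" for s
  define f' where "f' s = exp (- 2 * C * s) * (2 * (Z s \<bullet> A s (Z s)) - 2 * C * (Z s \<bullet> Z s))" for s
  have f: "(f has_real_derivative f' s) (at s within {0..1})" if "s \<in> {0..1}" for s
  proof -
    have "((\<lambda>s. Z s \<bullet> Z s) has_derivative (\<lambda>h. Z s \<bullet> (h *\<^sub>R A s (Z s)) + (h *\<^sub>R A s (Z s)) \<bullet> Z s)) (at s within {0..1})"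
      using Z[OF that] unfolding has_vector_derivative_def by (intro has_derivative_inner)
    then have "((\<lambda>s. Z s \<bullet> Z s) has_real_derivative 2 * (Z s \<bullet> A s (Z s))) (at s within {0..1})"
      unfolding has_field_derivative_def by (rule has_derivative_eq_rhs) (auto simp: inner_commute)
    then show ?thesis
      unfolding f_def f'_def by (auto intro!: derivative_eq_intros simp: algebra_simps)
  qed
  have f'0: "f' s \<le> 0" if "s \<in> {0..1}" for s
  proof -
    have "Z s \<bullet> A s (Z s) \<le> norm (Z s) * norm (A s (Z s))"
      by (rule norm_cauchy_schwarz)
    also have "\<dots> \<le> norm (Z s) * (C * norm (Z s))"
      by (intro mult_left_mono C(2)[OF that]) auto
    also have "\<dots> = C * (Z s \<bullet> Z s)"
      by (simp add: dot_square_norm power2_eq_square)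
    finally show ?thesis
      unfolding f'_def by (intro mult_nonneg_nonpos) auto
  qed
  have "f t \<le> f 0"
  proof (cases "t = 0")
    case False
    have sub: "{0..t} \<subseteq> {0..1}"
      using t by auto
    show ?thesis
    proof (rule DERIV_nonpos_imp_decreasing_open[of 0 t f])
      show "0 \<le> t"
        using t by simp
      show "\<exists>y. (f has_real_derivative y) (at s) \<and> y \<le> 0" if s: "0 < s" "s < t" for s
      proof -
        have "s \<in> interior {0..1}" "s \<in> {0..1}"
          using s t by auto
        then show ?thesis
          using f[of s] f'0[of s] at_within_interior[of s "{0..1}"] by metis
      qed
      show "continuous_on {0..t} f"
        using DERIV_continuous_on[OF f] sub continuous_on_subset by blast
    qed
  qed simp
  also have "f 0 = 0"
    by (simp add: f_def Z_def 0)
  finally have "Z t \<bullet> Z t \<le> 0"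
    by (simp add: f_def mult_le_0_iff)
  then have "Z t = 0"
    by (metis inner_ge_zero inner_eq_zero_iff order_antisym)
  then show ?thesis
    by (simp add: Z_def)
qed

text \<open>Jacobi's formula for a solution of \<open>M' = B M\<close>. Differentiating one row at a time
  replaces row \<open>k\<close> of \<open>M\<close> by row \<open>k\<close> of \<open>B
  M\<close>, a combination of the rows of \<open>M\<close> of which only the multiple
  \<open>B\<^sub>k\<^sub>k\<close> of row \<open>k\<close> itself contributes to the
  determinant.\<close>

lemma has_derivative_det:
  fixes M :: "real \<Rightarrow> 'k::real_normed_field^'n^'n"
  assumes M: "(M has_vector_derivative B ** M t) (at t within S)"
  shows "((\<lambda>s. det (M s)) has_vector_derivative trace B * det (M t)) (at t within S)"
proof -
  have entry: "((\<lambda>s. M s $ i $ j) has_derivative (\<lambda>h. h *\<^sub>R (B ** M t) $ i $ j)) (at t within S)" for i j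
    using bounded_linear.has_derivative[OF bounded_linear_vec_nth
        bounded_linear.has_derivative[OF bounded_linear_vec_nth M[unfolded has_vector_derivative_def]]]
    by simp
  let ?P = "{p. p permutes (UNIV :: 'n set)}"
  let ?row = "\<lambda>k v. (\<chi> i. if i = k then v else M t $ i) :: 'k^'n^'n"
  have "((\<lambda>s. det (M s)) has_derivative (\<lambda>h. \<Sum>p\<in>?P. of_int (sign p) *
      (\<Sum>k\<in>UNIV. h *\<^sub>R (B ** M t) $ k $ p k * (\<Prod>j\<in>UNIV - {k}. M t $ j $ p j)))) (at t within S)"
    unfolding det_def
    by (intro has_derivative_sum has_derivative_mult_right has_derivative_prod entry)
  moreover have "(\<Sum>p\<in>?P. of_int (sign p) *
      (\<Sum>k\<in>UNIV. h *\<^sub>R (B ** M t) $ k $ p k * (\<Prod>j\<in>UNIV - {k}. M t $ j $ p j))) = h *\<^sub>R (trace B * det (M t))" for h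
  proof -
    have "(\<Sum>p\<in>?P. of_int (sign p) *
      (\<Sum>k\<in>UNIV. h *\<^sub>R (B ** M t) $ k $ p k * (\<Prod>j\<in>UNIV - {k}. M t $ j $ p j)))
      = h *\<^sub>R (\<Sum>k\<in>UNIV. \<Sum>p\<in>?P. of_int (sign p) * ((B ** M t) $ k $ p k * (\<Prod>j\<in>UNIV - {k}. M t $ j $ p j)))"
      by (subst sum.swap) (simp add: scaleR_sum_right sum_distrib_left)
    also have "(\<Sum>k\<in>UNIV. \<Sum>p\<in>?P. of_int (sign p) * ((B ** M t) $ k $ p k * (\<Prod>j\<in>UNIV - {k}. M t $ j $ p j)))
      = (\<Sum>k\<in>UNIV. det (?row k ((B ** M t) $ k)))"
    proof (rule sum.cong[OF refl])
      fix k
      have "(\<Prod>j\<in>UNIV. ?row k ((B ** M t) $ k) $ j $ p j) = (B ** M t) $ k $ p k * (\<Prod>j\<in>UNIV - {k}. M t $ j $ p j)" for p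
        by (subst prod.remove[of _ k]) (auto intro!: prod.cong)
      then show "(\<Sum>p\<in>?P. of_int (sign p) * ((B ** M t) $ k $ p k * (\<Prod>j\<in>UNIV - {k}. M t $ j $ p j)))
          = det (?row k ((B ** M t) $ k))"
        unfolding det_def by simp
    qed
    also have "\<dots> = (\<Sum>k\<in>UNIV. B $ k $ k * det (M t))"
    proof (rule sum.cong[OF refl])
      fix k
      have eq: "(B ** M t) $ k = (\<Sum>l\<in>UNIV. B $ k $ l *s (M t $ l))"
        by (simp add: vec_eq_iff matrix_matrix_mult_def)
      have "det (?row k ((B ** M t) $ k)) = (\<Sum>l\<in>UNIV. B $ k $ l * det (?row k (M t $ l)))"
        unfolding eq
        using det_linear_row_sum[where S = UNIV and k = k and a = "\<lambda>_ l. B $ k $ l *s (M t $ l)" and c = "\<lambda>i. M t $ i"]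
        by (simp add: det_row_mul)
      also have "\<dots> = (\<Sum>l\<in>UNIV. if l = k then B $ k $ k * det (M t) else 0)"
      proof (rule sum.cong[OF refl])
        fix l
        show "B $ k $ l * det (?row k (M t $ l)) = (if l = k then B $ k $ k * det (M t) else 0)"
        proof (cases "l = k")
          case True
          then have "?row k (M t $ l) = M t"
            by (auto simp: vec_eq_iff)
          then show ?thesis
            using True by simp
        next
          case False
          have "det (?row k (M t $ l)) = 0"
            by (rule det_identical_rows[OF False]) (use False in \<open>simp add: row_def vec_eq_iff\<close>)
          then show ?thesis
            using False by simp
        qed
      qed
      finally show "det (?row k ((B ** M t) $ k)) = B $ k $ k * det (M t)"
        by simp
    qed
    finally show ?thesis
      by (simp add: trace_def sum_distrib_right)
  qed
  ultimately show ?thesis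
    by (simp add: has_vector_derivative_def)
qed

lemma matrix_vector_mult_scaleR':
  fixes A :: "'k::real_normed_field^'n^'m"
  shows "A *v (r *\<^sub>R a) = r *\<^sub>R (A *v a)" "(r *\<^sub>R A) *v a = r *\<^sub>R (A *v a)"
  by (simp_all add: vec_eq_iff matrix_vector_mult_def scaleR_sum_right)

text \<open>Coordinates on a space that splits into two halves exchanged by \<open>J\<close>. The scalars
  \<open>'k\<close> are the real numbers for the Lie algebra and the complex numbers for its
  complexification, so that both cases share one theory of block diagonal endomorphisms and
  their transport.\<close>

locale block_space =
  fixes \<Phi> :: "'k::{real_normed_field, euclidean_space}^'n \<Rightarrow> 'v::euclidean_space" and J :: "'v \<Rightarrow> 'v"
  assumes lin\<Phi>: "linear \<Phi>" and linJ: "linear J"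
    and bij_join: "bij (\<lambda>(a, b). \<Phi> a + J (\<Phi> b))"
begin

definition join :: "('k^'n) \<times> ('k^'n) \<Rightarrow> 'v" where
  "join = (\<lambda>(a, b). \<Phi> a + J (\<Phi> b))"

definition split :: "'v \<Rightarrow> ('k^'n) \<times> ('k^'n)" where
  "split = inv_into UNIV join"

lemma join_split [simp]: "join (split w) = w" and split_join [simp]: "split (join p) = p"
  using bij_join unfolding split_def join_def
  by (simp_all add: bij_is_surj bij_is_inj surj_f_inv_f inv_f_f)

lemma linear_join: "linear join"
  unfolding join_def
  by (intro linearI) (auto simp: linear_add[OF lin\<Phi>] linear_add[OF linJ] linear_scale[OF lin\<Phi>] linear_scale[OF linJ]
      scaleR_add_right split: prod.splits)

lemma linear_split: "linear split"
proof (rule linearI)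
  show "split (x + y) = split x + split y" for x y
    by (metis join_split split_join linear_add[OF linear_join])
  show "split (r *\<^sub>R x) = r *\<^sub>R split x" for r x
    by (metis join_split split_join linear_scale[OF linear_join])
qed

definition block :: "'k^'n^'n \<Rightarrow> 'v \<Rightarrow> 'v" where
  "block A w = join (A *v fst (split w), A *v snd (split w))"

lemma block_join: "block A (join (a, b)) = join (A *v a, A *v b)"
  by (simp add: block_def)

lemma block_mat_1: "block (mat 1) = id"
  by (simp add: block_def fun_eq_iff)

lemma block_mult: "block (A ** B) = block A \<circ> block B"
  by (simp add: block_def fun_eq_iff matrix_vector_mul_assoc)

lemma linear_block: "linear (block A)"
  unfolding block_def
  by (intro linearI) (simp_all add: linear_add[OF linear_split] linear_scale[OF linear_split]
      matrix_vector_right_distrib matrix_vector_mult_scaleR' linear_add[OF linear_join, symmetric]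
      linear_scale[OF linear_join, symmetric])

lemma linear_block_matrix: "linear (\<lambda>A. block A w)"
  unfolding block_def
  by (intro linearI) (simp_all add: matrix_vector_mult_add_rdistrib matrix_vector_mult_scaleR'
      linear_add[OF linear_join, symmetric] linear_scale[OF linear_join, symmetric])

end

text \<open>The algebraic form of a left-invariant connection that preserves the splitting and acts in the
  same way on both halves.\<close>

locale block_connection = block_space \<Phi> J
  for \<Phi> :: "'k::{real_normed_field, euclidean_space}^'n \<Rightarrow> 'v::euclidean_space" and J +
  fixes D :: "'v \<Rightarrow> 'v \<Rightarrow> 'v" and \<Gamma> :: "'v \<Rightarrow> 'k^'n^'n"
  assumes D_block: "D x = block (\<Gamma> x)" and lin\<Gamma>: "linear \<Gamma>"
begin

text \<open>The equation of parallel transport in the left-invariant trivialisation of the tangent bundle,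
  along a curve with velocity \<open>u\<close>.\<close>

definition solves :: "(real \<Rightarrow> 'v) \<Rightarrow> (real \<Rightarrow> 'v) \<Rightarrow> bool" where
  "solves u X \<longleftrightarrow> (\<forall>t\<in>{0..1}. (X has_vector_derivative - D (u t) (X t)) (at t within {0..1}))"

text \<open>The fundamental solution has values in matrices acting on both halves at once, so it is block
  diagonal; Liouville's formula gives the determinant of the block.\<close>

lemma transport:
  assumes u: "continuous_on {0..1} u"
  shows "\<exists>A. det A = exp (- integral {0..1} (\<lambda>t. trace (\<Gamma> (u t)))) \<and>
    (\<forall>w. \<exists>X. solves u X \<and> X 0 = w) \<and> (\<forall>X. solves u X \<longrightarrow> X 1 = block A (X 0))"
proof -
  have contG: "continuous_on {0..1} (\<lambda>t. - \<Gamma> (u t))"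
    by (intro continuous_intros linear_continuous_on_compose[OF u lin\<Gamma>])
  have "\<exists>M. M 0 = mat 1 \<and> (\<forall>t\<in>{0..1}. (M has_vector_derivative - \<Gamma> (u t) ** M t) (at t within {0..1}))"
  proof (rule linear_ode_exists)
    show "linear (\<lambda>M :: 'k^'n^'n. - \<Gamma> (u t) ** M)" for t
      by (intro linearI) (auto simp: vec_eq_iff matrix_matrix_mult_def sum_subtractf sum_negf distrib_left scaleR_sum_right)
    have *: "linear (\<lambda>C :: 'k^'n^'n. C ** B)" for B :: "'k^'n^'n"
      by (intro linearI) (auto simp: vec_eq_iff matrix_matrix_mult_def sum.distrib distrib_right scaleR_sum_right)
    show "continuous_on {0..1} (\<lambda>t. - \<Gamma> (u t) ** B)" for B :: "'k^'n^'n"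
      using linear_continuous_on_compose[OF contG *[of B]] by simp
  qed
  then obtain M where M: "M 0 = mat 1"
    "\<And>t. t \<in> {0..1} \<Longrightarrow> (M has_vector_derivative - \<Gamma> (u t) ** M t) (at t within {0..1})"
    by metis
  have sol: "solves u (\<lambda>t. block (M t) w)" for w
    unfolding solves_def
  proof
    fix t :: real assume t: "t \<in> {0..1}"
    have "((\<lambda>t. block (M t) w) has_vector_derivative block (- \<Gamma> (u t) ** M t) w) (at t within {0..1})"
      by (rule bounded_linear.has_vector_derivative[OF _ M(2)[OF t]])
        (simp add: linear_conv_bounded_linear[symmetric] linear_block_matrix)
    moreover have "block (- \<Gamma> (u t) ** M t) w = - D (u t) (block (M t) w)"
      using linear_neg[OF linear_block_matrix] by (simp add: block_mult D_block)
    ultimately show "((\<lambda>t. block (M t) w) has_vector_derivative - D (u t) (block (M t) w)) (at t within {0..1})"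
      by simp
  qed
  have init: "block (M 0) w = w" for w
    by (simp add: M(1) block_mat_1)
  have uniq: "X 1 = block (M 1) (X 0)" if X: "solves u X" for X
  proof (rule linear_ode_unique[where A = "\<lambda>t w. - D (u t) w" and Y = "\<lambda>t. block (M t) (X 0)"])
    show "linear (\<lambda>w. - D (u t) w)" for t
      by (intro linear_compose_neg) (simp add: D_block linear_block)
    have "linear (\<lambda>x. D x w)" for w
      unfolding D_block using linear_compose[OF lin\<Gamma> linear_block_matrix] by (simp add: o_def)
    then show "continuous_on {0..1} (\<lambda>t. - D (u t) w)" for w
      by (intro continuous_intros linear_continuous_on_compose[OF u])
    show "X 0 = block (M 0) (X 0)"
      by (simp add: init)
  qed (use X sol[of "X 0"] in \<open>auto simp: solves_def\<close>)
  \<comment> \<open>Both sides of Liouville's formula, as functions of the upper end, solve \<open>y' = - \<tau>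
    y\<close> with \<open>y 0 = 1\<close>.\<close>
  define \<tau> where "\<tau> t = trace (\<Gamma> (u t))" for t
  have lintr: "linear (\<lambda>x. trace (\<Gamma> x))"
    by (intro linearI) (auto simp: linear_add[OF lin\<Gamma>] linear_scale[OF lin\<Gamma>] trace_def sum.distrib scaleR_sum_right)
  have cont\<tau>: "continuous_on {0..1} \<tau>"
    unfolding \<tau>_def by (rule linear_continuous_on_compose[OF u lintr])
  have "det (M 1) = exp (- integral {0..1} \<tau>)"
  proof (rule linear_ode_unique[where A = "\<lambda>t y. - \<tau> t * y" and X = "\<lambda>t. det (M t)" and t = 1])
    show "linear (\<lambda>y. - \<tau> t * y)" for t
      by (intro linearI) (auto simp: algebra_simps)
    show "continuous_on {0..1} (\<lambda>t. - \<tau> t * y)" for y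
      by (intro continuous_intros cont\<tau>)
    show "((\<lambda>t. det (M t)) has_vector_derivative - \<tau> t * det (M t)) (at t within {0..1})" if "t \<in> {0..1}" for t
    proof -
      have "trace (- \<Gamma> (u t)) = - \<tau> t"
        by (simp add: \<tau>_def trace_def sum_negf)
      then show ?thesis
        using has_derivative_det[OF M(2)[OF that]] by simp
    qed
    show "((\<lambda>t. exp (- integral {0..t} \<tau>)) has_vector_derivative - \<tau> t * exp (- integral {0..t} \<tau>)) (at t within {0..1})"
      if "t \<in> {0..1}" for t
    proof -
      have 1: "((\<lambda>t. - integral {0..t} \<tau>) has_vector_derivative - \<tau> t) (at t within {0..1})"
        by (intro has_vector_derivative_minus integral_has_vector_derivative cont\<tau> that)
      have "((\<lambda>t. exp (- integral {0..t} \<tau>)) has_vector_derivative (- \<tau> t * exp (- integral {0..t} \<tau>))) (at t within {0..1})"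
        using field_vector_diff_chain_within[OF 1 DERIV_subset[OF DERIV_exp]] by (simp add: o_def)
      then show ?thesis .
    qed
    show "det (M 0) = exp (- integral {0..0} \<tau>)"
      by (simp add: M(1))
  qed simp
  moreover have "\<forall>w. \<exists>X. solves u X \<and> X 0 = w"
    using sol init by (intro allI exI[of _ "\<lambda>t. block (M t) w" for w]) auto
  ultimately show ?thesis
    using uniq by (intro exI[of _ "M 1"]) (simp add: \<tau>_def[abs_def])
qed

end


section \<open>Gradients and symmetric derivatives\<close>

text \<open>The map \<open>(y, w) \<mapsto> (y, T y w)\<close> is differentiable with invertible
  derivative and has the explicit inverse \<open>(y, u) \<mapsto> (y, sol y u)\<close>. The
  inverse function theorem differentiates this inverse and thereby expresses \<open>B'\<close>
  through \<open>sol\<close>, which shows that it is continuous.\<close>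

lemma linear_system_solution_C1:
  fixes T :: "'e::euclidean_space \<Rightarrow> 'e \<Rightarrow> 'e"
  assumes S: "open S" and T: "\<And>y. y \<in> S \<Longrightarrow> linear (T y)" "\<And>y. y \<in> S \<Longrightarrow> inj (T y)"
    and smooth: "\<And>w. smooth_on S (\<lambda>y. T y w)"
  obtains B B' where "\<And>y. y \<in> S \<Longrightarrow> T y (B y) = a" "\<And>y. y \<in> S \<Longrightarrow> (B has_derivative B' y) (at y)"
    "\<And>v. continuous_on S (\<lambda>y. B' y v)"
proof -
  define sol where "sol y = inv_into UNIV (T y)" for y
  have surj: "surj (T y)" if "y \<in> S" for y
    by (rule linear_injective_imp_surjective[OF T(1)[OF that] T(2)[OF that]]) simp
  have T_sol: "T y (sol y u) = u" if "y \<in> S" for y u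
    unfolding sol_def using surj[OF that] by (simp add: surj_f_inv_f)
  have sol_T: "sol y (T y w) = w" if "y \<in> S" for y w
    unfolding sol_def using T(2)[OF that] by (simp add: inv_f_f)
  define T' where "T' b y = frechet_derivative (\<lambda>y. T y b) (at y)" for b y
  have T': "((\<lambda>y. T y b) has_derivative T' b y) (at y)" if "y \<in> S" for b y
    unfolding T'_def by (rule smooth_on_derivative[OF smooth that])
  have T'_cont: "continuous_on S (\<lambda>y. T' b y v)" for b v
    unfolding T'_def by (rule smooth_on_continuous[OF smooth_on_frechet_derivative[OF smooth]])
  define \<Psi> where "\<Psi> p = (fst p, T (fst p) (snd p))" for p
  define g where "g p = (fst p, sol (fst p) (snd p))" for p
  let ?D = "\<lambda>y w h. \<Sum>b\<in>Basis. (w \<bullet> b) *\<^sub>R T' b y h"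
  have open_SU: "open (S \<times> (UNIV :: 'e set))"
    using S by (simp add: open_Times)
  have der\<Psi>: "(\<Psi> has_derivative (\<lambda>q. (fst q, T y (snd q) + ?D y w (fst q)))) (at (y, w))" if y: "y \<in> S" for y w
  proof -
    have "((\<lambda>p. T (fst p) b) has_derivative (\<lambda>q. T' b y (fst q))) (at (y, w))" for b
      using diff_chain_at[of fst fst "(y, w)" "\<lambda>y. T y b" "T' b y"] T'[OF y]
      by (simp add: o_def has_derivative_fst[OF has_derivative_ident])
    then have "((\<lambda>p. \<Sum>b\<in>Basis. (snd p \<bullet> b) *\<^sub>R T (fst p) b) has_derivative
        (\<lambda>q. \<Sum>b\<in>Basis. (snd (y, w) \<bullet> b) *\<^sub>R T' b y (fst q) + (snd q \<bullet> b) *\<^sub>R T (fst (y, w)) b)) (at (y, w))"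
      by (intro has_derivative_sum has_derivative_scaleR has_derivative_inner_left has_derivative_snd has_derivative_ident)
    then have "((\<lambda>p. (fst p, \<Sum>b\<in>Basis. (snd p \<bullet> b) *\<^sub>R T (fst p) b)) has_derivative
        (\<lambda>q. (fst q, \<Sum>b\<in>Basis. (snd (y, w) \<bullet> b) *\<^sub>R T' b y (fst q) + (snd q \<bullet> b) *\<^sub>R T (fst (y, w)) b))) (at (y, w))"
      by (intro has_derivative_Pair has_derivative_fst has_derivative_ident)
    then have "(\<Psi> has_derivative
        (\<lambda>q. (fst q, \<Sum>b\<in>Basis. (snd (y, w) \<bullet> b) *\<^sub>R T' b y (fst q) + (snd q \<bullet> b) *\<^sub>R T (fst (y, w)) b))) (at (y, w))"
    proof (rule has_derivative_transform_within_open)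
      show "open (S \<times> (UNIV :: 'e set))"
        by (rule open_SU)
      show "(y, w) \<in> S \<times> UNIV"
        using y by simp
      show "(fst p, \<Sum>b\<in>Basis. (snd p \<bullet> b) *\<^sub>R T (fst p) b) = \<Psi> p" if "p \<in> S \<times> UNIV" for p
        using linear_eq_sum_Basis[OF T(1)[of "fst p"], of "snd p"] that by (auto simp: \<Psi>_def)
    qed
    moreover have "(\<Sum>b\<in>Basis. (snd (y, w) \<bullet> b) *\<^sub>R T' b y h + (k \<bullet> b) *\<^sub>R T (fst (y, w)) b) = T y k + ?D y w h" for h k
      using linear_eq_sum_Basis[OF T(1)[OF y], of k] by (simp add: sum.distrib)
    ultimately show ?thesis
      by simp
  qed
  have derg: "(g has_derivative (\<lambda>q. (fst q, sol y (snd q - ?D y (sol y u) (fst q))))) (at (y, u))" if y: "y \<in> S" for y u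
  proof -
    have "(g has_derivative (\<lambda>q. (fst q, sol y (snd q - ?D y (sol y u) (fst q))))) (at (\<Psi> (y, sol y u)))"
    proof (rule has_derivative_inverse_strong[OF open_SU, where f = \<Psi> and x = "(y, sol y u)"])
      show "(y, sol y u) \<in> S \<times> UNIV"
        using y by simp
      show "continuous_on (S \<times> UNIV) \<Psi>"
        using der\<Psi> by (intro continuous_at_imp_continuous_on ballI) (auto intro: has_derivative_continuous)
      show "g (\<Psi> p) = p" if "p \<in> S \<times> UNIV" for p
        using that sol_T by (auto simp: g_def \<Psi>_def)
      show "(\<Psi> has_derivative (\<lambda>q. (fst q, T y (snd q) + ?D y (sol y u) (fst q)))) (at (y, sol y u))"
        by (rule der\<Psi>[OF y])
      show "(\<lambda>q. (fst q, T y (snd q) + ?D y (sol y u) (fst q))) \<circ>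
          (\<lambda>q. (fst q, sol y (snd q - ?D y (sol y u) (fst q)))) = id"
        using T_sol[OF y] by (simp add: fun_eq_iff)
    qed
    then show ?thesis
      using T_sol[OF y] by (simp add: \<Psi>_def)
  qed
  have sol_cont: "continuous_on (S \<times> UNIV) (\<lambda>p. sol (fst p) (snd p))"
  proof -
    have "continuous_on (S \<times> UNIV) g"
      using derg by (intro continuous_at_imp_continuous_on ballI) (auto intro: has_derivative_continuous)
    then have "continuous_on (S \<times> UNIV) (\<lambda>p. snd (g p))"
      by (rule continuous_on_snd)
    then show ?thesis
      by (simp add: g_def)
  qed
  have derB: "((\<lambda>y. sol y a) has_derivative (\<lambda>h. sol y (0 - ?D y (sol y a) h))) (at y)" if y: "y \<in> S" for y
  proof -
    have 1: "((\<lambda>y. (y, a)) has_derivative (\<lambda>h. (h, 0))) (at y)"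
      by (intro has_derivative_Pair has_derivative_ident has_derivative_const)
    from has_derivative_snd[OF diff_chain_at[OF 1 derg[OF y]]] show ?thesis
      by (simp add: g_def o_def)
  qed
  have contB: "continuous_on S (\<lambda>y. sol y a)"
    using derB by (intro continuous_at_imp_continuous_on ballI) (auto intro: has_derivative_continuous)
  show ?thesis
  proof (rule that)
    show "T y (sol y a) = a" if "y \<in> S" for y
      by (rule T_sol[OF that])
    show "((\<lambda>y. sol y a) has_derivative (\<lambda>h. sol y (0 - ?D y (sol y a) h))) (at y)" if "y \<in> S" for y
      by (rule derB[OF that])
    show "continuous_on S (\<lambda>y. sol y (0 - ?D y (sol y a) v))" for v
    proof -
      have 1: "continuous_on S (\<lambda>y. (y, 0 - ?D y (sol y a) v))"
        by (intro continuous_intros contB T'_cont)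
      have 2: "(\<lambda>y. (y, 0 - ?D y (sol y a) v)) ` S \<subseteq> S \<times> UNIV"
        by auto
      from continuous_on_compose2[OF sol_cont 1 2] show ?thesis
        by simp
    qed
  qed
qed

text \<open>The Poincare lemma for one-forms on a convex set, in terms of the vector field
  \<open>B\<close> dual to the form: closedness is symmetry of the derivative of
  \<open>B\<close>. The primitive is the integral of \<open>B\<close> along the segment from the
  base point \<open>z\<close>.\<close>

lemma poincare_lemma:
  fixes B :: "'e::euclidean_space \<Rightarrow> 'e"
  assumes S: "open S" "convex S" "z \<in> S"
    and B: "\<And>y. y \<in> S \<Longrightarrow> (B has_derivative B' y) (at y)"
    and cont: "\<And>v. continuous_on S (\<lambda>y. B' y v)"
    and sym: "\<And>y u v. y \<in> S \<Longrightarrow> B' y u \<bullet> v = B' y v \<bullet> u"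
  shows "\<exists>F :: 'e \<Rightarrow> real. \<forall>y\<in>S. (F has_derivative (\<lambda>h. B y \<bullet> h)) (at y)"
proof -
  define l where "l y t = z + t *\<^sub>R (y - z)" for y :: 'e and t :: real
  have lS: "l y t \<in> S" if "y \<in> S" "t \<in> {0..1}" for y t
  proof -
    have "(1 - t) *\<^sub>R z + t *\<^sub>R y \<in> S"
      using S that by (intro convexD) auto
    then show ?thesis
      by (simp add: l_def algebra_simps)
  qed
  have contB: "continuous_on S B"
    using B by (intro continuous_at_imp_continuous_on ballI) (auto intro: has_derivative_continuous)
  have contl: "continuous_on (S \<times> {0..1}) (\<lambda>p. l (fst p) (snd p))"
    unfolding l_def by (intro continuous_intros)
  have lS': "(\<lambda>p. l (fst p) (snd p)) ` (S \<times> {0..1}) \<subseteq> S"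
    using lS by auto
  \<comment> \<open>\<open>w y t\<close> is the derivative of \<open>t *\<^sub>R B (l y t)\<close> with respect
    to \<open>t\<close>. By symmetry of \<open>B'\<close> it is also the gradient in
    \<open>y\<close> of the integrand \<open>f y t\<close> below, so the gradient of the
    primitive is the integral of \<open>w\<close>, which telescopes to \<open>B y\<close>.\<close>
  define w where "w y t = t *\<^sub>R B' (l y t) (y - z) + B (l y t)" for y t
  have contw: "continuous_on (S \<times> {0..1}) (\<lambda>p. w (fst p) (snd p))"
  proof -
    have c1: "continuous_on (S \<times> {0..1}) (\<lambda>p. B' (l (fst p) (snd p)) (fst p - z))"
    proof (rule continuous_on_linear_family[where A = "\<lambda>p. B' (l (fst p) (snd p))" and Y = "\<lambda>p. fst p - z"])
      show "linear (B' (l (fst p) (snd p)))" if "p \<in> S \<times> {0..1}" for p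
        using B lS' that has_derivative_linear by blast
      show "continuous_on (S \<times> {0..1}) (\<lambda>p. B' (l (fst p) (snd p)) x)" for x
        by (rule continuous_on_compose2[OF cont contl lS'])
    qed (intro continuous_intros)
    show ?thesis
      unfolding w_def
      by (rule continuous_on_add[OF continuous_on_scaleR[OF continuous_on_snd[OF continuous_on_id] c1]
            continuous_on_compose2[OF contB contl lS']])
  qed
  define f where "f y t = B (l y t) \<bullet> (y - z)" for y t
  have derl: "((\<lambda>y. l y t) has_derivative (\<lambda>h. t *\<^sub>R h)) (at y within S)" for y t
    unfolding l_def by (auto intro!: derivative_eq_intros)
  have derf: "((\<lambda>y. f y t) has_derivative blinfun_apply (blinfun_inner_left (w y t))) (at y within S)"
    if y: "y \<in> S" and t: "t \<in> cbox 0 1" for y t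
  proof -
    have t': "t \<in> {0..1}"
      using t by simp
    have lin: "linear (B' (l y t))"
      using B[OF lS[OF y t']] by (rule has_derivative_linear)
    have "((\<lambda>y. B (l y t)) has_derivative (\<lambda>h. B' (l y t) (t *\<^sub>R h))) (at y within S)"
      using diff_chain_within[OF derl has_derivative_at_withinI[OF B[OF lS[OF y t']]]] by (simp add: o_def)
    then have "((\<lambda>y. f y t) has_derivative (\<lambda>h. B (l y t) \<bullet> (h - 0) + B' (l y t) (t *\<^sub>R h) \<bullet> (y - z))) (at y within S)"
      unfolding f_def by (intro has_derivative_inner has_derivative_diff has_derivative_ident has_derivative_const)
    moreover have "B (l y t) \<bullet> (h - 0) + B' (l y t) (t *\<^sub>R h) \<bullet> (y - z) = blinfun_apply (blinfun_inner_left (w y t)) h" for h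
      using sym[OF lS[OF y t'], of h "y - z"]
      by (simp add: w_def linear_scale[OF lin] inner_add_left inner_add_right inner_commute)
    ultimately show ?thesis
      by simp
  qed
  define F where "F y = integral (cbox 0 1) (f y)" for y
  have "(F has_derivative (\<lambda>h. B y \<bullet> h)) (at y)" if y: "y \<in> S" for y
  proof -
    have contw1: "continuous_on {0..1} (w y)"
    proof -
      have 1: "continuous_on {0..1} (\<lambda>t. (y, t))"
        by (intro continuous_intros)
      have 2: "(\<lambda>t. (y, t)) ` {0..1} \<subseteq> S \<times> {0..1}"
        using y by auto
      from continuous_on_compose2[OF contw 1 2] show ?thesis
        by simp
    qed
    have "(F has_derivative blinfun_apply (integral (cbox 0 1) (\<lambda>t. blinfun_inner_left (w y t)))) (at y within S)"
      unfolding F_def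
    proof (rule leibniz_rule[OF derf])
      show "f x integrable_on cbox 0 1" if "x \<in> S" for x
      proof -
        have "continuous_on {0..1} (\<lambda>t. B (l x t))"
        proof (rule continuous_on_compose2[OF contB])
          show "continuous_on {0..1} (\<lambda>t. l x t)"
            unfolding l_def by (intro continuous_intros)
        qed (use lS[OF that] in auto)
        then have "continuous_on {0..1} (f x)"
          unfolding f_def by (intro continuous_intros)
        then show ?thesis
          using integrable_continuous_real by simp
      qed
      have "continuous_on (S \<times> {0..1}) (\<lambda>p. blinfun_inner_left (w (fst p) (snd p)))"
        by (rule bounded_linear.continuous_on[OF bounded_linear_blinfun_inner_left contw])
      then show "continuous_on (S \<times> cbox 0 1) (\<lambda>(y, t). blinfun_inner_left (w y t))"
        by (simp add: case_prod_beta)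
    qed (use y S in auto)
    moreover have "integral (cbox 0 1) (\<lambda>t. blinfun_inner_left (w y t)) = blinfun_inner_left (integral (cbox 0 1) (w y))"
      using integral_linear[OF integrable_continuous_real[OF contw1] bounded_linear_blinfun_inner_left] by (simp add: o_def)
    moreover have "integral (cbox 0 1) (w y) = B y"
    proof -
      have "((\<lambda>t. t *\<^sub>R B (l y t)) has_vector_derivative w y t) (at t within {0..1})" if t: "t \<in> {0..1}" for t
      proof -
        have 1: "((\<lambda>t. l y t) has_vector_derivative (y - z)) (at t within {0..1})"
          unfolding l_def by (auto intro!: derivative_eq_intros)
        have "((\<lambda>t. B (l y t)) has_vector_derivative B' (l y t) (y - z)) (at t within {0..1})"
          using vector_derivative_diff_chain_within[OF 1 has_derivative_at_withinI[OF B[OF lS[OF y t]]]] by (simp add: o_def)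
        from has_vector_derivative_scaleR[OF DERIV_ident this] show ?thesis
          by (simp add: w_def)
      qed
      then have "(w y has_integral (1 *\<^sub>R B (l y 1) - 0 *\<^sub>R B (l y 0))) {0..1}"
        by (intro fundamental_theorem_of_calculus) auto
      then show ?thesis
        by (simp add: integral_unique l_def)
    qed
    ultimately have "(F has_derivative (\<lambda>h. h \<bullet> B y)) (at y within S)"
      by (simp add: blinfun_inner_left.rep_eq[abs_def])
    then show ?thesis
      using at_within_open[OF y S(1)] by (simp add: inner_commute)
  qed
  then show ?thesis
    by blast
qed

text \<open>Symmetry of the second derivative when the gradient is differentiable at the single point
  \<open>y0\<close>. The second difference of \<open>F\<close> over the parallelogram spanned by
  \<open>s *\<^sub>R u\<close> and \<open>s *\<^sub>R v\<close> is symmetric in \<open>u\<close>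
  and \<open>v\<close>, and by the mean value theorem it equals \<open>s\<^sup>2 * (B' u
  \<bullet> v)\<close> up to \<open>o(s\<^sup>2)\<close>.\<close>

lemma gradient_derivative_symmetric:
  fixes B :: "'e::euclidean_space \<Rightarrow> 'e" and F :: "'e \<Rightarrow> real"
  assumes S: "open S" "y0 \<in> S"
    and F: "\<And>y. y \<in> S \<Longrightarrow> (F has_derivative (\<lambda>h. B y \<bullet> h)) (at y)"
    and B: "(B has_derivative B') (at y0)"
  shows "B' u \<bullet> v = B' v \<bullet> u"
proof -
  have lin: "linear B'"
    using B by (rule has_derivative_linear)
  obtain r where r: "r > 0" "ball y0 r \<subseteq> S"
    using S openE by blast
  have est: "\<exists>d>0. \<forall>s. 0 < s \<and> s < d \<longrightarrow>
      \<bar>(F (y0 + s *\<^sub>R u + s *\<^sub>R v) - F (y0 + s *\<^sub>R u) - F (y0 + s *\<^sub>R v) + F y0) - s\<^sup>2 * (B' u \<bullet> v)\<bar> \<le> e * s\<^sup>2"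
    if e: "e > 0" for e and u v :: 'e
  proof -
    define K where "K = (norm u + norm v + 1)"
    have K: "K > 0" "norm u + norm v \<le> K" "norm v \<le> K"
      unfolding K_def by (simp_all add: add_nonneg_pos)
    \<comment> \<open>Two remainders of size \<open>\<epsilon> * (s * K)\<close> are paired with
      \<open>v\<close>, whose norm is at most \<open>K\<close>; the choice makes the total
      \<open>s * e\<close>.\<close>
    define \<epsilon> where "\<epsilon> = e / (2 * K * K)"
    have \<epsilon>: "\<epsilon> > 0"
      using e K by (simp add: \<epsilon>_def)
    obtain d where d: "d > 0" "\<And>y. norm (y - y0) < d \<Longrightarrow> norm (B y - B y0 - B' (y - y0)) \<le> \<epsilon> * norm (y - y0)"
      using B \<epsilon> unfolding has_derivative_at_alt by blast
    define d' where "d' = min d r / K"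
    have d': "d' > 0"
      using d(1) r(1) K(1) by (simp add: d'_def)
    have "\<bar>(F (y0 + s *\<^sub>R u + s *\<^sub>R v) - F (y0 + s *\<^sub>R u) - F (y0 + s *\<^sub>R v) + F y0) - s\<^sup>2 * (B' u \<bullet> v)\<bar> \<le> e * s\<^sup>2"
      if s: "0 < s" "s < d'" for s
    proof -
      have sK: "s * K < d" "s * K < r"
        using s K(1) unfolding d'_def by (simp_all add: field_simps)
      have small: "norm (a *\<^sub>R u + \<tau> *\<^sub>R v) \<le> s * K" if "0 \<le> a" "a \<le> s" "0 \<le> \<tau>" "\<tau> \<le> s" for a \<tau>
      proof -
        have "norm (a *\<^sub>R u + \<tau> *\<^sub>R v) \<le> a * norm u + \<tau> * norm v"
          using norm_triangle_ineq[of "a *\<^sub>R u" "\<tau> *\<^sub>R v"] that by simp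
        also have "\<dots> \<le> s * norm u + s * norm v"
          using that by (intro add_mono mult_right_mono) auto
        also have "\<dots> \<le> s * K"
          using K(2) s(1) by (simp flip: distrib_left)
        finally show ?thesis .
      qed
      define \<phi> where "\<phi> \<tau> = F (y0 + (s *\<^sub>R u + \<tau> *\<^sub>R v)) - F (y0 + (0 *\<^sub>R u + \<tau> *\<^sub>R v))" for \<tau>
      have inS: "y0 + (a *\<^sub>R u + \<tau> *\<^sub>R v) \<in> S" if "0 \<le> a" "a \<le> s" "0 \<le> \<tau>" "\<tau> \<le> s" for a \<tau>
      proof -
        have "dist y0 (y0 + h) = norm h" for h
          by (simp add: dist_norm)
        then have "dist y0 (y0 + (a *\<^sub>R u + \<tau> *\<^sub>R v)) < r"
          using small[OF that] sK(2) by simp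
        then show ?thesis
          using r(2) by auto
      qed
      have der: "(\<phi> has_real_derivative (B (y0 + (s *\<^sub>R u + \<tau> *\<^sub>R v)) - B (y0 + (0 *\<^sub>R u + \<tau> *\<^sub>R v))) \<bullet> v) (at \<tau>)"
        if \<tau>: "0 \<le> \<tau>" "\<tau> \<le> s" for \<tau>
      proof -
        have 1: "((\<lambda>\<tau>. F (y0 + (a *\<^sub>R u + \<tau> *\<^sub>R v))) has_real_derivative B (y0 + (a *\<^sub>R u + \<tau> *\<^sub>R v)) \<bullet> v) (at \<tau>)"
          if a: "0 \<le> a" "a \<le> s" for a
        proof -
          have "((\<lambda>\<tau>. y0 + (a *\<^sub>R u + \<tau> *\<^sub>R v)) has_derivative (\<lambda>h. h *\<^sub>R v)) (at \<tau>)"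
            by (auto intro!: derivative_eq_intros)
          from diff_chain_at[OF this F[OF inS[OF a \<tau>]]]
          show ?thesis
            by (simp add: o_def has_field_derivative_def mult_commute_abs)
        qed
        show ?thesis
          unfolding \<phi>_def inner_diff_left using 1[of s] 1[of 0] s by (intro DERIV_diff) auto
      qed
      obtain \<xi> where \<xi>: "0 < \<xi>" "\<xi> < s"
        "\<phi> s - \<phi> 0 = (s - 0) * ((B (y0 + (s *\<^sub>R u + \<xi> *\<^sub>R v)) - B (y0 + (0 *\<^sub>R u + \<xi> *\<^sub>R v))) \<bullet> v)"
        using MVT2[OF s(1), of \<phi>, OF der] by blast
      let ?y = "y0 + (s *\<^sub>R u + \<xi> *\<^sub>R v)" and ?z = "y0 + (0 *\<^sub>R u + \<xi> *\<^sub>R v)"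
      have rem: "norm (B (y0 + h) - B y0 - B' h) \<le> \<epsilon> * (s * K)" if h: "norm h \<le> s * K" for h
      proof -
        have "norm (B (y0 + h) - B y0 - B' h) \<le> \<epsilon> * norm h"
          using d(2)[of "y0 + h"] h sK(1) by simp
        also have "\<dots> \<le> \<epsilon> * (s * K)"
          using h \<epsilon> by (intro mult_left_mono) auto
        finally show ?thesis .
      qed
      define R where "R h = B (y0 + h) - B y0 - B' h" for h
      have "B ?y - B ?z = s *\<^sub>R B' u + (R (s *\<^sub>R u + \<xi> *\<^sub>R v) - R (0 *\<^sub>R u + \<xi> *\<^sub>R v))"
        by (simp add: R_def linear_add[OF lin] linear_scale[OF lin])
      then have "(B ?y - B ?z) \<bullet> v - s * (B' u \<bullet> v) = (R (s *\<^sub>R u + \<xi> *\<^sub>R v) - R (0 *\<^sub>R u + \<xi> *\<^sub>R v)) \<bullet> v"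
        by (simp add: inner_add_left)
      also have "\<bar>\<dots>\<bar> \<le> norm (R (s *\<^sub>R u + \<xi> *\<^sub>R v) - R (0 *\<^sub>R u + \<xi> *\<^sub>R v)) * norm v"
        by (rule Cauchy_Schwarz_ineq2)
      also have "\<dots> \<le> (\<epsilon> * (s * K) + \<epsilon> * (s * K)) * K"
      proof (intro mult_mono K(3) norm_ge_zero)
        show "norm (R (s *\<^sub>R u + \<xi> *\<^sub>R v) - R (0 *\<^sub>R u + \<xi> *\<^sub>R v)) \<le> \<epsilon> * (s * K) + \<epsilon> * (s * K)"
          using rem[OF small[of s \<xi>]] rem[OF small[of 0 \<xi>]] \<xi>(1,2) s norm_triangle_ineq4
          unfolding R_def by (smt (verit))
        show "0 \<le> \<epsilon> * (s * K) + \<epsilon> * (s * K)"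
          using \<epsilon> s K by simp
      qed
      also have "\<dots> = s * e"
        using K(1) by (simp add: \<epsilon>_def field_simps)
      finally have bnd: "\<bar>(B ?y - B ?z) \<bullet> v - s * (B' u \<bullet> v)\<bar> \<le> s * e" .
      have "F (y0 + s *\<^sub>R u + s *\<^sub>R v) - F (y0 + s *\<^sub>R u) - F (y0 + s *\<^sub>R v) + F y0 = \<phi> s - \<phi> 0"
        by (simp add: \<phi>_def add.assoc)
      also have "\<dots> - s\<^sup>2 * (B' u \<bullet> v) = s * ((B ?y - B ?z) \<bullet> v - s * (B' u \<bullet> v))"
        using \<xi>(3) by (simp add: power2_eq_square algebra_simps)
      finally show ?thesis
        using bnd s(1) by (simp add: abs_mult power2_eq_square mult.commute mult.left_commute)
    qed
    then show ?thesis
      using d' by blast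
  qed
  have "\<bar>B' u \<bullet> v - B' v \<bullet> u\<bar> \<le> e" if e: "e > 0" for e
  proof -
    obtain d1 where d1: "d1 > 0" "\<And>s. 0 < s \<Longrightarrow> s < d1 \<Longrightarrow>
      \<bar>(F (y0 + s *\<^sub>R u + s *\<^sub>R v) - F (y0 + s *\<^sub>R u) - F (y0 + s *\<^sub>R v) + F y0) - s\<^sup>2 * (B' u \<bullet> v)\<bar> \<le> e / 2 * s\<^sup>2"
      using est[of "e / 2" u v] e by auto
    obtain d2 where d2: "d2 > 0" "\<And>s. 0 < s \<Longrightarrow> s < d2 \<Longrightarrow>
      \<bar>(F (y0 + s *\<^sub>R v + s *\<^sub>R u) - F (y0 + s *\<^sub>R v) - F (y0 + s *\<^sub>R u) + F y0) - s\<^sup>2 * (B' v \<bullet> u)\<bar> \<le> e / 2 * s\<^sup>2"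
      using est[of "e / 2" v u] e by auto
    define s where "s = min d1 d2 / 2"
    have s: "0 < s" "s < d1" "s < d2"
      using d1(1) d2(1) by (auto simp: s_def)
    have comm: "y0 + s *\<^sub>R v + s *\<^sub>R u = y0 + s *\<^sub>R u + s *\<^sub>R v"
      by simp
    have factor: "\<bar>s\<^sup>2 * a - s\<^sup>2 * b\<bar> = s\<^sup>2 * \<bar>a - b\<bar>" for a b :: real
      by (simp add: abs_mult flip: right_diff_distrib)
    have "s\<^sup>2 * \<bar>B' u \<bullet> v - B' v \<bullet> u\<bar> = \<bar>s\<^sup>2 * (B' u \<bullet> v) - s\<^sup>2 * (B' v \<bullet> u)\<bar>"
      by (rule factor[symmetric])
    also have "\<dots> \<le> e * s\<^sup>2"
      using d1(2)[OF s(1,2)] d2(2)[OF s(1,3)] unfolding comm by linarith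
    also have "\<dots> = s\<^sup>2 * e"
      by (rule mult.commute)
    finally have "s\<^sup>2 * \<bar>B' u \<bullet> v - B' v \<bullet> u\<bar> \<le> s\<^sup>2 * e" .
    then show ?thesis
      using s(1) by simp
  qed
  then have "\<bar>B' u \<bullet> v - B' v \<bullet> u\<bar> \<le> 0"
    by (rule field_le_epsilon) simp
  then show ?thesis
    by simp
qed


section \<open>Charts and tangent vectors\<close>

locale smooth_manifold =
  fixes \<A> :: "('m::topological_space, 'e::euclidean_space) chart set"
  assumes atlas: "smooth_atlas \<A>"
begin

lemma chart:
  assumes "(U, \<phi>) \<in> \<A>"
  shows "open U" "open (\<phi> ` U)" "continuous_on U \<phi>" "continuous_on (\<phi> ` U) (inv_into U \<phi>)"
    "\<And>p. p \<in> U \<Longrightarrow> inv_into U \<phi> (\<phi> p) = p"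
    "\<And>y. y \<in> \<phi> ` U \<Longrightarrow> \<phi> (inv_into U \<phi> y) = y" "\<And>y. y \<in> \<phi> ` U \<Longrightarrow> inv_into U \<phi> y \<in> U"
  using bspec[OF conjunct1[OF atlas[unfolded smooth_atlas_def]] assms]
  by (auto simp: homeomorphism_def f_inv_into_f inv_into_into)

lemma chart_at: obtains U \<phi> where "(U, \<phi>) \<in> \<A>" "p \<in> U"
proof -
  have "p \<in> (\<Union>(U, \<phi>)\<in>\<A>. U)"
    using atlas unfolding smooth_atlas_def by simp
  then show ?thesis
    using that by auto
qed

lemma transition: "(U, \<phi>) \<in> \<A> \<Longrightarrow> (V, \<psi>) \<in> \<A> \<Longrightarrow> smooth_on (\<phi> ` (U \<inter> V)) (\<psi> \<circ> inv_into U \<phi>)"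
  using atlas unfolding smooth_atlas_def by fast

lemma chart_image_Int:
  assumes "(U, \<phi>) \<in> \<A>"
  shows "\<phi> ` (U \<inter> W) = {y \<in> \<phi> ` U. inv_into U \<phi> y \<in> W}"
  using chart(5)[OF assms] by auto

lemma open_chart_image:
  assumes "(U, \<phi>) \<in> \<A>" "open W"
  shows "open (\<phi> ` (U \<inter> W))"
proof -
  have "open (inv_into U \<phi> -` W \<inter> \<phi> ` U)"
    using chart(2,4)[OF assms(1)] assms(2) continuous_on_open_vimage by blast
  moreover have "inv_into U \<phi> -` W \<inter> \<phi> ` U = \<phi> ` (U \<inter> W)"
    unfolding chart_image_Int[OF assms(1)] by blast
  ultimately show ?thesis
    by simp
qed

lemma smooth_fun_coordinate:
  assumes "(U, \<phi>) \<in> \<A>"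
  shows "smooth_fun \<A> U (\<lambda>q. \<phi> q \<bullet> b)"
  unfolding smooth_fun_def
proof (intro conjI ballI, rule chart(1)[OF assms], clarify)
  fix V \<psi> assume V: "(V, \<psi>) \<in> \<A>"
  have "smooth_on (\<psi> ` (V \<inter> U)) (\<lambda>y. (\<phi> \<circ> inv_into V \<psi>) y \<bullet> b)"
    by (rule smooth_on_linear_compose[OF open_chart_image[OF V chart(1)[OF assms]] bounded_linear_inner_left
          transition[OF V assms]])
  then show "smooth_on (\<psi> ` (V \<inter> U)) ((\<lambda>q. \<phi> q \<bullet> b) \<circ> inv_into V \<psi>)"
    by (simp add: o_def)
qed

lemma smooth_funD: "smooth_fun \<A> W f \<Longrightarrow> (U, \<phi>) \<in> \<A> \<Longrightarrow> smooth_on (\<phi> ` (U \<inter> W)) (f \<circ> inv_into U \<phi>)"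
  unfolding smooth_fun_def by fast

lemma smooth_near_coordinate: "(U, \<phi>) \<in> \<A> \<Longrightarrow> p \<in> U \<Longrightarrow> smooth_near \<A> p (\<lambda>q. \<phi> q \<bullet> b)"
  unfolding smooth_near_def using smooth_fun_coordinate by blast

lemma smooth_near_derivative:
  assumes "smooth_near \<A> p f" "(U, \<phi>) \<in> \<A>" "p \<in> U"
  shows "((f \<circ> inv_into U \<phi>) has_derivative frechet_derivative (f \<circ> inv_into U \<phi>) (at (\<phi> p))) (at (\<phi> p))"
proof -
  obtain W where "p \<in> W" "smooth_fun \<A> W f"
    using assms(1) unfolding smooth_near_def by blast
  then show ?thesis
    using smooth_on_derivative[OF smooth_funD[OF _ assms(2)]] assms(3) by blast
qed

lemma transition_derivative:
  assumes "(U, \<phi>) \<in> \<A>" "(V, \<psi>) \<in> \<A>" "p \<in> U" "p \<in> V"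
  shows "((\<psi> \<circ> inv_into U \<phi>) has_derivative frechet_derivative (\<psi> \<circ> inv_into U \<phi>) (at (\<phi> p))) (at (\<phi> p))"
  using smooth_on_derivative[OF transition[OF assms(1,2)]] assms(3,4) by blast

text \<open>The coordinate vector of a tangent vector, obtained by applying it as a derivation to the
  coordinate functions.\<close>

definition chart_vector :: "('m \<Rightarrow> 'e) \<Rightarrow> (('m \<Rightarrow> real) \<Rightarrow> real) \<Rightarrow> 'e" where
  "chart_vector \<phi> v = (\<Sum>b\<in>Basis. v (\<lambda>q. \<phi> q \<bullet> b) *\<^sub>R b)"

lemma chart_vector_inner: "b \<in> Basis \<Longrightarrow> chart_vector \<phi> v \<bullet> b = v (\<lambda>q. \<phi> q \<bullet> b)"
  by (simp add: chart_vector_def)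

text \<open>The definition of tangent vectors provides a representing direction in some chart only.
  Transition maps transport it to every other chart, where it has to be the coordinate vector.\<close>

lemma tangent_in_chart:
  assumes v: "v \<in> tangent_space \<A> p" and U: "(U, \<phi>) \<in> \<A>" "p \<in> U" and f: "smooth_near \<A> p f"
  shows "v f = frechet_derivative (f \<circ> inv_into U \<phi>) (at (\<phi> p)) (chart_vector \<phi> v)"
proof -
  obtain V \<psi> a where V: "(V, \<psi>) \<in> \<A>" "p \<in> V"
    and a: "\<And>f. smooth_near \<A> p f \<Longrightarrow> v f = frechet_derivative (f \<circ> inv_into V \<psi>) (at (\<psi> p)) a"
    using v unfolding tangent_space_def by blast
  let ?\<tau> = "\<phi> \<circ> inv_into V \<psi>"
  have \<tau>: "(?\<tau> has_derivative frechet_derivative ?\<tau> (at (\<psi> p))) (at (\<psi> p))"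
    by (rule transition_derivative[OF V(1) U(1) V(2) U(2)])
  have \<tau>p: "?\<tau> (\<psi> p) = \<phi> p"
    by (simp add: chart(5)[OF V])
  have change: "v f = frechet_derivative (f \<circ> inv_into U \<phi>) (at (\<phi> p)) (frechet_derivative ?\<tau> (at (\<psi> p)) a)"
    if f: "smooth_near \<A> p f" for f
  proof -
    have "((f \<circ> inv_into U \<phi>) \<circ> ?\<tau> has_derivative
        frechet_derivative (f \<circ> inv_into U \<phi>) (at (\<phi> p)) \<circ> frechet_derivative ?\<tau> (at (\<psi> p))) (at (\<psi> p))"
      by (rule diff_chain_at[OF \<tau>]) (use smooth_near_derivative[OF f U] \<tau>p in simp)
    then have "(f \<circ> inv_into V \<psi> has_derivative
        frechet_derivative (f \<circ> inv_into U \<phi>) (at (\<phi> p)) \<circ> frechet_derivative ?\<tau> (at (\<psi> p))) (at (\<psi> p))"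
    proof (rule has_derivative_transform_within_open)
      show "open (\<psi> ` (V \<inter> U))"
        by (rule open_chart_image[OF V(1) chart(1)[OF U(1)]])
      show "\<psi> p \<in> \<psi> ` (V \<inter> U)"
        using U V by blast
      show "((f \<circ> inv_into U \<phi>) \<circ> ?\<tau>) y = (f \<circ> inv_into V \<psi>) y" if "y \<in> \<psi> ` (V \<inter> U)" for y
        using that chart(5)[OF U(1)] chart(5)[OF V(1)] by auto
    qed
    from frechet_derivative_at[OF this] show ?thesis
      using a[OF f] by (simp add: o_def fun_eq_iff)
  qed
  have "chart_vector \<phi> v = frechet_derivative ?\<tau> (at (\<psi> p)) a"
  proof (rule euclidean_eqI)
    fix b :: 'e assume b: "b \<in> Basis"
    have "((\<lambda>y. ?\<tau> y \<bullet> b) has_derivative (\<lambda>h. frechet_derivative ?\<tau> (at (\<psi> p)) h \<bullet> b)) (at (\<psi> p))"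
      by (rule bounded_linear.has_derivative[OF bounded_linear_inner_left \<tau>])
    from frechet_derivative_at[OF this]
    have "v (\<lambda>q. \<phi> q \<bullet> b) = frechet_derivative ?\<tau> (at (\<psi> p)) a \<bullet> b"
      using a[OF smooth_near_coordinate[OF U]] by (simp add: o_def fun_eq_iff)
    then show "chart_vector \<phi> v \<bullet> b = frechet_derivative ?\<tau> (at (\<psi> p)) a \<bullet> b"
      using b by (simp add: chart_vector_inner)
  qed
  then show ?thesis
    using change[OF f] by simp
qed

lemma tangent_eqI:
  assumes "v \<in> tangent_space \<A> p" "w \<in> tangent_space \<A> p" "(U, \<phi>) \<in> \<A>" "p \<in> U"
    and "chart_vector \<phi> v = chart_vector \<phi> w"
  shows "v = w"
proof
  fix f
  show "v f = w f"
  proof (cases "smooth_near \<A> p f")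
    case True
    then show ?thesis
      using tangent_in_chart[OF assms(1,3,4)] tangent_in_chart[OF assms(2,3,4)] assms(5) by simp
  next
    case False
    then show ?thesis
      using assms(1,2) unfolding tangent_space_def by simp
  qed
qed

lemma vector_fieldsD:
  assumes "X \<in> vector_fields \<A>"
  shows "X p \<in> tangent_space \<A> p" "smooth_fun \<A> W f \<Longrightarrow> smooth_fun \<A> W (\<lambda>p. X p f)"
  using assms unfolding vector_fields_def by auto

end


section \<open>Lie groups in charts\<close>

locale smooth_lie_group = smooth_manifold \<A> + group G
  for \<A> :: "('m::{t2_space, second_countable_topology}, 'e::euclidean_space) chart set" and G :: "'m monoid" (structure) +
  assumes lie: "lie_group \<A> G"
begin

lemma carrier_UNIV [simp]: "carrier G = UNIV"
  using lie by (simp add: lie_group_def)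

lemma mult_smooth_map: "smooth_map (prod_atlas \<A> \<A>) \<A> (\<lambda>(a, b). a \<otimes> b)"
  using lie by (simp add: lie_group_def)

lemma continuous_mult: "continuous_on UNIV (\<lambda>(a, b). a \<otimes> b)"
  using mult_smooth_map unfolding smooth_map_def by blast

lemma continuous_left_translation: "continuous_on UNIV (\<lambda>q. a \<otimes> q)"
  using continuous_on_compose2[OF continuous_mult, of UNIV "\<lambda>q. (a, q)"]
  by (simp add: continuous_on_Pair continuous_on_const continuous_on_id)

text \<open>Multiplication in local coordinates. Smoothness is needed jointly in both factors, because a
  left-invariant field is a derivative in the second factor whose dependence on the first one
  has to be smooth.\<close>

definition chart_mult :: "'m set \<Rightarrow> ('m \<Rightarrow> 'e) \<Rightarrow> 'm set \<Rightarrow> ('m \<Rightarrow> 'e) \<Rightarrow> 'e \<times> 'e \<Rightarrow> 'm" where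
  "chart_mult U \<phi> V \<psi> = (\<lambda>(y, z). inv_into U \<phi> y \<otimes> inv_into V \<psi> z)"

lemma open_chart_mult:
  assumes "(U, \<phi>) \<in> \<A>" "(V, \<psi>) \<in> \<A>" "open W"
  shows "open {x \<in> \<phi> ` U \<times> \<psi> ` V. chart_mult U \<phi> V \<psi> x \<in> W}"
proof -
  have "continuous_on (\<phi> ` U \<times> \<psi> ` V) (\<lambda>x. (inv_into U \<phi> (fst x), inv_into V \<psi> (snd x)))"
    by (intro continuous_on_Pair continuous_on_compose2[OF chart(4)[OF assms(1)] continuous_on_fst[OF continuous_on_id]]
        continuous_on_compose2[OF chart(4)[OF assms(2)] continuous_on_snd[OF continuous_on_id]]) auto
  from continuous_on_compose2[OF continuous_mult this]
  have "continuous_on (\<phi> ` U \<times> \<psi> ` V) (chart_mult U \<phi> V \<psi>)"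
    by (simp add: chart_mult_def case_prod_beta)
  moreover have "open (\<phi> ` U \<times> \<psi> ` V)"
    using chart(2) assms by (intro open_Times) auto
  ultimately have "open (chart_mult U \<phi> V \<psi> -` W \<inter> (\<phi> ` U \<times> \<psi> ` V))"
    using assms(3) continuous_on_open_vimage by blast
  moreover have "chart_mult U \<phi> V \<psi> -` W \<inter> (\<phi> ` U \<times> \<psi> ` V) = {x \<in> \<phi> ` U \<times> \<psi> ` V. chart_mult U \<phi> V \<psi> x \<in> W}"
    by blast
  ultimately show ?thesis
    by simp
qed

lemma smooth_chart_mult_coordinates:
  assumes "(U, \<phi>) \<in> \<A>" "(V, \<psi>) \<in> \<A>" "(X, \<omega>) \<in> \<A>"
  shows "smooth_on {x \<in> \<phi> ` U \<times> \<psi> ` V. chart_mult U \<phi> V \<psi> x \<in> X} (\<omega> \<circ> chart_mult U \<phi> V \<psi>)"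
proof -
  let ?m = "\<lambda>(a, b). a \<otimes> b" and ?j = "inv_into (U \<times> V) (map_prod \<phi> \<psi>)"
  have "(U \<times> V, map_prod \<phi> \<psi>) \<in> prod_atlas \<A> \<A>"
    unfolding prod_atlas_def using assms by blast
  then have sm: "smooth_on (map_prod \<phi> \<psi> ` ((U \<times> V) \<inter> ?m -` X)) (\<omega> \<circ> ?m \<circ> ?j)"
    using mult_smooth_map assms(3) unfolding smooth_map_def by fast
  have "inj_on \<phi> U" "inj_on \<psi> V"
    using chart(5)[OF assms(1)] chart(5)[OF assms(2)] by (metis inj_on_inverseI)+
  then have "inj_on (map_prod \<phi> \<psi>) (U \<times> V)"
    by (rule map_prod_inj_on)
  then have j: "?j (\<phi> a, \<psi> b) = (a, b)" if "a \<in> U" "b \<in> V" for a b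
    using inv_into_f_f[of "map_prod \<phi> \<psi>" "U \<times> V" "(a, b)"] that by simp
  have set_eq: "map_prod \<phi> \<psi> ` ((U \<times> V) \<inter> ?m -` X) = {x \<in> \<phi> ` U \<times> \<psi> ` V. chart_mult U \<phi> V \<psi> x \<in> X}"
  proof (intro Set.set_eqI iffI)
    fix x assume "x \<in> map_prod \<phi> \<psi> ` ((U \<times> V) \<inter> ?m -` X)"
    then show "x \<in> {x \<in> \<phi> ` U \<times> \<psi> ` V. chart_mult U \<phi> V \<psi> x \<in> X}"
      using chart(5)[OF assms(1)] chart(5)[OF assms(2)] by (auto simp: chart_mult_def)
  next
    fix x assume "x \<in> {x \<in> \<phi> ` U \<times> \<psi> ` V. chart_mult U \<phi> V \<psi> x \<in> X}"
    then obtain a b where ab: "x = (\<phi> a, \<psi> b)" "a \<in> U" "b \<in> V" "a \<otimes> b \<in> X"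
      using chart(5)[OF assms(1)] chart(5)[OF assms(2)] by (auto simp: chart_mult_def)
    then show "x \<in> map_prod \<phi> \<psi> ` ((U \<times> V) \<inter> ?m -` X)"
      by (intro image_eqI[of _ _ "(a, b)"]) auto
  qed
  show ?thesis
  proof (rule smooth_on_cong[OF open_chart_mult[OF assms(1,2) chart(1)[OF assms(3)]] _ sm[unfolded set_eq]])
    fix x assume "x \<in> {x \<in> \<phi> ` U \<times> \<psi> ` V. chart_mult U \<phi> V \<psi> x \<in> X}"
    then obtain a b where ab: "x = (\<phi> a, \<psi> b)" "a \<in> U" "b \<in> V"
      by blast
    then show "(\<omega> \<circ> ?m \<circ> ?j) x = (\<omega> \<circ> chart_mult U \<phi> V \<psi>) x"
      using chart(5)[OF assms(1)] chart(5)[OF assms(2)] j by (simp add: chart_mult_def)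
  qed
qed

text \<open>Near each point factor through a chart around the product and use the smoothness of
  multiplication in coordinates.\<close>

lemma smooth_chart_mult:
  assumes U: "(U, \<phi>) \<in> \<A>" and V: "(V, \<psi>) \<in> \<A>" and f: "smooth_fun \<A> W f"
  shows "smooth_on {x \<in> \<phi> ` U \<times> \<psi> ` V. chart_mult U \<phi> V \<psi> x \<in> W} (f \<circ> chart_mult U \<phi> V \<psi>)"
proof (rule smooth_on_local)
  fix x assume x: "x \<in> {x \<in> \<phi> ` U \<times> \<psi> ` V. chart_mult U \<phi> V \<psi> x \<in> W}"
  obtain X \<omega> where X: "(X, \<omega>) \<in> \<A>" "chart_mult U \<phi> V \<psi> x \<in> X"
    by (rule chart_at)
  let ?T = "{x \<in> \<phi> ` U \<times> \<psi> ` V. chart_mult U \<phi> V \<psi> x \<in> W \<inter> X}"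
  have W: "open W"
    using f by (simp add: smooth_fun_def)
  have T: "open ?T"
    using open_chart_mult[OF U V, of "W \<inter> X"] W chart(1)[OF X(1)] by blast
  have "smooth_on ?T (\<lambda>x. (f \<circ> inv_into X \<omega>) ((\<omega> \<circ> chart_mult U \<phi> V \<psi>) x))"
  proof (rule smooth_on_compose[OF T smooth_funD[OF f X(1)]])
    show "smooth_on ?T (\<omega> \<circ> chart_mult U \<phi> V \<psi>)"
      by (rule smooth_on_subset[OF smooth_chart_mult_coordinates[OF U V X(1)]]) blast
    show "(\<omega> \<circ> chart_mult U \<phi> V \<psi>) ` ?T \<subseteq> \<omega> ` (X \<inter> W)"
      by auto
  qed
  then have "smooth_on ?T (f \<circ> chart_mult U \<phi> V \<psi>)"
    by (rule smooth_on_cong[OF T, rotated]) (simp add: chart(5)[OF X(1)])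
  then show "\<exists>T. open T \<and> x \<in> T \<and> smooth_on T (f \<circ> chart_mult U \<phi> V \<psi>)"
    using T x X(2) by (intro exI[of _ ?T]) auto
qed

lemma smooth_fun_left_translation:
  assumes f: "smooth_fun \<A> W f"
  shows "smooth_fun \<A> ((\<lambda>q. a \<otimes> q) -` W) (\<lambda>q. f (a \<otimes> q))"
  unfolding smooth_fun_def
proof (intro conjI ballI)
  have W: "open W"
    using f by (simp add: smooth_fun_def)
  show open': "open ((\<lambda>q. a \<otimes> q) -` W)"
    using continuous_left_translation W by (simp add: continuous_on_open_vimage)
  fix c assume "c \<in> \<A>"
  then obtain V \<psi> where c: "c = (V, \<psi>)" and V: "(V, \<psi>) \<in> \<A>"
    by (cases c) auto
  obtain U \<phi> where U: "(U, \<phi>) \<in> \<A>" "a \<in> U"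
    by (rule chart_at)
  let ?S = "\<psi> ` (V \<inter> (\<lambda>q. a \<otimes> q) -` W)"
  have S: "open ?S"
    by (rule open_chart_image[OF V open'])
  have "smooth_on ?S (\<lambda>z. (f \<circ> chart_mult U \<phi> V \<psi>) ((\<phi> a, 0) + (0, z)))"
  proof (rule smooth_on_compose[OF S smooth_chart_mult[OF U(1) V f]])
    show "smooth_on ?S (\<lambda>z. (\<phi> a, 0) + (0, z))"
      by (rule smooth_on_affine[OF S]) (intro bounded_linear_Pair bounded_linear_zero bounded_linear_ident)
    show "(\<lambda>z. (\<phi> a, 0) + (0, z)) ` ?S \<subseteq> {x \<in> \<phi> ` U \<times> \<psi> ` V. chart_mult U \<phi> V \<psi> x \<in> W}"
      using U chart(5)[OF U] chart(5)[OF V] by (auto simp: chart_mult_def)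
  qed
  then have "smooth_on ?S ((\<lambda>q. f (a \<otimes> q)) \<circ> inv_into V \<psi>)"
    by (simp add: chart_mult_def o_def chart(5)[OF U])
  then show "case c of (V, \<psi>) \<Rightarrow> smooth_on (\<psi> ` (V \<inter> (\<lambda>q. a \<otimes> q) -` W)) ((\<lambda>q. f (a \<otimes> q)) \<circ> inv_into V \<psi>)"
    by (simp add: c)
qed

lemma smooth_near_left_translation: "smooth_near \<A> (a \<otimes> p) f \<Longrightarrow> smooth_near \<A> p (\<lambda>q. f (a \<otimes> q))"
  unfolding smooth_near_def using smooth_fun_left_translation[of _ f a] by blast

lemma smooth_near_left_translation_iff:
  "smooth_near \<A> p (\<lambda>q. f (a \<otimes> q)) \<longleftrightarrow> smooth_near \<A> (a \<otimes> p) f"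
proof
  assume "smooth_near \<A> p (\<lambda>q. f (a \<otimes> q))"
  then have "smooth_near \<A> (inv a \<otimes> (a \<otimes> p)) (\<lambda>q. f (a \<otimes> q))"
    by (simp flip: m_assoc)
  from smooth_near_left_translation[OF this] show "smooth_near \<A> (a \<otimes> p) f"
    by (simp flip: m_assoc)
qed (rule smooth_near_left_translation)

end


section \<open>Left-invariant frames\<close>

context smooth_lie_group
begin

text \<open>The left-invariant field with coordinate vector \<open>v\<close> at the identity in the chart
  \<open>\<psi>\<close>: its value at \<open>p\<close> differentiates \<open>f\<close> after
  left translation by \<open>p\<close>.\<close>

definition left_field :: "'m set \<Rightarrow> ('m \<Rightarrow> 'e) \<Rightarrow> 'e \<Rightarrow> 'm vfield" where
  "left_field V \<psi> v = (\<lambda>p f. if smooth_near \<A> p f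
     then frechet_derivative ((\<lambda>q. f (p \<otimes> q)) \<circ> inv_into V \<psi>) (at (\<psi> \<one>)) v else 0)"

lemma left_field_tangent:
  assumes V: "(V, \<psi>) \<in> \<A>" "\<one> \<in> V"
  shows "left_field V \<psi> v p \<in> tangent_space \<A> p"
proof -
  obtain U \<phi> where U: "(U, \<phi>) \<in> \<A>" "p \<in> U"
    by (rule chart_at)
  let ?h = "\<lambda>z. \<phi> (p \<otimes> inv_into V \<psi> z)"
  have "\<exists>D. ((\<lambda>z. ?h z \<bullet> b) has_derivative D) (at (\<psi> \<one>))" for b
  proof -
    have "smooth_near \<A> (p \<otimes> \<one>) (\<lambda>q. \<phi> q \<bullet> b)"
      using smooth_near_coordinate[OF U] by simp
    from smooth_near_derivative[OF smooth_near_left_translation[OF this] V]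
    show ?thesis
      by (auto simp: o_def)
  qed
  then obtain D where D: "\<And>b. ((\<lambda>z. ?h z \<bullet> b) has_derivative D b) (at (\<psi> \<one>))"
    by metis
  define h' where "h' w = (\<Sum>b\<in>Basis. D b w *\<^sub>R b)" for w
  have h: "(?h has_derivative h') (at (\<psi> \<one>))"
    unfolding has_derivative_componentwise_within[of ?h]
  proof
    fix b :: 'e assume b: "b \<in> Basis"
    then have "(\<lambda>w. h' w \<bullet> b) = D b"
      by (simp add: h'_def fun_eq_iff)
    then show "((\<lambda>z. ?h z \<bullet> b) has_derivative (\<lambda>w. h' w \<bullet> b)) (at (\<psi> \<one>))"
      using D by simp
  qed
  have h1: "?h (\<psi> \<one>) = \<phi> p"
    by (simp add: chart(5)[OF V])
  have "left_field V \<psi> v p f = frechet_derivative (f \<circ> inv_into U \<phi>) (at (\<phi> p)) (h' v)"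
    if f: "smooth_near \<A> p f" for f
  proof -
    let ?f = "f \<circ> inv_into U \<phi>"
    have "(?f \<circ> ?h has_derivative frechet_derivative ?f (at (\<phi> p)) \<circ> h') (at (\<psi> \<one>))"
      by (rule diff_chain_at[OF h]) (use smooth_near_derivative[OF f U] h1 in simp)
    then have "((\<lambda>q. f (p \<otimes> q)) \<circ> inv_into V \<psi> has_derivative frechet_derivative ?f (at (\<phi> p)) \<circ> h') (at (\<psi> \<one>))"
    proof (rule has_derivative_transform_within_open)
      have "open ((\<lambda>q. p \<otimes> q) -` U)"
        using continuous_left_translation chart(1)[OF U(1)] by (simp add: continuous_on_open_vimage)
      then show "open (\<psi> ` (V \<inter> (\<lambda>q. p \<otimes> q) -` U))"
        by (rule open_chart_image[OF V(1)])
      show "\<psi> \<one> \<in> \<psi> ` (V \<inter> (\<lambda>q. p \<otimes> q) -` U)"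
        using U V by auto
      show "(?f \<circ> ?h) z = ((\<lambda>q. f (p \<otimes> q)) \<circ> inv_into V \<psi>) z" if "z \<in> \<psi> ` (V \<inter> (\<lambda>q. p \<otimes> q) -` U)" for z
        using that chart(5)[OF U(1)] chart(5)[OF V(1)] by auto
    qed
    from frechet_derivative_at[OF this] show ?thesis
      using f by (simp add: left_field_def fun_eq_iff)
  qed
  moreover have "left_field V \<psi> v p f = 0" if "\<not> smooth_near \<A> p f" for f
    using that by (simp add: left_field_def)
  ultimately show ?thesis
    unfolding tangent_space_def using U by blast
qed

lemma left_field_smooth:
  assumes V: "(V, \<psi>) \<in> \<A>" "\<one> \<in> V" and f: "smooth_fun \<A> W f"
  shows "smooth_fun \<A> W (\<lambda>p. left_field V \<psi> v p f)"
  unfolding smooth_fun_def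
proof (intro conjI ballI)
  show W: "open W"
    using f by (simp add: smooth_fun_def)
  fix c assume "c \<in> \<A>"
  then obtain U \<phi> where c: "c = (U, \<phi>)" and U: "(U, \<phi>) \<in> \<A>"
    by (cases c) auto
  let ?S = "\<phi> ` (U \<inter> W)"
  let ?F = "f \<circ> chart_mult U \<phi> V \<psi>"
  let ?O = "{x \<in> \<phi> ` U \<times> \<psi> ` V. chart_mult U \<phi> V \<psi> x \<in> W}"
  have S: "open ?S"
    by (rule open_chart_image[OF U W])
  have F: "smooth_on ?O ?F"
    by (rule smooth_chart_mult[OF U V(1) f])
  have mem: "(y, \<psi> \<one>) \<in> ?O" if "y \<in> ?S" for y
    using that V chart(5)[OF U] chart(5)[OF V] by (auto simp: chart_mult_def)
  have "smooth_on ?S (\<lambda>y. frechet_derivative ?F (at ((0, \<psi> \<one>) + (y, 0))) (0, v))"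
  proof (rule smooth_on_compose[OF S smooth_on_frechet_derivative[OF F]])
    show "smooth_on ?S (\<lambda>y. (0, \<psi> \<one>) + (y, 0))"
      by (rule smooth_on_affine[OF S]) (intro bounded_linear_Pair bounded_linear_zero bounded_linear_ident)
    show "(\<lambda>y. (0, \<psi> \<one>) + (y, 0)) ` ?S \<subseteq> ?O"
      using mem by auto
  qed
  moreover have "frechet_derivative ?F (at ((0, \<psi> \<one>) + (y, 0))) (0, v)
      = ((\<lambda>p. left_field V \<psi> v p f) \<circ> inv_into U \<phi>) y" if y: "y \<in> ?S" for y
  proof -
    let ?p = "inv_into U \<phi> y"
    have p: "?p \<in> W"
      using y chart(5)[OF U] by auto
    have "((\<lambda>z. (y, z)) has_derivative (\<lambda>z. (0, z))) (at (\<psi> \<one>))"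
      by (intro has_derivative_Pair has_derivative_const has_derivative_ident)
    from diff_chain_at[OF this smooth_on_derivative[OF F mem[OF y]]]
    have "(?F \<circ> (\<lambda>z. (y, z)) has_derivative frechet_derivative ?F (at (y, \<psi> \<one>)) \<circ> (\<lambda>z. (0, z))) (at (\<psi> \<one>))" .
    from frechet_derivative_at[OF this] show ?thesis
      using f p by (auto simp: left_field_def smooth_near_def chart_mult_def o_def fun_eq_iff)
  qed
  ultimately have "smooth_on ?S ((\<lambda>p. left_field V \<psi> v p f) \<circ> inv_into U \<phi>)"
    by (rule smooth_on_cong[OF S, rotated])
  then show "case c of (U, \<phi>) \<Rightarrow> smooth_on (\<phi> ` (U \<inter> W)) ((\<lambda>p. left_field V \<psi> v p f) \<circ> inv_into U \<phi>)"
    by (simp add: c)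
qed

text \<open>Hence every tangent vector at the identity extends to a left-invariant field. This is what
  makes the dimension of the Lie algebra equal to that of the group.\<close>

lemma left_field_left_invariant:
  assumes "(V, \<psi>) \<in> \<A>" "\<one> \<in> V"
  shows "left_field V \<psi> v \<in> left_invariant_fields \<A> G"
  unfolding left_invariant_fields_def
proof (intro CollectI conjI allI)
  show "left_field V \<psi> v \<in> vector_fields \<A>"
    unfolding vector_fields_def using left_field_tangent[OF assms] left_field_smooth[OF assms] by blast
  fix a
  have "smooth_near \<A> (inv a \<otimes> p) (\<lambda>q. f (a \<otimes> q)) \<longleftrightarrow> smooth_near \<A> p f" for p f
    unfolding smooth_near_left_translation_iff by (simp flip: m_assoc)
  moreover have "a \<otimes> ((inv a \<otimes> p) \<otimes> q) = p \<otimes> q" for p q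
    by (simp flip: m_assoc)
  ultimately show "left_push G a (left_field V \<psi> v) = left_field V \<psi> v"
    by (simp add: left_push_def left_field_def fun_eq_iff)
qed

lemma chart_vector_left_field:
  assumes V: "(V, \<psi>) \<in> \<A>" "\<one> \<in> V"
  shows "chart_vector \<psi> (left_field V \<psi> v \<one>) = v"
proof (rule euclidean_eqI)
  fix b :: 'e assume b: "b \<in> Basis"
  have "((\<lambda>z. z \<bullet> b) has_derivative (\<lambda>z. z \<bullet> b)) (at (\<psi> \<one>))"
    by (rule bounded_linear_imp_has_derivative[OF bounded_linear_inner_left])
  then have "((\<lambda>q. \<psi> (\<one> \<otimes> q) \<bullet> b) \<circ> inv_into V \<psi> has_derivative (\<lambda>z. z \<bullet> b)) (at (\<psi> \<one>))"
  proof (rule has_derivative_transform_within_open[OF _ chart(2)[OF V(1)]])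
    show "\<psi> \<one> \<in> \<psi> ` V"
      using V by blast
  qed (use chart(5)[OF V(1)] in auto)
  from fun_cong[OF frechet_derivative_at[OF this], of v]
  have "left_field V \<psi> v \<one> (\<lambda>q. \<psi> q \<bullet> b) = v \<bullet> b"
    using smooth_near_coordinate[OF V] by (simp add: left_field_def)
  then show "chart_vector \<psi> (left_field V \<psi> v \<one>) \<bullet> b = v \<bullet> b"
    using b by (simp add: chart_vector_inner)
qed

end

locale lie_group_with_algebra = smooth_lie_group \<A> G
  for \<A> :: "('m::{t2_space, second_countable_topology}, 'e::euclidean_space) chart set"
    and G :: "'m monoid" (structure) +
  fixes br :: "'g::euclidean_space \<Rightarrow> 'g \<Rightarrow> 'g" and \<iota> :: "'g \<Rightarrow> 'm vfield"
  assumes lie_alg: "lie_algebra_of \<A> G br \<iota>"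
begin

lemma \<iota>_bij: "bij_betw \<iota> UNIV (left_invariant_fields \<A> G)"
  using lie_alg by (simp add: lie_algebra_of_def)

lemma \<iota>_left: "\<iota> x \<in> left_invariant_fields \<A> G"
  using \<iota>_bij by (auto simp: bij_betw_def)

lemma \<iota>_field: "\<iota> x \<in> vector_fields \<A>"
  using \<iota>_left by (simp add: left_invariant_fields_def)

lemma \<iota>_eq_iff: "\<iota> x = \<iota> y \<longleftrightarrow> x = y"
  using \<iota>_bij by (auto simp: bij_betw_def inj_on_def)

lemma \<iota>_add: "\<iota> (x + y) = vf_add (\<iota> x) (\<iota> y)"
  and \<iota>_scale: "\<iota> (c *\<^sub>R x) = vf_scale (\<lambda>_. c) (\<iota> x)"
  and \<iota>_br: "\<iota> (br x y) = vf_bracket \<A> (\<iota> x) (\<iota> y)"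
  using lie_alg by (simp_all add: lie_algebra_of_def)

text \<open>Left translations act transitively, so a left-invariant field is determined by its value at
  any one point.\<close>

lemma \<iota>_eq_at:
  assumes "\<iota> x p = \<iota> y p"
  shows "x = y"
proof -
  have "\<iota> x q f = \<iota> y q f" for q f
  proof -
    let ?a = "q \<otimes> inv p"
    have "inv ?a \<otimes> q = p"
      by (simp add: inv_mult_group m_assoc)
    moreover have "left_push G ?a (\<iota> z) q f = \<iota> z q f" for z
      using \<iota>_left[of z] by (simp add: left_invariant_fields_def)
    ultimately show ?thesis
      using assms unfolding left_push_def by metis
  qed
  then show ?thesis
    using \<iota>_eq_iff by blast
qed

text \<open>The isomorphism from the Lie algebra to the tangent space at \<open>p\<close>, in the
  coordinates of \<open>\<phi>\<close>.\<close>

definition frame :: "('m \<Rightarrow> 'e) \<Rightarrow> 'm \<Rightarrow> 'g \<Rightarrow> 'e" where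
  "frame \<phi> p x = chart_vector \<phi> (\<iota> x p)"

lemma linear_frame: "linear (frame \<phi> p)"
  by (intro linearI) (simp_all add: frame_def chart_vector_def \<iota>_add \<iota>_scale vf_add_def vf_scale_def
      scaleR_add_left sum.distrib scaleR_sum_right)

lemma inj_frame:
  assumes "(U, \<phi>) \<in> \<A>" "p \<in> U"
  shows "inj (frame \<phi> p)"
proof (rule injI)
  fix x y assume "frame \<phi> p x = frame \<phi> p y"
  then have "\<iota> x p = \<iota> y p"
    unfolding frame_def by (rule tangent_eqI[OF vector_fieldsD(1)[OF \<iota>_field] vector_fieldsD(1)[OF \<iota>_field] assms])
  then show "x = y"
    by (rule \<iota>_eq_at)
qed

text \<open>The frame at the identity is injective because a left-invariant field is determined by one
  value, and surjective because \<open>left_field\<close> supplies a left-invariant field with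
  any prescribed value.\<close>

lemma DIM_eq: "DIM('g) = DIM('e)"
proof -
  obtain V \<psi> where V: "(V, \<psi>) \<in> \<A>" "\<one> \<in> V"
    by (rule chart_at)
  have "surj (frame \<psi> \<one>)"
  proof (rule surjI)
    fix v
    show "frame \<psi> \<one> (the_inv_into UNIV \<iota> (left_field V \<psi> v)) = v"
      unfolding frame_def
      using f_the_inv_into_f_bij_betw[OF \<iota>_bij, of "left_field V \<psi> v"] left_field_left_invariant[OF V]
        chart_vector_left_field[OF V] by simp
  qed
  then have "dim (frame \<psi> \<one> ` UNIV) = DIM('e)"
    by simp
  moreover have "dim (frame \<psi> \<one> ` UNIV) = dim (UNIV :: 'g set)"
    by (rule dim_image_eq[OF linear_frame]) (use inj_frame[OF V] in simp)
  ultimately show ?thesis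
    by simp
qed

lemma surj_frame:
  assumes "(U, \<phi>) \<in> \<A>" "p \<in> U"
  shows "surj (frame \<phi> p)"
proof -
  have "dim (range (frame \<phi> p)) = dim (UNIV :: 'g set)"
    by (rule dim_image_eq[OF linear_frame]) (use inj_frame[OF assms] in simp)
  then have "dim (range (frame \<phi> p)) = DIM('e)"
    using DIM_eq by simp
  then have "span (range (frame \<phi> p)) = UNIV"
    using dim_eq_full by blast
  moreover have "span (range (frame \<phi> p)) = range (frame \<phi> p)"
    by (intro span_eq_iff[THEN iffD2] linear_subspace_image[OF linear_frame] subspace_UNIV)
  ultimately show ?thesis
    by simp
qed

lemma \<iota>_in_chart:
  assumes "(U, \<phi>) \<in> \<A>" "p \<in> U" "smooth_near \<A> p f"
  shows "\<iota> x p f = frechet_derivative (f \<circ> inv_into U \<phi>) (at (\<phi> p)) (frame \<phi> p x)"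
  unfolding frame_def by (rule tangent_in_chart[OF vector_fieldsD(1)[OF \<iota>_field] assms])

text \<open>The left-invariant fields as vector fields on the open set \<open>\<phi> ` U\<close> of
  coordinates, where the usual calculus applies.\<close>

definition frame_field :: "'m set \<Rightarrow> ('m \<Rightarrow> 'e) \<Rightarrow> 'g \<Rightarrow> 'e \<Rightarrow> 'e" where
  "frame_field U \<phi> x y = frame \<phi> (inv_into U \<phi> y) x"

lemma frame_field_smooth:
  assumes U: "(U, \<phi>) \<in> \<A>"
  shows "smooth_on (\<phi> ` U) (frame_field U \<phi> x)"
proof -
  have "Ck_on k (\<phi> ` U) (\<lambda>y. \<Sum>b\<in>Basis. \<iota> x (inv_into U \<phi> y) (\<lambda>q. \<phi> q \<bullet> b) *\<^sub>R b)" for k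
  proof (intro Ck_on_sum Ck_on_linear_compose[OF _ bounded_linear_scaleR_left] chart(2)[OF U])
    fix b :: 'e
    have "smooth_on (\<phi> ` (U \<inter> U)) ((\<lambda>p. \<iota> x p (\<lambda>q. \<phi> q \<bullet> b)) \<circ> inv_into U \<phi>)"
      by (rule smooth_funD[OF vector_fieldsD(2)[OF \<iota>_field smooth_fun_coordinate[OF U]] U])
    then show "Ck_on k (\<phi> ` U) (\<lambda>y. \<iota> x (inv_into U \<phi> y) (\<lambda>q. \<phi> q \<bullet> b))"
      by (simp add: smooth_on_def o_def)
  qed
  then show ?thesis
    unfolding smooth_on_def frame_field_def[abs_def] frame_def chart_vector_def by blast
qed

text \<open>The coordinate formula for the bracket of vector fields: second derivatives cancel in the
  commutator of the two derivations.\<close>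

lemma frame_bracket:
  assumes U: "(U, \<phi>) \<in> \<A>" "y \<in> \<phi> ` U"
  shows "frame_field U \<phi> (br x z) y =
    frechet_derivative (frame_field U \<phi> z) (at y) (frame_field U \<phi> x y) -
    frechet_derivative (frame_field U \<phi> x) (at y) (frame_field U \<phi> z y)"
proof (rule euclidean_eqI)
  fix b :: 'e assume b: "b \<in> Basis"
  let ?p = "inv_into U \<phi> y"
  have p: "?p \<in> U" "\<phi> ?p = y"
    using chart(6,7)[OF U(1)] U(2) by auto
  have fb: "smooth_near \<A> ?p (\<lambda>q. \<phi> q \<bullet> b)"
    by (rule smooth_near_coordinate[OF U(1) p(1)])
  have key: "\<iota> u ?p (\<lambda>q. \<iota> w q (\<lambda>q. \<phi> q \<bullet> b)) =
      frechet_derivative (frame_field U \<phi> w) (at y) (frame_field U \<phi> u y) \<bullet> b" for u w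
  proof -
    have "smooth_near \<A> ?p (\<lambda>q. \<iota> w q (\<lambda>q. \<phi> q \<bullet> b))"
      unfolding smooth_near_def
      using vector_fieldsD(2)[OF \<iota>_field smooth_fun_coordinate[OF U(1)]] p(1) by blast
    from \<iota>_in_chart[OF U(1) p(1) this, of u]
    have "\<iota> u ?p (\<lambda>q. \<iota> w q (\<lambda>q. \<phi> q \<bullet> b)) =
        frechet_derivative ((\<lambda>q. \<iota> w q (\<lambda>q. \<phi> q \<bullet> b)) \<circ> inv_into U \<phi>) (at y) (frame_field U \<phi> u y)"
      by (simp add: p(2) frame_field_def)
    also have "(\<lambda>q. \<iota> w q (\<lambda>q. \<phi> q \<bullet> b)) \<circ> inv_into U \<phi> = (\<lambda>y. frame_field U \<phi> w y \<bullet> b)"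
      using b by (simp add: frame_field_def frame_def chart_vector_inner fun_eq_iff)
    also have "frechet_derivative \<dots> (at y) = (\<lambda>h. frechet_derivative (frame_field U \<phi> w) (at y) h \<bullet> b)"
      by (rule frechet_derivative_at[symmetric, OF bounded_linear.has_derivative[OF bounded_linear_inner_left
              smooth_on_derivative[OF frame_field_smooth[OF U(1)] U(2)]]])
    finally show ?thesis .
  qed
  have "frame_field U \<phi> (br x z) y \<bullet> b = \<iota> (br x z) ?p (\<lambda>q. \<phi> q \<bullet> b)"
    using b by (simp add: frame_field_def frame_def chart_vector_inner)
  also have "\<dots> = \<iota> x ?p (\<lambda>q. \<iota> z q (\<lambda>q. \<phi> q \<bullet> b)) - \<iota> z ?p (\<lambda>q. \<iota> x q (\<lambda>q. \<phi> q \<bullet> b))"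
    using fb by (simp add: \<iota>_br vf_bracket_def)
  finally show "frame_field U \<phi> (br x z) y \<bullet> b =
    (frechet_derivative (frame_field U \<phi> z) (at y) (frame_field U \<phi> x y) -
    frechet_derivative (frame_field U \<phi> x) (at y) (frame_field U \<phi> z y)) \<bullet> b"
    by (simp add: key inner_diff_left)
qed

lemma C1_curve_in_chart:
  assumes \<gamma>: "C1_curve \<A> \<iota> \<gamma> u" and t: "t \<in> {0..1}" and U: "(U, \<phi>) \<in> \<A>" "\<gamma> t \<in> U"
  shows "((\<lambda>s. \<phi> (\<gamma> s)) has_vector_derivative frame \<phi> (\<gamma> t) (u t)) (at t within {0..1})"
  unfolding has_vector_derivative_def has_derivative_componentwise_within[of "\<lambda>s. \<phi> (\<gamma> s)"]
proof
  fix b :: 'e assume b: "b \<in> Basis"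
  have "((\<lambda>s. \<phi> (\<gamma> s) \<bullet> b) has_real_derivative \<iota> (u t) (\<gamma> t) (\<lambda>q. \<phi> q \<bullet> b)) (at t within {0..1})"
    using \<gamma> t smooth_near_coordinate[OF U] unfolding C1_curve_def by blast
  moreover have "\<iota> (u t) (\<gamma> t) (\<lambda>q. \<phi> q \<bullet> b) = frame \<phi> (\<gamma> t) (u t) \<bullet> b"
    using b by (simp add: frame_def chart_vector_inner)
  ultimately show "((\<lambda>s. \<phi> (\<gamma> s) \<bullet> b) has_derivative (\<lambda>h. (h *\<^sub>R frame \<phi> (\<gamma> t) (u t)) \<bullet> b)) (at t within {0..1})"
    by (simp add: has_field_derivative_def mult_commute_abs)
qed

end


section \<open>Integrals of left-invariant forms\<close>

text \<open>A linear map \<open>\<alpha>\<close> on the Lie algebra is a left-invariant form. The clauses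
  mirror those of parallel transport, so that the integrals and the transports run over the same
  concatenations of curves.\<close>

inductive line_integral :: "('m::topological_space, 'e::euclidean_space) chart set \<Rightarrow>
    ('g::real_normed_vector \<Rightarrow> 'm vfield) \<Rightarrow> ('g \<Rightarrow> 'b::euclidean_space) \<Rightarrow> 'm \<Rightarrow> 'm \<Rightarrow> 'b \<Rightarrow> bool"
  for \<A> \<iota> \<alpha> p where
  const: "line_integral \<A> \<iota> \<alpha> p p 0"
| append: "\<lbrakk>line_integral \<A> \<iota> \<alpha> p (\<gamma> 0) c; C1_curve \<A> \<iota> \<gamma> u\<rbrakk>
    \<Longrightarrow> line_integral \<A> \<iota> \<alpha> p (\<gamma> 1) (c + integral {0..1} (\<lambda>t. \<alpha> (u t)))"

text \<open>Together with the converse below, this passes between a complex form and its real and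
  imaginary parts.\<close>

lemma line_integral_linear_image:
  fixes \<alpha> :: "'g::euclidean_space \<Rightarrow> 'b::euclidean_space" and L :: "'b \<Rightarrow> 'c::euclidean_space"
  assumes L: "linear L" and \<alpha>: "linear \<alpha>"
  shows "line_integral \<A> \<iota> \<alpha> p q c \<Longrightarrow> line_integral \<A> \<iota> (L \<circ> \<alpha>) p q (L c)"
proof (induction rule: line_integral.induct)
  case const
  then show ?case
    using line_integral.const[of \<A> \<iota> "L \<circ> \<alpha>" p] by (simp add: linear_0[OF L] o_def)
next
  case (append \<gamma> c u)
  have "continuous_on {0..1} u"
    using append.hyps unfolding C1_curve_def by blast
  from integrable_continuous_real[OF linear_continuous_on_compose[OF this \<alpha>]]
  have "integral {0..1} (\<lambda>t. (L \<circ> \<alpha>) (u t)) = L (integral {0..1} (\<lambda>t. \<alpha> (u t)))"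
    using integral_linear[of "\<lambda>t. \<alpha> (u t)" "{0..1}" L] L by (simp add: o_def linear_conv_bounded_linear)
  then show ?case
    using line_integral.append[OF append.IH append.hyps(2)] by (simp add: linear_add[OF L])
qed

lemma line_integral_linear_preimage:
  fixes \<alpha> :: "'g::euclidean_space \<Rightarrow> 'b::euclidean_space" and L :: "'b \<Rightarrow> 'c::euclidean_space"
  assumes L: "linear L" and \<alpha>: "linear \<alpha>"
  shows "line_integral \<A> \<iota> (L \<circ> \<alpha>) p q d \<Longrightarrow> \<exists>c. line_integral \<A> \<iota> \<alpha> p q c \<and> d = L c"
proof (induction rule: line_integral.induct)
  case const
  show ?case
    using line_integral.const[of \<A> \<iota> \<alpha> p] linear_0[OF L] by metis
next
  case (append \<gamma> d u)
  obtain c where c: "line_integral \<A> \<iota> \<alpha> p (\<gamma> 0) c" "d = L c"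
    using append.IH by blast
  have "continuous_on {0..1} u"
    using append.hyps unfolding C1_curve_def by blast
  from integrable_continuous_real[OF linear_continuous_on_compose[OF this \<alpha>]]
  have "integral {0..1} (\<lambda>t. (L \<circ> \<alpha>) (u t)) = L (integral {0..1} (\<lambda>t. \<alpha> (u t)))"
    using integral_linear[of "\<lambda>t. \<alpha> (u t)" "{0..1}" L] L by (simp add: o_def linear_conv_bounded_linear)
  then show ?case
    using line_integral.append[OF c(1) append.hyps(2)] c(2) by (metis linear_add[OF L])
qed

context lie_group_with_algebra
begin

text \<open>In a chart, \<open>\<alpha>\<close> becomes the vector field \<open>B\<close> dual to the
  coordinate form. It solves a linear system whose coefficients are the smooth frame, so it is
  continuously differentiable. Differentiating the constant function \<open>B y \<bullet>
  frame_field U \<phi> x y = \<alpha> x\<close> gives the structure equation \<open>d\<alpha>(x,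
  z) = - \<alpha> [x, z]\<close>: the failure of \<open>B'\<close> to be symmetric is measured
  by \<open>\<alpha>\<close> on brackets.\<close>

lemma dual_form:
  fixes \<alpha> :: "'g \<Rightarrow> real"
  assumes U: "(U, \<phi>) \<in> \<A>" and \<alpha>: "linear \<alpha>"
  obtains B B' where "\<And>y x. y \<in> \<phi> ` U \<Longrightarrow> B y \<bullet> frame_field U \<phi> x y = \<alpha> x"
    "\<And>y. y \<in> \<phi> ` U \<Longrightarrow> (B has_derivative B' y) (at y)" "\<And>v. continuous_on (\<phi> ` U) (\<lambda>y. B' y v)"
    "\<And>y x z. y \<in> \<phi> ` U \<Longrightarrow> B' y (frame_field U \<phi> x y) \<bullet> frame_field U \<phi> z y
       - B' y (frame_field U \<phi> z y) \<bullet> frame_field U \<phi> x y = - \<alpha> (br x z)"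
proof -
  obtain V \<psi> where V: "(V, \<psi>) \<in> \<A>" "\<one> \<in> V"
    by (rule chart_at)
  define L where "L = frame \<psi> \<one>"
  \<comment> \<open>The preimages \<open>e b\<close> of the standard basis under the frame at the identity form
    a basis of the Lie algebra, indexed by the basis of the model space; \<open>B\<close> is
    determined by its pairing with these frame fields.\<close>
  define e where "e = inv_into UNIV L"
  have L: "linear L"
    unfolding L_def by (rule linear_frame)
  have eL: "e (L x) = x" for x
    using inj_frame[OF V] by (simp add: e_def L_def inv_f_f)
  have Le: "L (e v) = v" for v
    using surj_frame[OF V] by (simp add: e_def L_def surj_f_inv_f)
  have expand: "x = (\<Sum>b\<in>Basis. (L x \<bullet> b) *\<^sub>R e b)" for x
  proof -
    have "L (\<Sum>b\<in>Basis. (L x \<bullet> b) *\<^sub>R e b) = L x"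
      by (simp add: linear_sum[OF L] linear_scale[OF L] Le euclidean_representation)
    then show ?thesis
      using inj_frame[OF V] unfolding L_def inj_def by metis
  qed
  have linA: "linear (\<lambda>x. frame_field U \<phi> x y)" for y
    using linear_frame[of \<phi> "inv_into U \<phi> y"] by (simp add: frame_field_def[abs_def])
  have surjA: "\<exists>x. frame_field U \<phi> x y = v" if "y \<in> \<phi> ` U" for y v
    using surj_frame[OF U chart(7)[OF U that]] unfolding frame_field_def surj_def by metis
  have det: "w \<bullet> frame_field U \<phi> x y = \<beta> x"
    if "linear \<beta>" "\<And>b. b \<in> Basis \<Longrightarrow> w \<bullet> frame_field U \<phi> (e b) y = \<beta> (e b)" for w x y and \<beta> :: "'g \<Rightarrow> real"
  proof -
    have "w \<bullet> frame_field U \<phi> (\<Sum>b\<in>Basis. (L x \<bullet> b) *\<^sub>R e b) y = \<beta> (\<Sum>b\<in>Basis. (L x \<bullet> b) *\<^sub>R e b)"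
      using that(2) by (simp add: linear_sum[OF linA] linear_scale[OF linA] linear_sum[OF that(1)]
          linear_scale[OF that(1)] inner_sum_right)
    then show ?thesis
      using expand[of x] by simp
  qed
  define T where "T y w = (\<Sum>b\<in>Basis. (w \<bullet> frame_field U \<phi> (e b) y) *\<^sub>R b)" for y w
  have T_inner: "T y w \<bullet> b = w \<bullet> frame_field U \<phi> (e b) y" if "b \<in> Basis" for y w b
    using that by (simp add: T_def)
  have linT: "linear (T y)" for y
    by (intro linearI) (simp_all add: T_def inner_add_left scaleR_add_left sum.distrib scaleR_sum_right)
  have injT: "inj (T y)" if y: "y \<in> \<phi> ` U" for y
  proof (subst linear_injective_0[OF linT], intro allI impI)
    fix w assume "T y w = 0"
    then have "w \<bullet> frame_field U \<phi> (e b) y = 0" if "b \<in> Basis" for b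
      using T_inner[OF that, of y w] by simp
    then have "w \<bullet> frame_field U \<phi> x y = 0" for x
      by (rule det[OF linear_zero])
    then have "w \<bullet> w = 0"
      using surjA[OF y] by metis
    then show "w = 0"
      by simp
  qed
  have smT: "smooth_on (\<phi> ` U) (\<lambda>y. T y w)" for w
    unfolding smooth_on_def T_def
  proof (intro allI Ck_on_sum Ck_on_linear_compose[OF _ bounded_linear_scaleR_left]
      Ck_on_linear_compose[OF _ bounded_linear_inner_right] chart(2)[OF U])
    show "Ck_on k (\<phi> ` U) (\<lambda>y. frame_field U \<phi> (e b) y)" for k b
      using frame_field_smooth[OF U, of "e b"] by (simp add: smooth_on_def)
  qed
  obtain B B' where B: "\<And>y. y \<in> \<phi> ` U \<Longrightarrow> T y (B y) = (\<Sum>b\<in>Basis. \<alpha> (e b) *\<^sub>R b)"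
    "\<And>y. y \<in> \<phi> ` U \<Longrightarrow> (B has_derivative B' y) (at y)" "\<And>v. continuous_on (\<phi> ` U) (\<lambda>y. B' y v)"
    by (rule linear_system_solution_C1[OF chart(2)[OF U] linT injT smT, of "\<Sum>b\<in>Basis. \<alpha> (e b) *\<^sub>R b"]) blast+
  have dual: "B y \<bullet> frame_field U \<phi> x y = \<alpha> x" if y: "y \<in> \<phi> ` U" for y x
  proof (rule det[OF \<alpha>])
    fix b :: 'e assume b: "b \<in> Basis"
    show "B y \<bullet> frame_field U \<phi> (e b) y = \<alpha> (e b)"
      using T_inner[OF b, of y "B y"] B(1)[OF y] b by simp
  qed
  have skew: "B' y (frame_field U \<phi> x y) \<bullet> frame_field U \<phi> z y
       - B' y (frame_field U \<phi> z y) \<bullet> frame_field U \<phi> x y = - \<alpha> (br x z)" if y: "y \<in> \<phi> ` U" for y x z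
  proof -
    let ?A = "\<lambda>x. frame_field U \<phi> x y" and ?A' = "\<lambda>x. frechet_derivative (frame_field U \<phi> x) (at y)"
    have prod: "B y \<bullet> ?A' z h + B' y h \<bullet> ?A z = 0" for z h
    proof -
      have "((\<lambda>y. B y \<bullet> frame_field U \<phi> z y) has_derivative (\<lambda>h. B y \<bullet> ?A' z h + B' y h \<bullet> ?A z)) (at y)"
        by (rule has_derivative_inner[OF B(2)[OF y] smooth_on_derivative[OF frame_field_smooth[OF U] y]])
      moreover have "((\<lambda>y. B y \<bullet> frame_field U \<phi> z y) has_derivative (\<lambda>h. 0)) (at y)"
        by (rule has_derivative_transform_within_open[OF has_derivative_const[of "\<alpha> z"] chart(2)[OF U] y])
          (simp add: dual)
      ultimately have "(\<lambda>h. B y \<bullet> ?A' z h + B' y h \<bullet> ?A z) = (\<lambda>h. 0)"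
        by (rule has_derivative_unique)
      then show ?thesis
        by (rule fun_cong)
    qed
    have "\<alpha> (br x z) = B y \<bullet> ?A (br x z)"
      by (simp add: dual[OF y])
    also have "\<dots> = B y \<bullet> ?A' z (?A x) - B y \<bullet> ?A' x (?A z)"
      by (simp add: frame_bracket[OF U y] inner_diff_right)
    finally show ?thesis
      using prod[of z "?A x"] prod[of x "?A z"] by linarith
  qed
  show ?thesis
    by (rule that[of B B', OF dual B(2,3) skew])
qed

text \<open>The condition \<open>dF = \<alpha>\<close> at the point \<open>p\<close>, required in all
  charts around \<open>p\<close>; one chart suffices by the chain rule.\<close>

definition primitive_at :: "('g \<Rightarrow> real) \<Rightarrow> ('m \<Rightarrow> real) \<Rightarrow> 'm \<Rightarrow> bool" where
  "primitive_at \<alpha> F p \<longleftrightarrow> (\<forall>U \<phi>. (U, \<phi>) \<in> \<A> \<longrightarrow> p \<in> U \<longrightarrow>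
     (\<exists>D. ((F \<circ> inv_into U \<phi>) has_derivative D) (at (\<phi> p)) \<and> (\<forall>x. D (frame \<phi> p x) = \<alpha> x)))"

lemma frame_transition:
  assumes U: "(U, \<phi>) \<in> \<A>" "p \<in> U" and V: "(V, \<psi>) \<in> \<A>" "p \<in> V"
  shows "frechet_derivative (\<psi> \<circ> inv_into U \<phi>) (at (\<phi> p)) (frame \<phi> p x) = frame \<psi> p x"
proof (rule euclidean_eqI)
  fix b :: 'e assume b: "b \<in> Basis"
  have "frame \<psi> p x \<bullet> b = \<iota> x p (\<lambda>q. \<psi> q \<bullet> b)"
    using b by (simp add: frame_def chart_vector_inner)
  also have "\<dots> = frechet_derivative ((\<lambda>q. \<psi> q \<bullet> b) \<circ> inv_into U \<phi>) (at (\<phi> p)) (frame \<phi> p x)"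
    by (rule \<iota>_in_chart[OF U smooth_near_coordinate[OF V]])
  also have "(\<lambda>q. \<psi> q \<bullet> b) \<circ> inv_into U \<phi> = (\<lambda>y. (\<psi> \<circ> inv_into U \<phi>) y \<bullet> b)"
    by auto
  also have "frechet_derivative \<dots> (at (\<phi> p)) = (\<lambda>h. frechet_derivative (\<psi> \<circ> inv_into U \<phi>) (at (\<phi> p)) h \<bullet> b)"
    by (rule frechet_derivative_at[symmetric, OF bounded_linear.has_derivative[OF bounded_linear_inner_left
            transition_derivative[OF U(1) V(1) U(2) V(2)]]])
  finally show "frechet_derivative (\<psi> \<circ> inv_into U \<phi>) (at (\<phi> p)) (frame \<phi> p x) \<bullet> b = frame \<psi> p x \<bullet> b"
    by simp
qed

lemma primitive_atI:
  assumes V: "(V, \<psi>) \<in> \<A>" "p \<in> V" and D: "((F \<circ> inv_into V \<psi>) has_derivative D) (at (\<psi> p))"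
    and D\<alpha>: "\<And>x. D (frame \<psi> p x) = \<alpha> x"
  shows "primitive_at \<alpha> F p"
  unfolding primitive_at_def
proof (intro allI impI)
  fix U \<phi> assume U: "(U, \<phi>) \<in> \<A>" "p \<in> U"
  let ?\<tau> = "\<psi> \<circ> inv_into U \<phi>"
  let ?\<tau>' = "frechet_derivative ?\<tau> (at (\<phi> p))"
  have \<tau>p: "?\<tau> (\<phi> p) = \<psi> p"
    by (simp add: chart(5)[OF U])
  have "((F \<circ> inv_into V \<psi>) \<circ> ?\<tau> has_derivative D \<circ> ?\<tau>') (at (\<phi> p))"
    by (rule diff_chain_at[OF transition_derivative[OF U(1) V(1) U(2) V(2)]]) (use D \<tau>p in simp)
  then have "(F \<circ> inv_into U \<phi> has_derivative D \<circ> ?\<tau>') (at (\<phi> p))"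
  proof (rule has_derivative_transform_within_open)
    show "open (\<phi> ` (U \<inter> V))"
      by (rule open_chart_image[OF U(1) chart(1)[OF V(1)]])
    show "\<phi> p \<in> \<phi> ` (U \<inter> V)"
      using U V by blast
    show "((F \<circ> inv_into V \<psi>) \<circ> ?\<tau>) y = (F \<circ> inv_into U \<phi>) y" if "y \<in> \<phi> ` (U \<inter> V)" for y
      using that chart(5)[OF U(1)] chart(5)[OF V(1)] by auto
  qed
  moreover have "(D \<circ> ?\<tau>') (frame \<phi> p x) = \<alpha> x" for x
    by (simp add: frame_transition[OF U V] D\<alpha>)
  ultimately show "\<exists>D. ((F \<circ> inv_into U \<phi>) has_derivative D) (at (\<phi> p)) \<and> (\<forall>x. D (frame \<phi> p x) = \<alpha> x)"
    by blast
qed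

definition primitives :: "('g \<Rightarrow> real) \<Rightarrow> ('m set \<times> ('m \<Rightarrow> real)) set" where
  "primitives \<alpha> = {(V, F). open V \<and> (\<forall>p\<in>V. primitive_at \<alpha> F p)}"

text \<open>If \<open>\<alpha>\<close> vanishes on brackets, the structure equation makes the derivative
  of the dual field symmetric, and the Poincare lemma yields a primitive on a coordinate ball.
  Two primitives have the same derivative and differ by a constant on every ball.\<close>

lemma closed_form_primitives:
  assumes \<alpha>: "linear \<alpha>" and closed: "\<And>x y. \<alpha> (br x y) = 0"
  shows "local_primitives (primitives \<alpha>)"
  unfolding local_primitives_def
proof (intro conjI allI impI)
  show "open V" if "(V, F) \<in> primitives \<alpha>" for V F
    using that by (simp add: primitives_def)
  show "\<exists>V F. (V, F) \<in> primitives \<alpha> \<and> p \<in> V" for p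
  proof -
    obtain U \<phi> where U: "(U, \<phi>) \<in> \<A>" "p \<in> U"
      by (rule chart_at)
    obtain B B' where B: "\<And>y x. y \<in> \<phi> ` U \<Longrightarrow> B y \<bullet> frame_field U \<phi> x y = \<alpha> x"
      "\<And>y. y \<in> \<phi> ` U \<Longrightarrow> (B has_derivative B' y) (at y)" "\<And>v. continuous_on (\<phi> ` U) (\<lambda>y. B' y v)"
      "\<And>y x z. y \<in> \<phi> ` U \<Longrightarrow> B' y (frame_field U \<phi> x y) \<bullet> frame_field U \<phi> z y
         - B' y (frame_field U \<phi> z y) \<bullet> frame_field U \<phi> x y = - \<alpha> (br x z)"
      by (rule dual_form[OF U(1) \<alpha>]) blast
    obtain r where r: "r > 0" "ball (\<phi> p) r \<subseteq> \<phi> ` U"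
      using chart(2)[OF U(1)] U(2) openE by blast
    have "\<exists>F :: 'e \<Rightarrow> real. \<forall>y\<in>ball (\<phi> p) r. (F has_derivative (\<lambda>h. B y \<bullet> h)) (at y)"
    proof (rule poincare_lemma[where B' = B' and z = "\<phi> p"])
      show "continuous_on (ball (\<phi> p) r) (\<lambda>y. B' y v)" for v
        using B(3) r(2) by (rule continuous_on_subset)
      show "B' y u \<bullet> v = B' y v \<bullet> u" if "y \<in> ball (\<phi> p) r" for y u v
      proof -
        have y: "y \<in> \<phi> ` U"
          using that r(2) by blast
        obtain x z where "frame_field U \<phi> x y = u" "frame_field U \<phi> z y = v"
          using surj_frame[OF U(1) chart(7)[OF U(1) y]] unfolding frame_field_def surj_def by metis
        then show ?thesis
          using B(4)[OF y, of x z] closed by simp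
      qed
    qed (use r B(2) in auto)
    then obtain F :: "'e \<Rightarrow> real" where F: "\<And>y. y \<in> ball (\<phi> p) r \<Longrightarrow> (F has_derivative (\<lambda>h. B y \<bullet> h)) (at y)"
      by blast
    let ?V = "U \<inter> \<phi> -` ball (\<phi> p) r"
    have "primitive_at \<alpha> (F \<circ> \<phi>) q" if q: "q \<in> ?V" for q
    proof (rule primitive_atI[OF U(1)])
      show "q \<in> U"
        using q by blast
      have "(F has_derivative (\<lambda>h. B (\<phi> q) \<bullet> h)) (at (\<phi> q))"
        using F q by blast
      then show "((F \<circ> \<phi>) \<circ> inv_into U \<phi> has_derivative (\<lambda>h. B (\<phi> q) \<bullet> h)) (at (\<phi> q))"
        by (rule has_derivative_transform_within_open[OF _ chart(2)[OF U(1)]]) (use q chart(6)[OF U(1)] in auto)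
      show "B (\<phi> q) \<bullet> frame \<phi> q x = \<alpha> x" for x
        using B(1)[of "\<phi> q" x] q chart(5)[OF U(1)] by (simp add: frame_field_def)
    qed
    moreover have "open ?V"
      using chart(1,3)[OF U(1)] by (metis continuous_on_open_vimage Int_commute open_ball)
    moreover have "p \<in> ?V"
      using U(2) r(1) by simp
    ultimately show ?thesis
      unfolding primitives_def by blast
  qed
  show "\<exists>U. open U \<and> p \<in> U \<and> (\<lambda>q. F q - H q) constant_on U"
    if V: "(V, F) \<in> primitives \<alpha>" "(W, H) \<in> primitives \<alpha>" "p \<in> V" "p \<in> W" for V F W H p
  proof -
    obtain U \<phi> where U: "(U, \<phi>) \<in> \<A>" "p \<in> U"
      by (rule chart_at)
    let ?S = "\<phi> ` (U \<inter> (V \<inter> W))"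
    have VW: "open (V \<inter> W)"
      using V by (auto simp: primitives_def)
    have "open ?S" "\<phi> p \<in> ?S"
      using open_chart_image[OF U(1) VW] U V by auto
    then obtain r where r: "r > 0" "ball (\<phi> p) r \<subseteq> ?S"
      using openE by blast
    have der: "((\<lambda>y. F (inv_into U \<phi> y) - H (inv_into U \<phi> y)) has_derivative (\<lambda>h. 0)) (at y within ball (\<phi> p) r)"
      if y: "y \<in> ball (\<phi> p) r" for y
    proof -
      obtain q where q: "q \<in> U" "q \<in> V" "q \<in> W" "y = \<phi> q"
        using y r(2) by blast
      have "primitive_at \<alpha> F q" "primitive_at \<alpha> H q"
        using V q by (auto simp: primitives_def)
      then obtain D D' where D: "((F \<circ> inv_into U \<phi>) has_derivative D) (at (\<phi> q))" "\<And>x. D (frame \<phi> q x) = \<alpha> x"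
        "((H \<circ> inv_into U \<phi>) has_derivative D') (at (\<phi> q))" "\<And>x. D' (frame \<phi> q x) = \<alpha> x"
        using U(1) q(1) unfolding primitive_at_def by metis
      have "D h - D' h = 0" for h
        using surj_frame[OF U(1) q(1)] D(2,4) unfolding surj_def by (metis diff_self)
      then show ?thesis
        using has_derivative_at_withinI[OF has_derivative_diff[OF D(1,3)]] q(4) by (simp add: o_def)
    qed
    have "\<exists>c. \<forall>y\<in>ball (\<phi> p) r. F (inv_into U \<phi> y) - H (inv_into U \<phi> y) = c"
      by (rule has_derivative_zero_constant[OF convex_ball der])
    then obtain c where c: "\<And>y. y \<in> ball (\<phi> p) r \<Longrightarrow> F (inv_into U \<phi> y) - H (inv_into U \<phi> y) = c"
      by blast
    let ?N = "U \<inter> \<phi> -` ball (\<phi> p) r"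
    have "F q - H q = c" if "q \<in> ?N" for q
      using c[of "\<phi> q"] that chart(5)[OF U(1)] by simp
    then have "(\<lambda>q. F q - H q) constant_on ?N"
      unfolding constant_on_def by blast
    moreover have "open ?N"
      using chart(1,3)[OF U(1)] by (metis continuous_on_open_vimage Int_commute open_ball)
    moreover have "p \<in> ?N"
      using U(2) r(1) by simp
    ultimately show ?thesis
      by blast
  qed
qed

lemma C1_curve_primitive:
  assumes \<gamma>: "C1_curve \<A> \<iota> \<gamma> u" and t: "t \<in> {0..1}" and F: "primitive_at \<alpha> F (\<gamma> t)"
  shows "((\<lambda>s. F (\<gamma> s)) has_vector_derivative \<alpha> (u t)) (at t within {0..1})"
proof -
  obtain U \<phi> where U: "(U, \<phi>) \<in> \<A>" "\<gamma> t \<in> U"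
    by (rule chart_at)
  obtain D where D: "((F \<circ> inv_into U \<phi>) has_derivative D) (at (\<phi> (\<gamma> t)))" "\<And>x. D (frame \<phi> (\<gamma> t) x) = \<alpha> x"
    using F U unfolding primitive_at_def by blast
  have "((F \<circ> inv_into U \<phi>) \<circ> (\<lambda>s. \<phi> (\<gamma> s)) has_vector_derivative D (frame \<phi> (\<gamma> t) (u t))) (at t within {0..1})"
    by (rule vector_derivative_diff_chain_within[OF C1_curve_in_chart[OF \<gamma> t U] has_derivative_at_withinI[OF D(1)]])
  then have der: "((\<lambda>s. F (inv_into U \<phi> (\<phi> (\<gamma> s)))) has_vector_derivative \<alpha> (u t)) (at t within {0..1})"
    by (simp add: D(2) o_def)
  have "continuous_on {0..1} \<gamma>"
    using \<gamma> unfolding C1_curve_def by blast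
  then obtain M where M: "open M" "M \<inter> {0..1} = \<gamma> -` U \<inter> {0..1}"
    using chart(1)[OF U(1)] unfolding continuous_on_open_invariant by blast
  then have "t \<in> M"
    using t U(2) by blast
  then obtain d where d: "d > 0" "ball t d \<subseteq> M"
    using M(1) openE by blast
  show ?thesis
  proof (rule has_vector_derivative_transform_within[OF der d(1) t])
    fix s assume "s \<in> {0..1}" "dist s t < d"
    then have "\<gamma> s \<in> U"
      using d(2) M(2) by (auto simp: dist_commute subset_iff)
    then show "F (inv_into U \<phi> (\<phi> (\<gamma> s))) = F (\<gamma> s)"
      by (simp add: chart(5)[OF U(1)])
  qed
qed

text \<open>Links the topological notion of a primitive along a curve with the integral, by the
  fundamental theorem of calculus.\<close>

lemma C1_curve_primitive_along:
  assumes \<V>: "local_primitives (primitives \<alpha>)" and \<alpha>: "linear \<alpha>" and \<gamma>: "C1_curve \<A> \<iota> \<gamma> u"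
  shows "primitive_along (primitives \<alpha>) \<gamma> {0..1} (\<lambda>t. integral {0..t} (\<lambda>s. \<alpha> (u s)))"
proof -
  let ?\<Phi> = "\<lambda>t. integral {0..t} (\<lambda>s. \<alpha> (u s))"
  have cont: "continuous_on {0..1} \<gamma>" "continuous_on {0..1} u"
    using \<gamma> unfolding C1_curve_def by blast+
  have "\<exists>N V F. open N \<and> z \<in> N \<and> (V, F) \<in> primitives \<alpha> \<and> \<gamma> ` (N \<inter> {0..1}) \<subseteq> V \<and>
      (\<lambda>t. ?\<Phi> t - F (\<gamma> t)) constant_on (N \<inter> {0..1})" if z: "z \<in> {0..1}" for z
  proof -
    obtain V F where V: "(V, F) \<in> primitives \<alpha>" "\<gamma> z \<in> V"
      using \<V> unfolding local_primitives_def by blast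
    have "open V"
      using V by (simp add: primitives_def)
    then obtain M where M: "open M" "M \<inter> {0..1} = \<gamma> -` V \<inter> {0..1}"
      using cont(1) unfolding continuous_on_open_invariant by blast
    have "z \<in> M"
      using M z V(2) by blast
    then obtain d where d: "d > 0" "ball z d \<subseteq> M"
      using M(1) openE by blast
    have sub: "\<gamma> ` (ball z d \<inter> {0..1}) \<subseteq> V"
      using d(2) M(2) by blast
    have "((\<lambda>t. ?\<Phi> t - F (\<gamma> t)) has_derivative (\<lambda>h. 0)) (at t within ball z d \<inter> {0..1})"
      if t: "t \<in> ball z d \<inter> {0..1}" for t
    proof -
      have t1: "t \<in> {0..1}"
        using t by blast
      have "primitive_at \<alpha> F (\<gamma> t)"
        using V(1) sub t unfolding primitives_def by blast
      then have 1: "((\<lambda>s. F (\<gamma> s)) has_vector_derivative \<alpha> (u t)) (at t within {0..1})"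
        by (rule C1_curve_primitive[OF \<gamma> t1])
      have 2: "(?\<Phi> has_vector_derivative \<alpha> (u t)) (at t within {0..1})"
        by (rule integral_has_vector_derivative[OF linear_continuous_on_compose[OF cont(2) \<alpha>] t1])
      have "((\<lambda>t. ?\<Phi> t - F (\<gamma> t)) has_vector_derivative 0) (at t within {0..1})"
        using has_vector_derivative_diff[OF 2 1] by simp
      then have "((\<lambda>t. ?\<Phi> t - F (\<gamma> t)) has_derivative (\<lambda>h. 0)) (at t within {0..1})"
        by (simp add: has_vector_derivative_def)
      then show ?thesis
        by (rule has_derivative_subset) blast
    qed
    from has_derivative_zero_constant[OF convex_Int[OF convex_ball convex_real_interval(5)] this]
    have "(\<lambda>t. ?\<Phi> t - F (\<gamma> t)) constant_on (ball z d \<inter> {0..1})"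
      unfolding constant_on_def by blast
    then show ?thesis
      using V(1) sub d(1) by (intro exI[of _ "ball z d"] exI[of _ V] exI[of _ F]) auto
  qed
  then show ?thesis
    unfolding primitive_along_def by (rule ballI)
qed

text \<open>A concatenation of curves is joined into one continuous path, for which the monodromy argument
  applies. The joined path need not be differentiable at the corners; this is why primitives
  along merely continuous maps are used.\<close>

lemma line_integral_primitive_along:
  assumes \<V>: "local_primitives (primitives \<alpha>)" and \<alpha>: "linear \<alpha>"
  shows "line_integral \<A> \<iota> \<alpha> p q c \<Longrightarrow> \<exists>\<gamma> \<Phi>. path \<gamma> \<and> \<gamma> 0 = p \<and> \<gamma> 1 = q \<and>
    primitive_along (primitives \<alpha>) \<gamma> {0..1} \<Phi> \<and> \<Phi> 1 - \<Phi> 0 = c"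
proof (induction rule: line_integral.induct)
  case const
  obtain V F where V: "(V, F) \<in> primitives \<alpha>" "p \<in> V"
    using \<V> unfolding local_primitives_def by blast
  have "primitive_along (primitives \<alpha>) (\<lambda>_. p) {0..1::real} (\<lambda>_. 0)"
    unfolding primitive_along_def
    by (intro ballI exI[of _ UNIV] exI[of _ V] exI[of _ F]) (use V in \<open>auto simp: constant_on_def\<close>)
  then show ?case
    by (intro exI[of _ "\<lambda>_. p"] exI[of _ "\<lambda>_. 0"]) (simp add: path_def continuous_on_const)
next
  case (append \<gamma> c u)
  obtain \<delta> \<Phi> where \<delta>: "path \<delta>" "\<delta> 0 = p" "\<delta> 1 = \<gamma> 0"
    "primitive_along (primitives \<alpha>) \<delta> {0..1} \<Phi>" "\<Phi> 1 - \<Phi> 0 = c"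
    using append.IH by blast
  have \<gamma>: "path \<gamma>"
    using append.hyps(2) unfolding C1_curve_def path_def by blast
  let ?j = "\<delta> +++ \<gamma>"
  have j: "path ?j"
    using \<delta> \<gamma> by (intro path_join_imp) (auto simp: pathstart_def pathfinish_def)
  obtain \<Theta> where \<Theta>: "primitive_along (primitives \<alpha>) ?j {0..1} \<Theta>"
    by (rule exE[OF primitive_along_path[OF \<V> j]])
  have "primitive_along (primitives \<alpha>) (?j \<circ> (\<lambda>t. t / 2)) {0..1} (\<Theta> \<circ> (\<lambda>t. t / 2))"
    by (rule primitive_along_compose[OF \<Theta>]) (auto intro!: continuous_intros)
  then have 1: "primitive_along (primitives \<alpha>) \<delta> {0..1} (\<Theta> \<circ> (\<lambda>t. t / 2))"
    by (rule primitive_along_cong[rotated]) (auto simp: joinpaths_def)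
  have "primitive_along (primitives \<alpha>) (?j \<circ> (\<lambda>t. (t + 1) / 2)) {0..1} (\<Theta> \<circ> (\<lambda>t. (t + 1) / 2))"
    by (rule primitive_along_compose[OF \<Theta>]) (auto intro!: continuous_intros)
  then have 2: "primitive_along (primitives \<alpha>) \<gamma> {0..1} (\<Theta> \<circ> (\<lambda>t. (t + 1) / 2))"
    by (rule primitive_along_cong[rotated]) (use \<delta>(3) in \<open>auto simp: joinpaths_def field_simps\<close>)
  have "\<Phi> 1 - \<Phi> 0 = (\<Theta> \<circ> (\<lambda>t. t / 2)) 1 - (\<Theta> \<circ> (\<lambda>t. t / 2)) 0"
    by (rule primitive_along_unique[OF \<V> \<delta>(4) 1]) (use \<delta>(1) in \<open>auto simp: path_def\<close>)
  moreover have "integral {0..1} (\<lambda>s. \<alpha> (u s)) - integral {0..0} (\<lambda>s. \<alpha> (u s))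
      = (\<Theta> \<circ> (\<lambda>t. (t + 1) / 2)) 1 - (\<Theta> \<circ> (\<lambda>t. (t + 1) / 2)) 0"
    by (rule primitive_along_unique[OF \<V> C1_curve_primitive_along[OF \<V> \<alpha> append.hyps(2)] 2])
      (use \<gamma> in \<open>auto simp: path_def\<close>)
  ultimately have "\<Theta> 1 - \<Theta> 0 = c + integral {0..1} (\<lambda>s. \<alpha> (u s))"
    using \<delta>(5) by simp
  moreover have "?j 0 = p" "?j 1 = \<gamma> 1"
    using \<delta>(2) by (simp_all add: joinpaths_def)
  ultimately show ?case
    using j \<Theta> by (intro exI[of _ ?j] exI[of _ \<Theta>] conjI)
qed

text \<open>A left-invariant form that vanishes on brackets is closed, hence exact on a simply connected
  group.\<close>

theorem closed_form_loop_integral: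
  fixes \<alpha> :: "'g \<Rightarrow> real"
  assumes "linear \<alpha>" "\<And>x y. \<alpha> (br x y) = 0" "simply_connected (UNIV :: 'm set)"
    and "line_integral \<A> \<iota> \<alpha> p p c"
  shows "c = 0"
proof -
  have \<V>: "local_primitives (primitives \<alpha>)"
    by (rule closed_form_primitives[OF assms(1,2)])
  obtain \<gamma> \<Phi> where \<gamma>: "path \<gamma>" "\<gamma> 0 = p" "\<gamma> 1 = p" "primitive_along (primitives \<alpha>) \<gamma> {0..1} \<Phi>" "\<Phi> 1 - \<Phi> 0 = c"
    using line_integral_primitive_along[OF \<V> assms(1,4)] by blast
  then have "\<Phi> 1 = \<Phi> 0"
    using primitive_along_loop[OF \<V> assms(3) \<gamma>(1) _ \<gamma>(4)] by simp
  then show ?thesis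
    using \<gamma>(5) by simp
qed

end


section \<open>Forms with vanishing loop integrals\<close>

context lie_group_with_algebra
begin

text \<open>A segment in coordinates has a velocity \<open>u\<close> with respect to the left-invariant
  frame. Its continuity follows from \<open>dual_form\<close> applied to the coordinate
  functionals of the Lie algebra.\<close>

lemma segment_curve:
  assumes U: "(U, \<phi>) \<in> \<A>" and seg: "closed_segment y z \<subseteq> \<phi> ` U"
  shows "\<exists>u. C1_curve \<A> \<iota> (\<lambda>t. inv_into U \<phi> (y + t *\<^sub>R (z - y))) u \<and>
    (\<forall>t\<in>{0..1}. frame_field U \<phi> (u t) (y + t *\<^sub>R (z - y)) = z - y)"
proof -
  define l where "l t = y + t *\<^sub>R (z - y)" for t :: real
  have l: "l t \<in> \<phi> ` U" if "t \<in> {0..1}" for t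
  proof -
    have "l t \<in> closed_segment y z"
      using that unfolding closed_segment_def l_def by (auto simp: algebra_simps intro!: exI[of _ t])
    then show ?thesis
      using seg by blast
  qed
  have contl: "continuous_on {0..1} l"
    unfolding l_def by (intro continuous_intros)
  have l_im: "l ` {0..1} \<subseteq> \<phi> ` U"
    using l by blast
  define u where "u t = inv_into UNIV (frame \<phi> (inv_into U \<phi> (l t))) (z - y)" for t
  have u: "frame_field U \<phi> (u t) (l t) = z - y" if "t \<in> {0..1}" for t
    using surj_frame[OF U chart(7)[OF U l[OF that]]] by (simp add: u_def frame_field_def surj_f_inv_f)
  have "continuous_on {0..1} (\<lambda>t. u t \<bullet> b)" for b
  proof -
    have "linear (\<lambda>x. x \<bullet> b)"
      by (intro linearI) (simp_all add: inner_add_left)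
    from dual_form[OF U this]
    obtain B B' where B: "\<And>y x. y \<in> \<phi> ` U \<Longrightarrow> B y \<bullet> frame_field U \<phi> x y = x \<bullet> b"
      "\<And>y. y \<in> \<phi> ` U \<Longrightarrow> (B has_derivative B' y) (at y)"
      by metis
    have "continuous_on (\<phi> ` U) B"
      using B(2) by (intro continuous_at_imp_continuous_on ballI) (auto intro: has_derivative_continuous)
    from continuous_on_compose2[OF this contl l_im]
    have "continuous_on {0..1} (\<lambda>t. B (l t) \<bullet> (z - y))"
      by (intro continuous_intros)
    moreover have "B (l t) \<bullet> (z - y) = u t \<bullet> b" if "t \<in> {0..1}" for t
      using B(1)[OF l[OF that], of "u t"] u[OF that] by simp
    ultimately show ?thesis
      using continuous_on_cong[of "{0..1}" "{0..1}" "\<lambda>t. B (l t) \<bullet> (z - y)" "\<lambda>t. u t \<bullet> b"] by simp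
  qed
  then have contu: "continuous_on {0..1} u"
    using continuous_on_componentwise by blast
  have curve: "C1_curve \<A> \<iota> (\<lambda>t. inv_into U \<phi> (l t)) u"
    unfolding C1_curve_def
  proof (intro conjI ballI allI impI contu continuous_on_compose2[OF chart(4)[OF U] contl l_im])
    fix t f assume t: "t \<in> {0..1}" and f: "smooth_near \<A> (inv_into U \<phi> (l t)) f"
    let ?p = "inv_into U \<phi> (l t)"
    have p: "?p \<in> U" "\<phi> ?p = l t"
      using chart(6,7)[OF U l[OF t]] by auto
    let ?D = "frechet_derivative (f \<circ> inv_into U \<phi>) (at (l t))"
    have v1: "(l has_vector_derivative (z - y)) (at t within {0..1})"
      unfolding l_def by (auto intro!: derivative_eq_intros)
    have v2: "((f \<circ> inv_into U \<phi>) has_derivative ?D) (at (l t))"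
      using smooth_near_derivative[OF f U p(1)] p(2) by simp
    have "((f \<circ> inv_into U \<phi>) \<circ> l has_vector_derivative ?D (z - y)) (at t within {0..1})"
      by (rule vector_derivative_diff_chain_within[OF v1 has_derivative_at_withinI[OF v2]])
    moreover have "\<iota> (u t) ?p f = ?D (z - y)"
      using \<iota>_in_chart[OF U p(1) f, of "u t"] p(2) u[OF t] by (simp add: frame_field_def)
    ultimately show "((\<lambda>s. f (inv_into U \<phi> (l s))) has_real_derivative \<iota> (u t) ?p f) (at t within {0..1})"
      by (simp add: has_real_derivative_iff_has_vector_derivative o_def)
  qed
  have "\<forall>t\<in>{0..1}. frame_field U \<phi> (u t) (l t) = z - y"
    using u by (rule ballI)
  from conjI[OF curve this, unfolded l_def] show ?thesis
    by (intro exI[of _ u])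
qed

text \<open>Integrating along segments from the identity defines a function near the identity in
  coordinates. The vanishing of the integrals over triangles makes the dual field of
  \<open>\<alpha>\<close> its gradient, so the derivative of that field is symmetric, and the
  structure equation gives \<open>\<alpha> [x, z] = 0\<close>.\<close>

theorem loop_integrals_vanish_imp_closed:
  fixes \<alpha> :: "'g \<Rightarrow> real"
  assumes \<alpha>: "linear \<alpha>" and loops: "\<And>c. line_integral \<A> \<iota> \<alpha> \<one> \<one> c \<Longrightarrow> c = 0"
  shows "\<alpha> (br x z) = 0"
proof -
  obtain U \<phi> where U: "(U, \<phi>) \<in> \<A>" "\<one> \<in> U"
    by (rule chart_at)
  obtain B B' where B: "\<And>y x. y \<in> \<phi> ` U \<Longrightarrow> B y \<bullet> frame_field U \<phi> x y = \<alpha> x"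
    "\<And>y. y \<in> \<phi> ` U \<Longrightarrow> (B has_derivative B' y) (at y)"
    "\<And>y x z. y \<in> \<phi> ` U \<Longrightarrow> B' y (frame_field U \<phi> x y) \<bullet> frame_field U \<phi> z y
       - B' y (frame_field U \<phi> z y) \<bullet> frame_field U \<phi> x y = - \<alpha> (br x z)"
    by (rule dual_form[OF U(1) \<alpha>]) blast
  define y0 where "y0 = \<phi> \<one>"
  obtain r where r: "r > 0" "ball y0 r \<subseteq> \<phi> ` U"
    using chart(2)[OF U(1)] U(2) openE unfolding y0_def by blast
  have y0: "y0 \<in> ball y0 r"
    using r by simp
  have inv_y0: "inv_into U \<phi> y0 = \<one>"
    unfolding y0_def by (rule chart(5)[OF U])
  define I where "I y z = integral {0..1} (\<lambda>t. B (y + t *\<^sub>R (z - y)) \<bullet> (z - y))" for y z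
  have seg_sub: "closed_segment y z \<subseteq> ball y0 r" if "y \<in> ball y0 r" "z \<in> ball y0 r" for y z
    using that by (intro closed_segment_subset convex_ball)
  have extend: "line_integral \<A> \<iota> \<alpha> \<one> (inv_into U \<phi> z) (c + I y z)"
    if c: "line_integral \<A> \<iota> \<alpha> \<one> (inv_into U \<phi> y) c" and yz: "y \<in> ball y0 r" "z \<in> ball y0 r" for y z c
  proof -
    let ?\<gamma> = "\<lambda>t. inv_into U \<phi> (y + t *\<^sub>R (z - y))"
    have sub: "closed_segment y z \<subseteq> \<phi> ` U"
      using seg_sub[OF yz] r(2) by blast
    obtain u where u: "C1_curve \<A> \<iota> ?\<gamma> u"
      "\<And>t. t \<in> {0..1} \<Longrightarrow> frame_field U \<phi> (u t) (y + t *\<^sub>R (z - y)) = z - y"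
      using segment_curve[OF U(1) sub] by blast
    have "\<alpha> (u t) = B (y + t *\<^sub>R (z - y)) \<bullet> (z - y)" if t: "t \<in> {0..1}" for t
    proof -
      have "y + t *\<^sub>R (z - y) \<in> closed_segment y z"
        using t unfolding closed_segment_def by (auto simp: algebra_simps intro!: exI[of _ t])
      then show ?thesis
        using B(1)[of "y + t *\<^sub>R (z - y)" "u t"] u(2)[OF t] sub by auto
    qed
    then have "integral {0..1} (\<lambda>t. \<alpha> (u t)) = I y z"
      unfolding I_def by (intro integral_cong) auto
    then show ?thesis
      using line_integral.append[of \<A> \<iota> \<alpha> \<one> ?\<gamma> c u] c u(1) by simp
  qed
  have start: "line_integral \<A> \<iota> \<alpha> \<one> (inv_into U \<phi> y0) 0"
    unfolding inv_y0 by (rule line_integral.const)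
  \<comment> \<open>Compare two closed polygons through \<open>y0\<close> that return along the same last edge.\<close>
  have triangle: "I y0 z - I y0 y = I y z" if yz: "y \<in> ball y0 r" "z \<in> ball y0 r" for y z
  proof -
    have "0 + I y0 y + I y z + I z y0 = 0"
      by (rule loops) (use extend[OF extend[OF extend[OF start y0 yz(1)] yz] yz(2) y0] inv_y0 in simp)
    moreover have "0 + I y0 z + I z y0 = 0"
      by (rule loops) (use extend[OF extend[OF start y0 yz(2)] yz(2) y0] inv_y0 in simp)
    ultimately show ?thesis
      by simp
  qed
  have contB: "continuous_on (\<phi> ` U) B"
    using B(2) by (intro continuous_at_imp_continuous_on ballI) (auto intro: has_derivative_continuous)
  have "(I y0 has_derivative (\<lambda>h. B y \<bullet> h)) (at y)" if y: "y \<in> ball y0 r" for y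
    unfolding has_derivative_at_alt
  proof (intro conjI allI impI)
    show "bounded_linear (\<lambda>h. B y \<bullet> h)"
      by (rule bounded_linear_inner_right)
    fix \<epsilon> :: real assume \<epsilon>: "\<epsilon> > 0"
    have "isCont B y"
      using B(2)[of y] y r(2) has_derivative_continuous by blast
    then obtain d1 where d1: "d1 > 0" "\<And>w. dist w y < d1 \<Longrightarrow> dist (B w) (B y) < \<epsilon>"
      using \<epsilon> unfolding continuous_at_eps_delta by blast
    obtain d2 where d2: "d2 > 0" "ball y d2 \<subseteq> ball y0 r"
      using y openE[OF open_ball] by blast
    have "norm (I y0 z - I y0 y - B y \<bullet> (z - y)) \<le> \<epsilon> * norm (z - y)" if z: "norm (z - y) < min d1 d2" for z
    proof -
      have zb: "z \<in> ball y0 r"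
        using z d2(2) by (auto simp: dist_norm norm_minus_commute subset_iff)
      let ?f = "\<lambda>t. B (y + t *\<^sub>R (z - y)) \<bullet> (z - y)"
      have mem: "y + t *\<^sub>R (z - y) \<in> closed_segment y z" if "t \<in> {0..1}" for t
        using that unfolding closed_segment_def by (auto simp: algebra_simps intro!: exI[of _ t])
      have "continuous_on {0..1} (\<lambda>t. B (y + t *\<^sub>R (z - y)))"
      proof (rule continuous_on_compose2[OF contB])
        show "continuous_on {0..1} (\<lambda>t. y + t *\<^sub>R (z - y))"
          by (intro continuous_intros)
        show "(\<lambda>t. y + t *\<^sub>R (z - y)) ` {0..1} \<subseteq> \<phi> ` U"
          using mem seg_sub[OF y zb] r(2) by blast
      qed
      then have int: "?f integrable_on {0..1}"
        by (intro integrable_continuous_real continuous_intros)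
      have "I y0 z - I y0 y - B y \<bullet> (z - y) = integral {0..1} (\<lambda>t. ?f t - B y \<bullet> (z - y))"
        unfolding triangle[OF y zb] unfolding I_def using int by (subst integral_diff) auto
      also have "norm \<dots> \<le> integral {0..1} (\<lambda>t::real. \<epsilon> * norm (z - y))"
      proof (rule integral_norm_bound_integral)
        show "(\<lambda>t. ?f t - B y \<bullet> (z - y)) integrable_on {0..1}"
          using int by (intro integrable_diff) auto
        show "(\<lambda>t::real. \<epsilon> * norm (z - y)) integrable_on {0..1}"
          by auto
        fix t :: real assume t: "t \<in> {0..1}"
        have "norm (t *\<^sub>R (z - y)) \<le> 1 * norm (z - y)"
          unfolding norm_scaleR using t by (intro mult_right_mono) auto
        then have "dist (y + t *\<^sub>R (z - y)) y < d1"
          using z by (simp add: dist_norm)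
        then have "norm (B (y + t *\<^sub>R (z - y)) - B y) \<le> \<epsilon>"
          using d1(2) by (simp add: dist_norm less_imp_le)
        moreover have "norm ((B (y + t *\<^sub>R (z - y)) - B y) \<bullet> (z - y)) \<le> norm (B (y + t *\<^sub>R (z - y)) - B y) * norm (z - y)"
          by (simp add: Cauchy_Schwarz_ineq2)
        ultimately show "norm (?f t - B y \<bullet> (z - y)) \<le> \<epsilon> * norm (z - y)"
          unfolding inner_diff_left[symmetric] by (meson mult_right_mono norm_ge_zero order_trans)
      qed
      finally show ?thesis
        by simp
    qed
    then show "\<exists>d>0. \<forall>z. norm (z - y) < d \<longrightarrow> norm (I y0 z - I y0 y - B y \<bullet> (z - y)) \<le> \<epsilon> * norm (z - y)"
      using d1(1) d2(1) by (intro exI[of _ "min d1 d2"]) auto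
  qed
  from gradient_derivative_symmetric[OF open_ball y0 this B(2)]
  have sym: "B' y0 v \<bullet> w = B' y0 w \<bullet> v" for v w
    using y0 r(2) by blast
  have "y0 \<in> \<phi> ` U"
    using y0 r(2) by blast
  from B(3)[OF this, of x z] show ?thesis
    unfolding sym[of "frame_field U \<phi> x y0"] by simp
qed

end


section \<open>Parallel transport of block diagonal connections\<close>

locale block_transport = lie_group_with_algebra \<A> G br \<iota> + block_connection \<Phi> J D \<Gamma>
  for \<A> :: "('m::{t2_space, second_countable_topology}, 'e::euclidean_space) chart set"
    and G :: "'m monoid" (structure) and br :: "'g::euclidean_space \<Rightarrow> 'g \<Rightarrow> 'g" and \<iota>
    and \<Phi> :: "'k::{real_normed_field, euclidean_space}^'n \<Rightarrow> 'g" and J D \<Gamma> +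
  fixes N :: "'m vfield \<Rightarrow> 'm vfield \<Rightarrow> 'm vfield"
  assumes N_\<iota>: "N (\<iota> x) (\<iota> y) = \<iota> (D x y)"
begin

text \<open>Left-invariant fields that agree at one point are equal, so the pointwise equation for fields
  along the curve is an equation in the Lie algebra.\<close>

lemma parallel_along_iff_solves: "parallel_along \<iota> N \<gamma> u X \<longleftrightarrow> solves u X"
proof -
  have "(\<forall>f. \<iota> X' p f + N (\<iota> v) (\<iota> w) p f = 0) \<longleftrightarrow> X' = - D v w" for X' p v w
  proof -
    have zero: "\<iota> 0 p f = 0" for f
      using \<iota>_scale[of 0 0] by (simp add: vf_scale_def)
    have "\<iota> X' p f + N (\<iota> v) (\<iota> w) p f = \<iota> (X' + D v w) p f" for f
      by (simp add: N_\<iota> \<iota>_add vf_add_def)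
    then have "(\<forall>f. \<iota> X' p f + N (\<iota> v) (\<iota> w) p f = 0) \<longleftrightarrow> \<iota> (X' + D v w) p = \<iota> 0 p"
      using zero by (simp add: fun_eq_iff)
    also have "\<dots> \<longleftrightarrow> X' + D v w = 0"
      using \<iota>_eq_at by metis
    finally show ?thesis
      by (simp add: eq_neg_iff_add_eq_0)
  qed
  then show ?thesis
    unfolding parallel_along_def solves_def by auto
qed

abbreviation trace_form :: "'g \<Rightarrow> 'k" where
  "trace_form \<equiv> \<lambda>x. trace (\<Gamma> x)"

lemma linear_trace_form: "linear trace_form"
  by (intro linearI) (auto simp: linear_add[OF lin\<Gamma>] linear_scale[OF lin\<Gamma>] trace_def sum.distrib scaleR_sum_right)

text \<open>Determinants multiply and integrals add under concatenation; each curve contributes by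
  \<open>transport\<close>.\<close>

lemma parallel_transport_block:
  "parallel_transport \<A> \<iota> N p q P \<Longrightarrow>
    \<exists>A c. P = block A \<and> line_integral \<A> \<iota> trace_form p q c \<and> det A = exp (- c)"
proof (induction rule: parallel_transport.induct)
  case const
  show ?case
    by (intro exI[of _ "mat 1"] exI[of _ 0]) (simp add: block_mat_1 line_integral.const)
next
  case (append \<gamma> P u Q)
  obtain A c where A: "P = block A" "line_integral \<A> \<iota> trace_form p (\<gamma> 0) c" "det A = exp (- c)"
    using append.IH by blast
  have "continuous_on {0..1} u"
    using append.hyps(2) unfolding C1_curve_def by blast
  from transport[OF this] obtain A' where A': "det A' = exp (- integral {0..1} (\<lambda>t. trace (\<Gamma> (u t))))"
    "\<And>X. solves u X \<Longrightarrow> X 1 = block A' (X 0)"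
    by blast
  have "Q x = block A' x" for x
  proof -
    obtain X where "solves u X" "X 0 = x" "X 1 = Q x"
      using append.hyps(3) unfolding parallel_along_iff_solves by blast
    then show ?thesis
      using A'(2)[of X] by simp
  qed
  then have "Q \<circ> P = block (A' ** A)"
    by (simp add: A(1) block_mult fun_eq_iff)
  moreover have "det (A' ** A) = exp (- (c + integral {0..1} (\<lambda>t. trace (\<Gamma> (u t)))))"
    by (simp add: det_mul A(3) A'(1) mult.commute flip: exp_add)
  ultimately show ?case
    using line_integral.append[OF A(2) append.hyps(2)] by blast
qed

text \<open>Every curve has a parallel transport, so every value of the line integral shows up in a
  determinant.\<close>

lemma line_integral_parallel_transport:
  "line_integral \<A> \<iota> trace_form p q c \<Longrightarrow>
    \<exists>A. parallel_transport \<A> \<iota> N p q (block A) \<and> det A = exp (- c)"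
proof (induction rule: line_integral.induct)
  case const
  have "parallel_transport \<A> \<iota> N p p (block (mat 1))"
    unfolding block_mat_1 by (rule parallel_transport.const)
  moreover have "det (mat 1 :: 'k^'n^'n) = exp (- 0)"
    by simp
  ultimately show ?case
    by (intro exI[of _ "mat 1"] conjI)
next
  case (append \<gamma> c u)
  obtain A where A: "parallel_transport \<A> \<iota> N p (\<gamma> 0) (block A)" "det A = exp (- c)"
    using append.IH by blast
  have "continuous_on {0..1} u"
    using append.hyps(2) unfolding C1_curve_def by blast
  from transport[OF this] obtain A' where A': "det A' = exp (- integral {0..1} (\<lambda>t. trace (\<Gamma> (u t))))"
    "\<And>w. \<exists>X. solves u X \<and> X 0 = w" "\<And>X. solves u X \<Longrightarrow> X 1 = block A' (X 0)"
    by blast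
  have "\<forall>x. \<exists>X. parallel_along \<iota> N \<gamma> u X \<and> X 0 = x \<and> X 1 = block A' x"
  proof
    fix x
    obtain X where "solves u X" "X 0 = x"
      using A'(2) by blast
    then show "\<exists>X. parallel_along \<iota> N \<gamma> u X \<and> X 0 = x \<and> X 1 = block A' x"
      using A'(3)[of X] by (intro exI[of _ X]) (simp add: parallel_along_iff_solves)
  qed
  from parallel_transport.append[OF A(1) append.hyps(2) this]
  have "parallel_transport \<A> \<iota> N p (\<gamma> 1) (block (A' ** A))"
    by (simp add: block_mult)
  moreover have "det (A' ** A) = exp (- (c + integral {0..1} (\<lambda>t. trace (\<Gamma> (u t)))))"
    by (simp add: det_mul A(2) A'(1) mult.commute flip: exp_add)
  ultimately show ?case
    by (intro exI[of _ "A' ** A"] conjI)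
qed

end


section \<open>Generation of the complex general linear group\<close>

definition diag_mat :: "('n \<Rightarrow> 'k) \<Rightarrow> 'k::field^'n^'n" where
  "diag_mat d = (\<chi> i j. if i = j then d i else 0)"

definition transvection :: "'n \<Rightarrow> 'n \<Rightarrow> 'k \<Rightarrow> 'k::field^'n^'n" where
  "transvection m k c = (\<chi> i j. if i = j then 1 else if i = m \<and> j = k then c else 0)"

lemma diag_mat_1: "diag_mat (\<lambda>_. 1) = mat 1"
  by (simp add: diag_mat_def mat_def)

lemma diag_mat_mult_nth: "(diag_mat d ** A) $ i $ j = d i * A $ i $ j"
  by (simp add: diag_mat_def matrix_matrix_mult_def if_distrib[of "\<lambda>x. x * _"] cong: if_cong)

lemma mult_diag_mat_nth: "(A ** diag_mat d) $ i $ j = A $ i $ j * d j"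
  by (simp add: diag_mat_def matrix_matrix_mult_def if_distrib[of "\<lambda>x. _ * x"] cong: if_cong)

lemma diag_mat_mult: "diag_mat c ** diag_mat d = diag_mat (\<lambda>i. c i * d i)"
  by (simp add: vec_eq_iff diag_mat_mult_nth) (simp add: diag_mat_def)

lemma transvection_0: "transvection m k 0 = mat 1"
  by (simp add: transvection_def mat_def vec_eq_iff)

lemma transvection_mult_nth:
  assumes "m \<noteq> k"
  shows "(transvection m k c ** A) $ i $ j = A $ i $ j + (if i = m then c * A $ k $ j else 0)"
proof -
  have "(\<Sum>l\<in>UNIV. transvection m k c $ i $ l * A $ l $ j)
    = (\<Sum>l\<in>UNIV. (if i = l then A $ l $ j else 0) + (if l = k then (if i = m then c * A $ k $ j else 0) else 0))"
    using assms by (intro sum.cong) (auto simp: transvection_def)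
  then show ?thesis
    by (simp add: matrix_matrix_mult_def sum.distrib)
qed

lemma mult_transvection_nth:
  assumes "m \<noteq> k"
  shows "(A ** transvection m k c) $ i $ j = A $ i $ j + (if j = k then A $ i $ m * c else 0)"
proof -
  have "(\<Sum>l\<in>UNIV. A $ i $ l * transvection m k c $ l $ j)
    = (\<Sum>l\<in>UNIV. (if l = j then A $ i $ l else 0) + (if l = m then (if j = k then A $ i $ m * c else 0) else 0))"
    using assms by (intro sum.cong) (auto simp: transvection_def)
  then show ?thesis
    by (simp add: matrix_matrix_mult_def sum.distrib)
qed

lemma transvection_mult:
  assumes "m \<noteq> k"
  shows "transvection m k c ** transvection m k d = transvection m k (c + d)"
  unfolding vec_eq_iff transvection_mult_nth[OF assms] using assms by (simp add: transvection_def)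

lemma det_middle_factor:
  fixes B C D R :: "'k::field^'n^'n"
  shows "B = C ** D ** R \<Longrightarrow> det B \<noteq> 0 \<Longrightarrow> det D \<noteq> 0"
    and "B = C ** D \<Longrightarrow> det B \<noteq> 0 \<Longrightarrow> det D \<noteq> 0"
  by (auto simp: det_mul)

text \<open>Gaussian elimination. The indices outside the finite set \<open>K\<close> are already reduced
  to the identity matrix. Eliminating an index \<open>k\<close> takes a transvection to make the
  pivot non-zero, a diagonal matrix to make it \<open>1\<close>, and then a column and a row of
  transvections to clear the rest.\<close>

lemma invertible_matrix_induct:
  fixes P :: "'k::field^'n^'n \<Rightarrow> bool"
  assumes mult: "\<And>A B. P A \<Longrightarrow> P B \<Longrightarrow> P (A ** B)"
    and diag: "\<And>d. (\<And>i. d i \<noteq> 0) \<Longrightarrow> P (diag_mat d)"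
    and transv: "\<And>m k c. m \<noteq> k \<Longrightarrow> P (transvection m k c)"
    and A: "invertible A"
  shows "P A"
proof -
  have P1: "P (mat 1)"
    using diag[of "\<lambda>_. 1"] by (simp add: diag_mat_1)
  have col: "P (\<chi> i j. if i = j then 1 else if j = k \<and> i \<in> L then c i else 0)" for k c L
  proof -
    have "finite L"
      by simp
    then show ?thesis
    proof (induction L)
      case empty
      then show ?case
        using P1 by (simp add: mat_def cong: if_cong)
    next
      case (insert m L)
      let ?X = "(\<chi> i j. if i = j then 1 else if j = k \<and> i \<in> L then c i else 0) :: 'k^'n^'n"
      let ?Y = "(\<chi> i j. if i = j then 1 else if j = k \<and> i \<in> insert m L then c i else 0) :: 'k^'n^'n"
      show ?case
      proof (cases "m = k")
        case True
        then have "?Y = ?X"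
          by (auto simp: vec_eq_iff)
        then show ?thesis
          using insert.IH by simp
      next
        case False
        then have "?Y = transvection m k (c m) ** ?X"
          using insert.hyps by (auto simp: vec_eq_iff transvection_mult_nth)
        then show ?thesis
          using mult[OF transv[OF False] insert.IH] by simp
      qed
    qed
  qed
  have row: "P (\<chi> i j. if i = j then 1 else if i = k \<and> j \<in> L then c j else 0)" for k c L
  proof -
    have "finite L"
      by simp
    then show ?thesis
    proof (induction L)
      case empty
      then show ?case
        using P1 by (simp add: mat_def cong: if_cong)
    next
      case (insert m L)
      let ?X = "(\<chi> i j. if i = j then 1 else if i = k \<and> j \<in> L then c j else 0) :: 'k^'n^'n"
      let ?Y = "(\<chi> i j. if i = j then 1 else if i = k \<and> j \<in> insert m L then c j else 0) :: 'k^'n^'n"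
      show ?case
      proof (cases "m = k")
        case True
        then have "?Y = ?X"
          by (auto simp: vec_eq_iff)
        then show ?thesis
          using insert.IH by simp
      next
        case False
        then have "?Y = ?X ** transvection k m (c m)"
          using insert.hyps by (auto simp: vec_eq_iff mult_transvection_nth)
        then show ?thesis
          using mult[OF insert.IH transv[of k m]] False by auto
      qed
    qed
  qed
  have step: "P B"
    if "\<And>i j. i \<notin> K \<or> j \<notin> K \<Longrightarrow> B $ i $ j = (if i = j then 1 else 0)" "det B \<noteq> 0" for B K
  proof -
    have "finite K"
      by simp
    then show ?thesis
      using that
    proof (induction K arbitrary: B)
      case empty
      then have "B = mat 1"
        by (simp add: vec_eq_iff mat_def)
      then show ?case
        using P1 by simp
    next
      case (insert k K)
      have pivot1: "P B"
        if B: "\<And>i j. i \<notin> insert k K \<or> j \<notin> insert k K \<Longrightarrow> B $ i $ j = (if i = j then 1 else 0)"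
          and nz: "det B \<noteq> 0" and kk: "B $ k $ k = 1" for B
      proof -
        \<comment> \<open>With pivot \<open>1\<close> the matrix factors as a unipotent column, the Schur
          complement, and a unipotent row.\<close>
        let ?C = "(\<chi> i j. if i = j then 1 else if j = k \<and> i \<in> UNIV then B $ i $ k else 0) :: 'k^'n^'n"
        let ?R = "(\<chi> i j. if i = j then 1 else if i = k \<and> j \<in> UNIV then B $ k $ j else 0) :: 'k^'n^'n"
        let ?B = "(\<chi> i j. if i = k \<or> j = k then (if i = j then 1 else 0) else B $ i $ j - B $ i $ k * B $ k $ j) :: 'k^'n^'n"
        have CX: "(?C ** X) $ i $ j = (if i = k then X $ k $ j else X $ i $ j + B $ i $ k * X $ k $ j)" for X :: "'k^'n^'n" and i j
        proof -
          have "(\<Sum>l\<in>UNIV. ?C $ i $ l * X $ l $ j)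
            = (\<Sum>l\<in>UNIV. (if l = i then X $ l $ j else 0) + (if l = k then (if i = k then 0 else B $ i $ k * X $ k $ j) else 0))"
            by (intro sum.cong) auto
          then show ?thesis
            by (simp add: matrix_matrix_mult_def sum.distrib)
        qed
        have XR: "(X ** ?R) $ i $ j = (if j = k then X $ i $ k else X $ i $ j + X $ i $ k * B $ k $ j)" for X :: "'k^'n^'n" and i j
        proof -
          have "(\<Sum>l\<in>UNIV. X $ i $ l * ?R $ l $ j)
            = (\<Sum>l\<in>UNIV. (if l = j then X $ i $ l else 0) + (if l = k then (if j = k then 0 else X $ i $ k * B $ k $ j) else 0))"
            by (intro sum.cong) auto
          then show ?thesis
            by (simp add: matrix_matrix_mult_def sum.distrib)
        qed
        have BB: "B = ?C ** ?B ** ?R"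
        proof -
          have "(?C ** ?B ** ?R) $ i $ j = B $ i $ j" for i j
            unfolding XR CX using kk by (cases "i = k"; cases "j = k") simp_all
          then show ?thesis
            by (simp only: vec_eq_iff simp_thms)
        qed
        have "P ?B"
        proof (rule insert.IH)
          show "det ?B \<noteq> 0"
            using det_middle_factor(1)[OF BB nz] .
          show "?B $ i $ j = (if i = j then 1 else 0)" if "i \<notin> K \<or> j \<notin> K" for i j
            using B[of i j] B[of i k] B[of k j] that by auto
        qed
        then have "P (?C ** ?B ** ?R)"
          by (intro mult col row)
        then show "P B"
          using BB by simp
      qed
      have pivot: "P B"
        if B: "\<And>i j. i \<notin> insert k K \<or> j \<notin> insert k K \<Longrightarrow> B $ i $ j = (if i = j then 1 else 0)"
          and nz: "det B \<noteq> 0" and kk: "B $ k $ k \<noteq> 0" for B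
      proof -
        let ?d = "\<lambda>i. if i = k then B $ k $ k else 1"
        let ?B = "(\<chi> i j. if i = k then B $ k $ j / B $ k $ k else B $ i $ j) :: 'k^'n^'n"
        have BB: "B = diag_mat ?d ** ?B"
          using kk by (simp add: vec_eq_iff diag_mat_mult_nth)
        have "P ?B"
        proof (rule pivot1)
          show "det ?B \<noteq> 0"
            using det_middle_factor(2)[OF BB nz] .
          show "?B $ i $ j = (if i = j then 1 else 0)" if "i \<notin> insert k K \<or> j \<notin> insert k K" for i j
            using B[of i j] that by auto
        qed (use kk in simp)
        then have "P (diag_mat ?d ** ?B)"
          using kk by (intro mult diag) auto
        then show "P B"
          using BB by simp
      qed
      show ?case
      proof (cases "B $ k $ k = 0")
        case False
        then show ?thesis
          using pivot insert.prems by blast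
      next
        case True
        have "\<exists>m. B $ m $ k \<noteq> 0"
        proof (rule ccontr)
          assume "\<nexists>m. B $ m $ k \<noteq> 0"
          then have "column k B = 0"
            by (simp add: column_def vec_eq_iff)
          then show False
            using insert.prems(2) det_zero_column(2)[of k B] by simp
        qed
        then obtain m where m: "B $ m $ k \<noteq> 0"
          by blast
        then have mk: "m \<noteq> k" "m \<in> insert k K"
          using True insert.prems(1)[of m k] by auto
        let ?B = "transvection k m 1 ** B"
        have BB: "B = transvection k m (- 1) ** ?B"
          using mk(1) by (simp add: matrix_mul_assoc transvection_mult transvection_0)
        have "P ?B"
        proof (rule pivot)
          show "det ?B \<noteq> 0"
            using det_middle_factor(2)[OF BB insert.prems(2)] .
          show "?B $ i $ j = (if i = j then 1 else 0)" if "i \<notin> insert k K \<or> j \<notin> insert k K" for i j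
            using insert.prems(1)[of i j] insert.prems(1)[of m j] mk that by (auto simp: transvection_mult_nth)
          show "?B $ k $ k \<noteq> 0"
            using m mk True by (simp add: transvection_mult_nth)
        qed
        then have "P (transvection k m (- 1) ** ?B)"
          using mult[OF transv[OF mk(1)[symmetric]], of ?B "- 1"] by blast
        then show ?thesis
          by (subst BB)
      qed
    qed
  qed
  show ?thesis
    using step[of UNIV A] A by (simp add: invertible_det_nz)
qed

text \<open>The determinant of a matrix representation takes values in a commutative group, so it is
  trivial on commutators. The representation is given by a map with values in all matrices;
  invertibility of the values follows from the group laws.\<close>

lemma det_derived_eq_1:
  fixes \<rho> :: "'a \<Rightarrow> 'k::field^'m^'m"
  assumes "group G" and mult: "\<And>x y. x \<in> carrier G \<Longrightarrow> y \<in> carrier G \<Longrightarrow> \<rho> (x \<otimes>\<^bsub>G\<^esub> y) = \<rho> x ** \<rho> y"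
    and \<rho>_one: "\<rho> \<one>\<^bsub>G\<^esub> = mat 1" and S: "S \<in> derived G (carrier G)"
  shows "det (\<rho> S) = 1"
proof -
  interpret G: group G by fact
  have inv_det: "det (\<rho> x) * det (\<rho> (inv\<^bsub>G\<^esub> x)) = 1" if "x \<in> carrier G" for x
  proof -
    have "det (\<rho> x) * det (\<rho> (inv\<^bsub>G\<^esub> x)) = det (\<rho> (x \<otimes>\<^bsub>G\<^esub> inv\<^bsub>G\<^esub> x))"
      by (simp only: det_mul mult[OF that G.inv_closed[OF that]])
    also have "\<dots> = 1"
      by (simp only: G.r_inv[OF that] \<rho>_one det_I)
    finally show ?thesis .
  qed
  have comm: "det (\<rho> h) = 1 \<and> h \<in> carrier G" if h: "h \<in> derived_set G (carrier G)" for h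
  proof -
    obtain a b where ab: "a \<in> carrier G" "b \<in> carrier G"
      "h = a \<otimes>\<^bsub>G\<^esub> b \<otimes>\<^bsub>G\<^esub> inv\<^bsub>G\<^esub> a \<otimes>\<^bsub>G\<^esub> inv\<^bsub>G\<^esub> b"
      using h by blast
    then have "det (\<rho> h) = (det (\<rho> a) * det (\<rho> (inv\<^bsub>G\<^esub> a))) * (det (\<rho> b) * det (\<rho> (inv\<^bsub>G\<^esub> b)))"
      by (simp add: mult det_mul)
    then show ?thesis
      using ab by (simp add: inv_det)
  qed
  have "S \<in> generate G (derived_set G (carrier G))"
    using S unfolding derived_def .
  then have "det (\<rho> S) = 1 \<and> S \<in> carrier G"
  proof (induction rule: generate.induct)
    case one
    show ?case
      using \<rho>_one by simp
  next
    case (incl h)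
    show ?case
      by (rule comm[OF incl])
  next
    case (inv h)
    from comm[OF inv] have h: "det (\<rho> h) = 1" "h \<in> carrier G"
      by (rule conjunct1, rule conjunct2)
    then show ?case
      using inv_det[OF h(2)] by simp
  next
    case (eng h1 h2)
    then show ?case
      by (simp add: mult det_mul)
  qed
  then show ?thesis
    by simp
qed

lemma GL_C_simps [simp]:
  "A \<in> carrier GL_C \<longleftrightarrow> invertible A" "A \<otimes>\<^bsub>GL_C\<^esub> B = A ** B" "\<one>\<^bsub>GL_C\<^esub> = mat 1"
  by (simp_all add: GL_C_def)

lemma group_GL_C: "group (GL_C :: (complex^'n^'n) monoid)"
proof (rule groupI)
  show "\<exists>B\<in>carrier GL_C. B \<otimes>\<^bsub>GL_C\<^esub> A = \<one>\<^bsub>GL_C\<^esub>" if "A \<in> carrier GL_C" for A :: "complex^'n^'n"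
  proof -
    obtain B where "A ** B = mat 1" "B ** A = mat 1"
      using \<open>A \<in> carrier GL_C\<close> by (auto simp: invertible_def)
    then show ?thesis
      by (intro bexI[of _ B]) (auto simp: invertible_def)
  qed
qed (auto simp: invertible_mult matrix_mul_assoc invertible_det_nz[of "mat 1"])

interpretation GL: group "GL_C :: (complex^'n^'n) monoid"
  by (rule group_GL_C)

lemma GL_C_inv:
  assumes "A ** B = mat 1"
  shows "inv\<^bsub>GL_C\<^esub> (A :: complex^'n^'n) = B"
proof -
  have "B ** A = mat 1"
    using assms matrix_left_right_inverse by blast
  then show ?thesis
    using assms by (intro GL.inv_equality) (auto simp: invertible_def)
qed

abbreviation "GL_derived \<equiv> derived GL_C (carrier GL_C)"

lemma GL_derived_det: "S \<in> GL_derived \<Longrightarrow> det S = 1" for S :: "complex^'n^'n"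
  by (rule det_derived_eq_1[where \<rho> = "\<lambda>A. A", OF group_GL_C]) simp_all

lemma commutator_in_GL_derived:
  assumes "invertible a" "invertible b"
  shows "a ** b ** inv\<^bsub>GL_C\<^esub> a ** inv\<^bsub>GL_C\<^esub> b \<in> GL_derived"
proof -
  have "\<exists>x\<in>carrier GL_C. \<exists>y\<in>carrier GL_C. a ** b ** inv\<^bsub>GL_C\<^esub> a ** inv\<^bsub>GL_C\<^esub> b
      = x ** y ** inv\<^bsub>GL_C\<^esub> x ** inv\<^bsub>GL_C\<^esub> y"
    by (rule bexI[of _ a], rule bexI[of _ b]) (use assms in auto)
  then show ?thesis
    unfolding derived_def by (intro generate.incl) simp
qed

text \<open>One such matrix for each determinant \<open>c\<close>: a section of the determinant.\<close>

definition dilation :: "'n \<Rightarrow> 'k \<Rightarrow> 'k::field^'n^'n" where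
  "dilation m c = diag_mat (\<lambda>i. if i = m then c else 1)"

lemma dilation_mult: "dilation m c ** dilation m d = dilation m (c * d)"
  by (simp add: dilation_def diag_mat_mult) (rule arg_cong[of _ _ diag_mat], auto)

lemma det_dilation: "det (dilation m c :: 'k::field^'n^'n) = c"
proof -
  have "det (dilation m c :: 'k^'n^'n) = (\<Prod>i\<in>UNIV. if i = m then c else 1)"
    unfolding dilation_def by (subst det_diagonal) (simp_all add: diag_mat_def)
  then show ?thesis
    by simp
qed

lemma invertible_dilation: "c \<noteq> 0 \<Longrightarrow> invertible (dilation m c)"
  by (simp add: invertible_det_nz det_dilation)

text \<open>Conjugation by \<open>dilation m 2\<close> doubles the off-diagonal entry \<open>c\<close>, so
  the commutator has the entry \<open>2 * c - c\<close>.\<close>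

lemma transvection_in_GL_derived:
  assumes "m \<noteq> k"
  shows "(transvection m k c :: complex^'n^'n) \<in> GL_derived"
proof -
  let ?g = "dilation m 2 :: complex^'n^'n" and ?t = "transvection m k c :: complex^'n^'n"
  have t: "?t ** transvection m k (- c) = mat 1"
    using assms by (simp add: transvection_mult transvection_0)
  have g: "?g ** dilation m (1 / 2) = mat 1"
    by (simp add: dilation_mult) (simp add: dilation_def diag_mat_1)
  have "?g ** ?t ** dilation m (1 / 2) ** transvection m k (- c) = ?t"
    using assms unfolding dilation_def
    by (auto simp: vec_eq_iff mult_transvection_nth mult_diag_mat_nth diag_mat_mult_nth) (auto simp: transvection_def)
  then show ?thesis
    using commutator_in_GL_derived[of ?g ?t] t g invertible_right_inverse
    by (metis GL_C_inv)
qed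

lemma GL_derived_mult: "S \<in> GL_derived \<Longrightarrow> T \<in> GL_derived \<Longrightarrow> S ** T \<in> GL_derived"
  using generate.eng[of S GL_C _ T] unfolding derived_def by simp

text \<open>Dilations in different coordinates are conjugate by a transposition matrix, hence agree up to
  a commutator.\<close>

lemma dilation_mod_GL_derived:
  assumes "c \<noteq> 0"
  shows "\<exists>S\<in>GL_derived. (dilation m c :: complex^'n^'n) = S ** dilation k c"
proof (cases "m = k")
  case True
  then show ?thesis
    by (intro bexI[of _ "mat 1"]) (auto simp: derived_def intro: generate.one[of GL_C, simplified])
next
  case False
  define s :: "complex^'n^'n" where "s = (\<chi> i j. if j = Transposition.transpose m k i then 1 else 0)"
  have ss: "s ** s = mat 1"
    by (simp add: s_def vec_eq_iff matrix_matrix_mult_def mat_def if_distrib[of "\<lambda>x. x * _"] eq_commute cong: if_cong)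
  have conj: "s ** dilation k c ** s = dilation m c"
  proof -
    have "(s ** A ** s) $ i $ j = A $ Transposition.transpose m k i $ Transposition.transpose m k j" for A i j
    proof -
      have 1: "(s ** A) $ i $ l = A $ Transposition.transpose m k i $ l" for l
        by (simp add: s_def matrix_matrix_mult_def if_distrib[of "\<lambda>x. x * _"] cong: if_cong)
      have "(s ** A ** s) $ i $ j = (\<Sum>l\<in>UNIV. (s ** A) $ i $ l * s $ l $ j)"
        by (simp add: matrix_matrix_mult_def)
      also have "\<dots> = (\<Sum>l\<in>UNIV. if l = Transposition.transpose m k j then (s ** A) $ i $ l else 0)"
        by (intro sum.cong) (auto simp: s_def)
      finally show ?thesis
        by (simp add: 1)
    qed
    then show ?thesis
      by (auto simp: vec_eq_iff dilation_def diag_mat_def Transposition.transpose_def)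
  qed
  let ?S = "s ** dilation k c ** inv\<^bsub>GL_C\<^esub> s ** inv\<^bsub>GL_C\<^esub> (dilation k c)"
  have "?S \<in> GL_derived"
    using ss invertible_dilation[OF assms] by (intro commutator_in_GL_derived) (auto simp: invertible_def)
  moreover have "?S ** dilation k c = dilation m c"
    using GL_C_inv[OF ss] GL.l_inv[of "dilation k c"] invertible_dilation[OF assms, of k] conj
    by (simp flip: matrix_mul_assoc)
  ultimately show ?thesis
    by metis
qed

text \<open>Matrices of this form are closed under products because the commutator subgroup is normal, and
  they contain the transvections and the diagonal matrices. The dilation factor is recovered
  from the determinant. In particular, all matrices of determinant \<open>1\<close> are products
  of commutators.\<close>

lemma GL_C_decomposition:
  fixes A :: "complex^'n^'n"
  assumes "invertible A"
  shows "\<exists>S\<in>GL_derived. A = S ** dilation k (det A)"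
proof -
  define P where "P A \<longleftrightarrow> (\<exists>S\<in>GL_derived. \<exists>c. c \<noteq> 0 \<and> A = S ** dilation k c)" for A :: "complex^'n^'n"
  have one: "mat 1 \<in> (GL_derived :: (complex^'n^'n) set)"
    by (auto simp: derived_def intro: generate.one[of GL_C, simplified])
  have Pder: "P S" if "S \<in> GL_derived" for S
    unfolding P_def using that
    by (intro bexI[of _ S] exI[of _ 1]) (auto simp: dilation_def diag_mat_1)
  have mult: "P (A ** B)" if "P A" "P B" for A B
  proof -
    obtain S T a b where *: "S \<in> GL_derived" "T \<in> GL_derived" "a \<noteq> 0" "b \<noteq> 0"
      "A = S ** dilation k a" "B = T ** dilation k b"
      using \<open>P A\<close> \<open>P B\<close> unfolding P_def by blast
    let ?d = "dilation k a :: complex^'n^'n"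
    have d: "invertible ?d"
      using invertible_dilation *(3) by blast
    have "?d ** T ** inv\<^bsub>GL_C\<^esub> ?d \<in> GL_derived"
      using normal.inv_op_closed2[OF GL.derived_self_is_normal, of ?d T] d *(2) by simp
    then have "S ** (?d ** T ** inv\<^bsub>GL_C\<^esub> ?d) \<in> GL_derived"
      by (rule GL_derived_mult[OF *(1)])
    moreover have "A ** B = S ** (?d ** T ** inv\<^bsub>GL_C\<^esub> ?d) ** dilation k (a * b)"
    proof -
      have "inv\<^bsub>GL_C\<^esub> ?d ** dilation k (a * b) = dilation k b"
        unfolding dilation_mult[symmetric] matrix_mul_assoc using GL.l_inv[of ?d] d by simp
      then show ?thesis
        unfolding *(5,6) by (simp flip: matrix_mul_assoc)
    qed
    ultimately show ?thesis
      unfolding P_def using *(3,4) by (metis mult_eq_0_iff)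
  qed
  have "P A"
  proof (rule invertible_matrix_induct[where P = P])
    show "P (B ** C)" if "P B" "P C" for B C
      using mult that .
    show "invertible A"
      by (rule assms)
    show "P (transvection m k c)" if "m \<noteq> k" for m k c
      using Pder transvection_in_GL_derived[OF that] by blast
    fix d :: "'n \<Rightarrow> complex" assume d: "\<And>i. d i \<noteq> 0"
    have Pdil: "P (dilation m c)" if "c \<noteq> 0" for m c
      using dilation_mod_GL_derived[OF that, of m k] that unfolding P_def by metis
    have "P (diag_mat (\<lambda>i. if i \<in> L then d i else 1))" for L
    proof -
      have "finite L"
        by simp
      then show ?thesis
      proof (induction L)
        case empty
        then show ?case
          using Pder[OF one] by (simp add: diag_mat_1)
      next
        case (insert m L)
        have "diag_mat (\<lambda>i. if i \<in> insert m L then d i else 1)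
            = dilation m (d m) ** diag_mat (\<lambda>i. if i \<in> L then d i else 1)"
          unfolding dilation_def diag_mat_mult using insert.hyps by (intro arg_cong[of _ _ diag_mat] ext) auto
        then show ?case
          using mult[OF Pdil insert.IH] d by metis
      qed
    qed
    from this[of UNIV] show "P (diag_mat d)"
      by simp
  qed
  then show ?thesis
    unfolding P_def using GL_derived_det det_mul det_dilation by (metis mult_1)
qed


section \<open>The quaternionic linear group\<close>

lemma matrix_vector_mult_smult: "A *v (c *s a) = c *s (A *v (a :: 'k::field^'n))"
  by (simp add: vec_eq_iff matrix_vector_mult_def sum_distrib_left mult.left_commute)

lemma matrix_vector_mult_uminus: "A *v (- a) = - (A *v (a :: 'k::field^'n))"
  by (simp add: vec_eq_iff matrix_vector_mult_def sum_negf)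

lemma matrix_vector_mult_axis: "(A *v axis j 1) $ i = (A :: 'k::field^'n^'m) $ i $ j"
proof -
  have "(A *v axis j 1) $ i = (\<Sum>k\<in>UNIV. A $ i $ k * axis j 1 $ k)"
    by (simp add: matrix_vector_mult_def)
  also have "\<dots> = (\<Sum>k\<in>UNIV. if k = j then A $ i $ k else 0)"
    by (intro sum.cong) (auto simp: axis_def)
  finally show ?thesis
    by simp
qed

text \<open>The algebra of \<open>J\<close> and \<open>E\<close> on the Lie algebra and on its
  complexification, in adapted coordinates.\<close>

locale adapted_frame =
  fixes J E :: "'g::euclidean_space \<Rightarrow> 'g" and e :: "'n::finite \<Rightarrow> 'g"
  assumes linJ: "linear J" and linE: "linear E" and JJ: "J (J x) = - x"
    and JE: "J (E x) = - E (J x)"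
    and basis: "adapted_basis J E e" and dim: "DIM('g) = 2 * CARD('n)"
begin

\<comment> \<open>Elements of the complexification are pairs; quantifiers over them should stay as they are.\<close>
declare split_paired_All [simp del]

lemma Ee: "E (e j) = e j"
  using basis by (simp add: adapted_basis_def)

definition \<Phi>R :: "real^'n \<Rightarrow> 'g" where
  "\<Phi>R a = (\<Sum>j\<in>UNIV. a $ j *\<^sub>R e j)"

lemma lin\<Phi>R: "linear \<Phi>R"
  by (intro linearI) (simp_all add: \<Phi>R_def scaleR_add_left sum.distrib scaleR_sum_right)

lemma \<Phi>R_axis: "\<Phi>R (axis j 1) = e j"
proof -
  have "\<Phi>R (axis j 1) = (\<Sum>k\<in>UNIV. if k = j then e k else 0)"
    unfolding \<Phi>R_def by (intro sum.cong) (auto simp: axis_def)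
  then show ?thesis
    by simp
qed

lemma E_\<Phi>R: "E (\<Phi>R a) = \<Phi>R a"
  by (simp add: \<Phi>R_def linear_sum[OF linE] linear_scale[OF linE] Ee)

lemma bij_joinR: "bij (\<lambda>(a, b). \<Phi>R a + J (\<Phi>R b))"
proof -
  let ?f = "\<lambda>(a, b). \<Phi>R a + J (\<Phi>R b)"
  have lin: "linear ?f"
    by (intro linearI) (auto simp: linear_add[OF lin\<Phi>R] linear_add[OF linJ] linear_scale[OF lin\<Phi>R]
        linear_scale[OF linJ] scaleR_add_right)
  have sub: "subspace (range ?f)"
    by (rule linear_subspace_image[OF lin subspace_UNIV])
  have "e j \<in> range ?f" for j
    by (rule image_eqI[of _ _ "(axis j 1, 0)"]) (simp_all add: \<Phi>R_axis linear_0[OF lin\<Phi>R] linear_0[OF linJ])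
  moreover have "J (e j) \<in> range ?f" for j
    by (rule image_eqI[of _ _ "(0, axis j 1)"]) (simp_all add: \<Phi>R_axis linear_0[OF lin\<Phi>R])
  ultimately have "range e \<union> range (J \<circ> e) \<subseteq> range ?f"
    by auto
  then have "span (range e \<union> range (J \<circ> e)) \<subseteq> range ?f"
    by (rule span_minimal[OF _ sub])
  then have surj: "surj ?f"
    using basis by (auto simp: adapted_basis_def)
  have "inj ?f"
    by (rule linear_surjective_imp_injective[OF lin surj]) (simp add: dim)
  with surj show ?thesis
    by (simp add: bij_def)
qed

sublocale R: block_space \<Phi>R J
  by (rule block_space.intro[OF lin\<Phi>R linJ bij_joinR])

lemma R_join: "R.join (a, b) = \<Phi>R a + J (\<Phi>R b)"
  by (simp add: R.join_def)

lemma E_join: "E (R.join (a, b)) = R.join (a, - b)"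
proof -
  have "E (J (\<Phi>R b)) = - J (\<Phi>R b)"
    using JE[of "\<Phi>R b"] unfolding E_\<Phi>R by (metis minus_minus)
  then show ?thesis
    by (simp add: R_join linear_add[OF linE] E_\<Phi>R linear_neg[OF lin\<Phi>R] linear_neg[OF linJ])
qed

text \<open>The complex-linear extension of \<open>\<Phi>R\<close>, an isomorphism of
  \<open>\<complex>\<^sup>n\<close> with the complexification of the
  \<open>+1\<close>-eigenspace.\<close>

definition \<Phi>C :: "complex^'n \<Rightarrow> 'g \<times> 'g" where
  "\<Phi>C v = (\<Phi>R (\<chi> i. Re (v $ i)), \<Phi>R (\<chi> i. Im (v $ i)))"

lemma lin\<Phi>C: "linear \<Phi>C"
proof -
  have 1: "(\<chi> i. Re ((v + w) $ i)) = (\<chi> i. Re (v $ i)) + (\<chi> i. Re (w $ i))"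
    "(\<chi> i. Im ((v + w) $ i)) = (\<chi> i. Im (v $ i)) + (\<chi> i. Im (w $ i))"
    "(\<chi> i. Re ((r *\<^sub>R v) $ i)) = r *\<^sub>R (\<chi> i. Re (v $ i))"
    "(\<chi> i. Im ((r *\<^sub>R v) $ i)) = r *\<^sub>R (\<chi> i. Im (v $ i))" for v w :: "complex^'n" and r
    by (simp_all add: vec_eq_iff)
  show ?thesis
    unfolding \<Phi>C_def by (intro linearI) (simp_all only: 1 linear_add[OF lin\<Phi>R] linear_scale[OF lin\<Phi>R] add_Pair scaleR_Pair)
qed

lemma linJ1: "linear (J1 J)"
  unfolding J1_def by (intro linearI) (auto simp: linear_add[OF linJ] linear_scale[OF linJ])

lemma J1J1: "J1 J (J1 J w) = - w"
  by (cases w) (simp add: J1_def JJ)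

lemma joinC_eq: "\<Phi>C a + J1 J (\<Phi>C b) =
    (R.join (\<chi> i. Re (a $ i), \<chi> i. Re (b $ i)), R.join (\<chi> i. Im (a $ i), \<chi> i. Im (b $ i)))"
  by (simp add: \<Phi>C_def J1_def R_join)

lemma bij_joinC: "bij (\<lambda>(a, b). \<Phi>C a + J1 J (\<Phi>C b))"
proof (rule bijI)
  show "inj (\<lambda>(a, b). \<Phi>C a + J1 J (\<Phi>C b))"
  proof (rule injI)
    fix p q assume "(\<lambda>(a, b). \<Phi>C a + J1 J (\<Phi>C b)) p = (\<lambda>(a, b). \<Phi>C a + J1 J (\<Phi>C b)) q"
    then have *: "\<Phi>C (fst p) + J1 J (\<Phi>C (snd p)) = \<Phi>C (fst q) + J1 J (\<Phi>C (snd q))"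
      by (simp add: case_prod_beta)
    from arg_cong[OF arg_cong[OF *[unfolded joinC_eq], of fst], of R.split]
      arg_cong[OF arg_cong[OF *[unfolded joinC_eq], of snd], of R.split]
    show "p = q"
      by (simp add: vec_eq_iff prod_eq_iff complex_eq_iff)
  qed
  show "surj (\<lambda>(a, b). \<Phi>C a + J1 J (\<Phi>C b))"
  proof (rule surjI)
    fix w :: "'g \<times> 'g"
    show "(\<lambda>(a, b). \<Phi>C a + J1 J (\<Phi>C b))
      (\<chi> i. Complex (fst (R.split (fst w)) $ i) (fst (R.split (snd w)) $ i),
       \<chi> i. Complex (snd (R.split (fst w)) $ i) (snd (R.split (snd w)) $ i)) = w"
      by (simp add: joinC_eq)
  qed
qed

sublocale C: block_space \<Phi>C "J1 J"
  by (rule block_space.intro[OF lin\<Phi>C linJ1 bij_joinC])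

lemma C_join: "C.join (a, b) = \<Phi>C a + J1 J (\<Phi>C b)"
  by (simp add: C.join_def)

lemma C_join_eq: "C.join (a, b) =
    (R.join (\<chi> i. Re (a $ i), \<chi> i. Re (b $ i)), R.join (\<chi> i. Im (a $ i), \<chi> i. Im (b $ i)))"
  unfolding C_join by (rule joinC_eq)

lemma R_join_uminus: "- R.join (a, b) = R.join (- a, - b)"
  using linear_neg[OF R.linear_join, of "(a, b)"] by simp

lemma J1_join: "J1 J (C.join (a, b)) = C.join (- b, a)"
  by (simp add: C_join linear_add[OF linJ1] J1J1 linear_neg[OF lin\<Phi>C])

lemma mult_i_join: "mult_i (C.join (a, b)) = C.join (\<i> *s a, \<i> *s b)"
  by (simp add: C_join_eq mult_i_def R_join_uminus) (intro conjI arg_cong[of _ _ R.join]; simp add: vec_eq_iff)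

text \<open>In these coordinates \<open>J2 E\<close> is multiplication by \<open>i\<close> on the first
  half and by \<open>-i\<close> on the second.\<close>

lemma J2_join: "J2 E (C.join (a, b)) = C.join (\<i> *s a, - (\<i> *s b))"
  by (simp add: C_join_eq J2_def mult_i_def E_join R_join_uminus) (intro conjI arg_cong[of _ _ R.join]; simp add: vec_eq_iff)

lemma block_commutes:
  "C.block A (J1 J w) = J1 J (C.block A w)" "C.block A (J2 E w) = J2 E (C.block A w)"
  "C.block A (mult_i w) = mult_i (C.block A w)"
proof -
  obtain a b where w: "w = C.join (a, b)"
    by (metis C.join_split surj_pair)
  show "C.block A (J1 J w) = J1 J (C.block A w)" "C.block A (J2 E w) = J2 E (C.block A w)"
    "C.block A (mult_i w) = mult_i (C.block A w)"
    by (simp_all add: w J1_join J2_join mult_i_join C.block_join matrix_vector_mult_smult matrix_vector_mult_uminus)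
qed

lemma GL_H_simps [simp]:
  "one (GL_H J E) = id" "monoid.mult (GL_H J E) = (\<circ>)"
  by (simp_all add: GL_H_def)

lemma GL_H_iff: "T \<in> carrier (GL_H J E) \<longleftrightarrow> linear T \<and> bij T \<and>
    (\<forall>w. T (J1 J w) = J1 J (T w)) \<and> (\<forall>w. T (J2 E w) = J2 E (T w))"
  by (auto simp: GL_H_def J3_def fun_eq_iff simp del: split_paired_All)

lemma group_GL_H: "group (GL_H J E)"
proof (rule groupI)
  show "\<one>\<^bsub>GL_H J E\<^esub> \<in> carrier (GL_H J E)"
    by (simp add: GL_H_iff id_def linear_ident bij_id[unfolded id_def])
  show "T \<otimes>\<^bsub>GL_H J E\<^esub> S \<in> carrier (GL_H J E)" if "T \<in> carrier (GL_H J E)" "S \<in> carrier (GL_H J E)" for S T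
    using that unfolding GL_H_iff GL_H_simps by (auto intro: linear_compose bij_comp)
  show "\<exists>S\<in>carrier (GL_H J E). S \<otimes>\<^bsub>GL_H J E\<^esub> T = \<one>\<^bsub>GL_H J E\<^esub>" if T: "T \<in> carrier (GL_H J E)" for T
  proof -
    have b: "bij T" and lin: "linear T" and c: "\<And>w. T (J1 J w) = J1 J (T w)" "\<And>w. T (J2 E w) = J2 E (T w)"
      using T by (simp_all add: GL_H_iff)
    let ?S = "inv_into UNIV T"
    have TS: "T (?S w) = w" and ST: "?S (T w) = w" for w
      using b by (simp_all add: bij_is_surj surj_f_inv_f bij_is_inj inv_f_f)
    have "linear ?S"
      by (intro linearI) (metis TS ST linear_add[OF lin], metis TS ST linear_scale[OF lin])
    moreover have "bij ?S"
      using b by (rule bij_imp_bij_inv)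
    moreover have "?S (J1 J w) = J1 J (?S w)" "?S (J2 E w) = J2 E (?S w)" for w
      by (metis TS ST c(1), metis TS ST c(2))
    ultimately show ?thesis
      using ST by (intro bexI[of _ ?S]) (auto simp: GL_H_iff)
  qed
qed (simp_all add: comp_assoc)

sublocale GLH: group "GL_H J E"
  by (rule group_GL_H)

lemma bij_block: "invertible A \<Longrightarrow> bij (C.block A)"
proof -
  assume "invertible A"
  then obtain B where "A ** B = mat 1" "B ** A = mat 1"
    by (auto simp: invertible_def)
  then have "C.block A \<circ> C.block B = id" "C.block B \<circ> C.block A = id"
    by (simp_all add: C.block_mat_1 flip: C.block_mult)
  then show ?thesis
    by (rule o_bij[rotated])
qed

lemma block_GL_H: "invertible A \<Longrightarrow> C.block A \<in> carrier (GL_H J E)"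
  by (simp add: GL_H_iff C.linear_block bij_block block_commutes)

sublocale blk: group_hom "GL_C :: (complex^'n^'n) monoid" "GL_H J E" C.block
  by (intro group_hom.intro group_hom_axioms.intro group_GL_C group_GL_H homI) (auto simp: block_GL_H C.block_mult)

abbreviation "derH \<equiv> derived (GL_H J E) (carrier (GL_H J E))"

lemma derH_subgroup: "subgroup derH (GL_H J E)"
  by (rule GLH.derived_is_subgroup) simp

lemma block_GL_derived: "S \<in> GL_derived \<Longrightarrow> C.block S \<in> derH"
proof -
  assume "S \<in> GL_derived"
  then have "C.block S \<in> derived (GL_H J E) (C.block ` carrier GL_C)"
    using blk.derived_img[of "carrier GL_C"] by auto
  moreover have "derived (GL_H J E) (C.block ` carrier GL_C) \<subseteq> derH"
    by (rule GLH.mono_derived) (auto simp: block_GL_H)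
  ultimately show ?thesis
    by blast
qed

text \<open>Conjugating the second half of the coordinates turns \<open>J2 E\<close> into multiplication
  by the scalar \<open>i\<close>. Quaternionic endomorphisms become complex-linear maps of
  \<open>\<complex>\<^sup>2\<^sup>n\<close>, and their complex determinant is available.\<close>

definition \<Psi> :: "complex^('n + 'n) \<Rightarrow> 'g \<times> 'g" where
  "\<Psi> v = C.join (\<chi> j. v $ Inl j, \<chi> j. cnj (v $ Inr j))"

definition \<Psi>i :: "'g \<times> 'g \<Rightarrow> complex^('n + 'n)" where
  "\<Psi>i w = (\<chi> p. case p of Inl j \<Rightarrow> fst (C.split w) $ j | Inr j \<Rightarrow> cnj (snd (C.split w) $ j))"

lemma \<Psi>_\<Psi>i: "\<Psi> (\<Psi>i w) = w" and \<Psi>i_\<Psi>: "\<Psi>i (\<Psi> v) = v"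
  by (simp_all add: \<Psi>_def \<Psi>i_def vec_eq_iff split: sum.split)

lemma lin\<Psi>: "linear \<Psi>"
proof -
  have "\<Psi> (v + w) = C.join ((\<chi> j. v $ Inl j, \<chi> j. cnj (v $ Inr j)) + (\<chi> j. w $ Inl j, \<chi> j. cnj (w $ Inr j)))" for v w
    unfolding \<Psi>_def by (rule arg_cong[of _ _ C.join]) (simp add: vec_eq_iff)
  moreover have "\<Psi> (r *\<^sub>R v) = C.join (r *\<^sub>R (\<chi> j. v $ Inl j, \<chi> j. cnj (v $ Inr j)))" for r v
    unfolding \<Psi>_def by (rule arg_cong[of _ _ C.join]) (simp add: vec_eq_iff)
  ultimately show ?thesis
    by (intro linearI) (simp_all only: linear_add[OF C.linear_join] linear_scale[OF C.linear_join] \<Psi>_def)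
qed

lemma lin\<Psi>i: "linear \<Psi>i"
  by (intro linearI) (metis \<Psi>_\<Psi>i \<Psi>i_\<Psi> linear_add[OF lin\<Psi>], metis \<Psi>_\<Psi>i \<Psi>i_\<Psi> linear_scale[OF lin\<Psi>])

lemma J2_\<Psi>: "J2 E (\<Psi> v) = \<Psi> (\<i> *s v)"
  unfolding \<Psi>_def J2_join by (rule arg_cong[of _ _ C.join]) (simp add: vec_eq_iff)

lemma quaternionic_complex_linear:
  assumes T: "T \<in> carrier (GL_H J E)"
  shows "Vector_Spaces.linear (*s) (*s) (\<Psi>i \<circ> T \<circ> \<Psi>)"
proof -
  let ?T = "\<Psi>i \<circ> T \<circ> \<Psi>"
  have linT: "linear T" and c: "\<And>w. T (J2 E w) = J2 E (T w)"
    using T by (simp_all add: GL_H_iff)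
  have lin: "linear ?T"
    using lin\<Psi> linT lin\<Psi>i by (intro linear_compose)
  have i: "?T (\<i> *s v) = \<i> *s ?T v" for v
    by (simp add: c flip: J2_\<Psi>) (metis J2_\<Psi> \<Psi>_\<Psi>i \<Psi>i_\<Psi>)
  have "?T (c *s v) = c *s ?T v" for c v
  proof -
    have split: "c *s u = Re c *\<^sub>R u + Im c *\<^sub>R (\<i> *s u)" for u :: "complex^('n + 'n)"
      by (simp add: vec_eq_iff complex_eq_iff)
    show ?thesis
      unfolding split[of v] split[of "?T v"] linear_add[OF lin] linear_scale[OF lin] i ..
  qed
  then show ?thesis
    using linear_add[OF lin] by unfold_locales auto
qed

text \<open>The standard embedding of \<open>GL(n, H)\<close> in \<open>GL(2n, \<complex>)\<close>;
  \<open>det (\<rho> T)\<close> is the Study determinant of \<open>T\<close>.\<close>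

definition \<rho> :: "('g \<times> 'g \<Rightarrow> 'g \<times> 'g) \<Rightarrow> complex^('n + 'n)^('n + 'n)" where
  "\<rho> T = matrix (\<Psi>i \<circ> T \<circ> \<Psi>)"

lemma \<rho>_compose:
  assumes "S \<in> carrier (GL_H J E)" "T \<in> carrier (GL_H J E)"
  shows "\<rho> (S \<circ> T) = \<rho> S ** \<rho> T"
proof -
  have "\<Psi>i \<circ> (S \<circ> T) \<circ> \<Psi> = (\<Psi>i \<circ> S \<circ> \<Psi>) \<circ> (\<Psi>i \<circ> T \<circ> \<Psi>)"
    by (simp add: fun_eq_iff \<Psi>_\<Psi>i)
  then show ?thesis
    unfolding \<rho>_def
    using matrix_compose_gen[OF quaternionic_complex_linear[OF assms(2)] quaternionic_complex_linear[OF assms(1)]]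
    by simp
qed

lemma \<rho>_id: "\<rho> id = mat 1"
proof -
  have "\<Psi>i \<circ> id \<circ> \<Psi> = id"
    by (simp add: fun_eq_iff \<Psi>i_\<Psi>)
  then show ?thesis
    by (simp add: \<rho>_def matrix_id_mat_1)
qed

lemma det_\<rho>_derived:
  assumes "S \<in> derH"
  shows "det (\<rho> S) = 1"
proof (rule det_derived_eq_1[where \<rho> = \<rho>, OF group_GL_H _ _ assms])
  show "\<rho> (x \<otimes>\<^bsub>GL_H J E\<^esub> y) = \<rho> x ** \<rho> y" if "x \<in> carrier (GL_H J E)" "y \<in> carrier (GL_H J E)" for x y
    unfolding GL_H_simps by (rule \<rho>_compose[OF that])
  show "\<rho> \<one>\<^bsub>GL_H J E\<^esub> = mat 1"
    unfolding GL_H_simps by (rule \<rho>_id)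
qed

text \<open>The second block enters with conjugated coordinates, which accounts for the conjugate factor.\<close>

lemma det_\<rho>_dilation: "det (\<rho> (C.block (dilation k c))) = c * cnj c"
proof -
  let ?d = "\<lambda>i. if i = k then c else 1"
  let ?D = "\<lambda>p. case p of Inl j \<Rightarrow> ?d j | Inr j \<Rightarrow> cnj (?d j)"
  have dil: "dilation k c *v a = (\<chi> i. ?d i * a $ i)" for a
    by (simp add: vec_eq_iff matrix_vector_mult_def dilation_def diag_mat_def if_distrib[of "\<lambda>x. x * _"] cong: if_cong)
  have "(\<Psi>i \<circ> C.block (dilation k c) \<circ> \<Psi>) v = (\<chi> p. ?D p * v $ p)" for v
    unfolding o_def \<Psi>_def C.block_join dil by (simp add: \<Psi>i_def vec_eq_iff split: sum.split)
  then have "\<rho> (C.block (dilation k c)) = (\<chi> p q. ?D p * axis q 1 $ p)"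
    unfolding \<rho>_def matrix_def by simp
  then have "det (\<rho> (C.block (dilation k c))) = (\<Prod>p\<in>UNIV. ?D p)"
    by (subst det_diagonal) (simp_all add: axis_def)
  also have "\<dots> = (\<Prod>p\<in>UNIV <+> UNIV. ?D p)"
    by (simp only: UNIV_Plus_UNIV)
  also have "\<dots> = (\<Prod>j\<in>UNIV. ?d j) * (\<Prod>j\<in>UNIV. cnj (?d j))"
    by (subst prod.Plus) (simp_all only: finite o_def sum.case)
  also have "\<dots> = c * cnj c"
    by (simp add: if_distrib[of cnj] cong: if_cong)
  finally show ?thesis .
qed

lemma block_det_1_derived:
  assumes "det A = 1"
  shows "C.block A \<in> derH"
proof -
  have "invertible A"
    using assms by (simp add: invertible_det_nz)
  \<comment> \<open>Any index may carry the dilation factor, which is trivial here.\<close>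
  from GL_C_decomposition[OF this, of undefined] obtain S where "S \<in> GL_derived" "A = S ** dilation undefined (det A)"
    by blast
  then have "A = S"
    using assms by (simp add: dilation_def diag_mat_1)
  then show ?thesis
    using \<open>S \<in> GL_derived\<close> block_GL_derived by simp
qed

text \<open>Up to commutators the block is a dilation by \<open>det A\<close>, whose Study determinant is
  the squared modulus of \<open>det A\<close>. The argument of \<open>det A\<close> is not
  controlled: \<open>GL(1, \<complex>)\<close> meets the commutator subgroup of \<open>GL(1,
  H)\<close> in the unit circle.\<close>

lemma block_derived_norm_det:
  assumes A: "invertible A" and der: "C.block A \<in> derH"
  shows "cmod (det A) = 1"
proof -
  obtain S where S: "S \<in> GL_derived" "A = S ** dilation undefined (det A)"
    using GL_C_decomposition[OF A, of undefined] by blast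
  have nz: "det A \<noteq> 0"
    using A by (simp add: invertible_det_nz)
  have S1: "det S = 1"
    by (rule GL_derived_det[OF S(1)])
  have dS: "det (\<rho> (C.block S)) = 1"
    by (rule det_\<rho>_derived[OF block_GL_derived[OF S(1)]])
  have mem: "C.block S \<in> carrier (GL_H J E)" "C.block (dilation undefined (det A)) \<in> carrier (GL_H J E)"
    using S1 nz by (auto intro!: block_GL_H simp: invertible_det_nz det_dilation)
  have "1 = det (\<rho> (C.block A))"
    by (rule det_\<rho>_derived[OF der, symmetric])
  also have "C.block A = C.block S \<circ> C.block (dilation undefined (det A))"
    using arg_cong[OF S(2), of C.block] by (simp add: C.block_mult)
  also have "det (\<rho> \<dots>) = det A * cnj (det A)"
    by (simp add: \<rho>_compose[OF mem] det_mul dS det_\<rho>_dilation)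
  also have "\<dots> = complex_of_real ((cmod (det A))\<^sup>2)"
    by (rule complex_norm_square[symmetric])
  finally have "(cmod (det A))\<^sup>2 = 1"
    by (metis of_real_eq_1_iff)
  then show ?thesis
    by (simp add: power2_eq_1_iff) (metis norm_ge_zero not_one_le_zero neg_0_le_iff_le order_trans zero_le_one)
qed

text \<open>The inverse of \<open>A \<mapsto> C.block A\<close> reads off the matrix from the images of
  the basis vectors, so it is continuous for pointwise convergence. The statement covers the
  general and the special linear group.\<close>

lemma block_topological_iso:
  fixes L :: "(complex^'n^'n) monoid"
  assumes L: "monoid.mult L = (**)"
    and K: "monoid.mult K = (\<circ>)" "carrier K = C.block ` carrier L"
  shows "topological_group_iso K L"
proof -
  define h where "h T = (\<chi> i j. fst (C.split (T (\<Phi>C (axis j 1)))) $ i)" for T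
  have h: "h (C.block A) = A" for A
  proof -
    have "\<Phi>C v = C.join (v, 0)" for v
      by (simp add: C_join linear_0[OF lin\<Phi>C] linear_0[OF linJ1])
    then show ?thesis
      by (simp add: h_def C.block_join vec_eq_iff matrix_vector_mult_axis)
  qed
  have inj: "inj_on h (carrier K)"
    unfolding K(2) by (intro inj_onI) (auto simp: h)
  have im: "h ` carrier K = carrier L"
    unfolding K(2) by (auto simp: h image_image)
  have inv: "inv_into (carrier K) h A = C.block A" if "A \<in> carrier L" for A
    using that by (intro inv_into_f_eq[OF inj]) (auto simp: K(2) h)
  have "h \<in> iso K L"
  proof (rule isoI)
    show "h \<in> hom K L"
      by (intro homI) (auto simp: K L h simp flip: C.block_mult)
    show "bij_betw h (carrier K) (carrier L)"
      using inj im by (simp add: bij_betw_def)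
  qed
  moreover have "homeomorphism (carrier K) (carrier L) h (inv_into (carrier K) h)"
    unfolding homeomorphism_def
  proof (intro conjI ballI)
    have bl: "bounded_linear (\<lambda>w. fst (C.split w) $ i)" for i
    proof -
      have "linear (\<lambda>w. fst (C.split w) $ i)"
        by (intro linearI) (simp_all add: linear_add[OF C.linear_split] linear_scale[OF C.linear_split])
      then show ?thesis
        by (simp add: linear_conv_bounded_linear)
    qed
    have ch: "continuous_on UNIV (\<lambda>T :: 'g \<times> 'g \<Rightarrow> 'g \<times> 'g. fst (C.split (T w)) $ i)" for w i
      by (rule bounded_linear.continuous_on[OF bl continuous_on_product_coordinates])
    have "continuous_on UNIV h"
      unfolding h_def by (rule continuous_on_vec_lambda, rule continuous_on_vec_lambda, rule ch)
    then show "continuous_on (carrier K) h"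
      by (rule continuous_on_subset) simp
    have cb: "continuous_on (carrier L) (\<lambda>A. C.block A w)" for w
      by (rule linear_continuous_on[OF C.linear_block_matrix[unfolded linear_conv_bounded_linear]])
    have "continuous_on (carrier L) C.block"
      by (rule continuous_on_coordinatewise_then_product[OF cb])
    moreover have "continuous_on (carrier L) (inv_into (carrier K) h) \<longleftrightarrow> continuous_on (carrier L) C.block"
      by (rule continuous_on_cong[OF refl inv])
    ultimately show "continuous_on (carrier L) (inv_into (carrier K) h)"
      by simp
    show "h ` carrier K = carrier L" "inv_into (carrier K) h ` carrier L = carrier K"
      using im inv K(2) by auto
  qed (use im inj inv in \<open>auto simp: K(2) h\<close>)
  ultimately show ?thesis
    unfolding topological_group_iso_def by (rule bexI[of _ h, rotated])
qed

text \<open>The conjugate-linear extension of \<open>J\<close>. Composing \<open>J\<close> with complex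
  conjugation turns it into an endomorphism which is still quaternionic, since conjugation
  anticommutes with \<open>i\<close> and \<open>J\<close> anticommutes with \<open>E\<close>. It
  is the witness that the complex-linear blocks are a proper subgroup.\<close>

definition conj_J :: "'g \<times> 'g \<Rightarrow> 'g \<times> 'g" where
  "conj_J = (\<lambda>(x, y). (J x, - J y))"

lemma conj_J_props:
  "linear conj_J" "conj_J (conj_J w) = - w" "conj_J (J1 J w) = J1 J (conj_J w)"
  "conj_J (J2 E w) = J2 E (conj_J w)" "conj_J (mult_i w) = - mult_i (conj_J w)"
proof -
  show "linear conj_J"
    unfolding conj_J_def by (intro linearI) (auto simp: linear_add[OF linJ] linear_scale[OF linJ])
  obtain x y where w: "w = (x, y)"
    by (cases w)
  show "conj_J (conj_J w) = - w" "conj_J (J1 J w) = J1 J (conj_J w)"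
    "conj_J (J2 E w) = J2 E (conj_J w)" "conj_J (mult_i w) = - mult_i (conj_J w)"
    by (simp_all add: w conj_J_def J1_def J2_def mult_i_def JJ JE linear_neg[OF linJ] linear_neg[OF linE])
qed

lemma conj_J_not_complex: "\<exists>w. conj_J (mult_i w) \<noteq> mult_i (conj_J w)"
proof -
  have "e undefined \<noteq> 0"
  proof
    assume "e undefined = 0"
    then have "0 \<in> range e \<union> range (J \<circ> e)"
      by (metis UnI1 rangeI)
    then have "dependent (range e \<union> range (J \<circ> e))"
      by (rule dependent_zero)
    then show False
      using basis by (simp add: adapted_basis_def)
  qed
  then have "J (e undefined) \<noteq> 0"
    using JJ[of "e undefined"] linear_0[OF linJ] by auto
  then have "J (e undefined) + J (e undefined) \<noteq> 0"
    by (simp flip: scaleR_2)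
  then have "- J (e undefined) \<noteq> J (e undefined)"
    by (metis add.left_inverse)
  then have "conj_J (mult_i (e undefined, 0)) \<noteq> mult_i (conj_J (e undefined, 0))"
    by (simp add: conj_J_def mult_i_def linear_0[OF linJ])
  then show ?thesis
    by blast
qed

lemma conj_J_GL_H: "conj_J \<in> carrier (GL_H J E)"
proof -
  have "bij conj_J"
    by (rule o_bij[of "\<lambda>w. - conj_J w"]) (auto simp: fun_eq_iff conj_J_props linear_neg[OF conj_J_props(1)])
  then show ?thesis
    by (simp add: GL_H_iff conj_J_props)
qed

text \<open>As \<open>conj_J\<close> anticommutes with \<open>i\<close>, conjugating \<open>1 +
  conj_J\<close> by \<open>i\<close> gives \<open>1 - conj_J\<close>, so the commutator of
  \<open>i\<close> and \<open>1 + conj_J\<close> is \<open>(1 - conj_J) (1 +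
  conj_J)\<^sup>-\<^sup>1 = (1 - conj_J)\<^sup>2 / 2 = - conj_J\<close>.\<close>

lemma uminus_conj_J_derived: "(\<lambda>w. - conj_J w) \<in> derH"
proof -
  have lini: "linear (mult_i :: 'g \<times> 'g \<Rightarrow> _)"
    unfolding mult_i_def by (intro linearI) auto
  have ii: "mult_i (mult_i w) = - w" for w :: "'g \<times> 'g"
    by (cases w) (simp add: mult_i_def)
  have mi: "mult_i \<in> carrier (GL_H J E)"
  proof -
    have "bij (mult_i :: 'g \<times> 'g \<Rightarrow> _)"
      by (rule o_bij[of "\<lambda>w. - mult_i w"]) (auto simp: fun_eq_iff ii linear_neg[OF lini])
    then show ?thesis
      using lini by (auto simp: GL_H_iff J1_def J2_def mult_i_def linear_neg[OF linJ] linear_neg[OF linE])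
  qed
  have J1m: "J1 J (u + v) = J1 J u + J1 J v" "J1 J (- v) = - J1 J v" for u v
    by (rule linear_add[OF linJ1], rule linear_neg[OF linJ1])
  have linJ2: "linear (J2 E)"
    unfolding J2_def mult_i_def by (intro linearI) (auto simp: linear_add[OF linE] linear_scale[OF linE])
  \<comment> \<open>These are mutually inverse because \<open>(1 + conj_J) (1 - conj_J) = 1 - conj_J\<^sup>2 =
    2\<close>.\<close>
  let ?U = "\<lambda>w. w + conj_J w" and ?V = "\<lambda>w. (1 / 2) *\<^sub>R (w - conj_J w)"
  have linU: "linear ?U" and linV: "linear ?V"
    by (intro linear_compose_add linear_ident conj_J_props linear_compose_scale_right linear_compose_sub)+
  have UV: "?U (?V w) = w" and VU: "?V (?U w) = w" for w
    by (simp_all add: linear_add[OF conj_J_props(1)] linear_diff[OF conj_J_props(1)] linear_scale[OF conj_J_props(1)]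
        conj_J_props(2) algebra_simps flip: scaleR_add_left)
  have comp: "?U \<circ> ?V = id" "?V \<circ> ?U = id"
    by (rule ext, simp only: o_apply id_apply UV, rule ext, simp only: o_apply id_apply VU)
  have bijU: "bij ?U" and bijV: "bij ?V"
    by (rule o_bij[OF comp(2,1)], rule o_bij[OF comp])
  have U: "?U \<in> carrier (GL_H J E)"
    by (simp add: GL_H_iff linU bijU conj_J_props J1m linear_add[OF linJ2])
  have V: "?V \<in> carrier (GL_H J E)"
    by (simp add: GL_H_iff linV bijV conj_J_props linear_diff[OF linJ2] linear_diff[OF linJ1] linear_scale[OF linJ1] linear_scale[OF linJ2])
  have invU: "inv\<^bsub>GL_H J E\<^esub> ?U = ?V"
    by (rule GLH.inv_equality[OF _ U V]) (use VU in \<open>simp add: fun_eq_iff\<close>)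
  have mmi: "(\<lambda>w. - mult_i w) \<in> carrier (GL_H J E)"
  proof -
    have "bij (\<lambda>w :: 'g \<times> 'g. - mult_i w)"
      by (rule o_bij[of mult_i]) (auto simp: fun_eq_iff ii linear_neg[OF lini])
    moreover have "linear (\<lambda>w :: 'g \<times> 'g. - mult_i w)"
      by (rule linear_compose_neg[OF lini])
    ultimately show ?thesis
      using mi by (simp add: GL_H_iff linear_neg[OF linJ1] linear_neg[OF linJ2])
  qed
  have invi: "inv\<^bsub>GL_H J E\<^esub> mult_i = (\<lambda>w. - mult_i w)"
    by (rule GLH.inv_equality[OF _ mi mmi]) (simp add: fun_eq_iff ii)
  have "(mult_i \<circ> ?U \<circ> (\<lambda>w. - mult_i w) \<circ> ?V) w = - conj_J w" for w
    by (simp add: linear_add[OF lini] linear_neg[OF lini] ii conj_J_props linear_neg[OF conj_J_props(1)]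
        linear_scale[OF lini] linear_diff[OF lini] linear_scale[OF conj_J_props(1)] linear_diff[OF conj_J_props(1)]
        algebra_simps flip: scaleR_add_left)
  then have "(\<lambda>w. - conj_J w) = mult_i \<circ> ?U \<circ> (\<lambda>w. - mult_i w) \<circ> ?V"
    by (simp add: fun_eq_iff)
  also have "\<dots> = mult_i \<otimes>\<^bsub>GL_H J E\<^esub> ?U \<otimes>\<^bsub>GL_H J E\<^esub> inv\<^bsub>GL_H J E\<^esub> mult_i \<otimes>\<^bsub>GL_H J E\<^esub> inv\<^bsub>GL_H J E\<^esub> ?U"
    by (simp only: invU invi GL_H_simps)
  also have "\<dots> \<in> derH"
    unfolding derived_def by (intro generate.incl) (use mi U in blast)
  finally show ?thesis .
qed

end


section \<open>Left-invariant connections as products on the Lie algebra\<close>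

context lie_group_with_algebra
begin

lemma smooth_fun_const: "smooth_fun \<A> UNIV (\<lambda>_. c)"
  unfolding smooth_fun_def by (auto simp: o_def smooth_on_def Ck_on_const)

lemma \<iota>_const: "\<iota> x p (\<lambda>_. c) = 0"
proof -
  obtain U \<phi> where U: "(U, \<phi>) \<in> \<A>" "p \<in> U"
    by (rule chart_at)
  have "smooth_near \<A> p (\<lambda>_. c)"
    unfolding smooth_near_def using smooth_fun_const by blast
  from \<iota>_in_chart[OF U this, of x]
  have "\<iota> x p (\<lambda>_. c) = frechet_derivative (\<lambda>_. c) (at (\<phi> p)) (frame \<phi> p x)"
    by (simp add: o_def)
  also have "frechet_derivative (\<lambda>_. c) (at (\<phi> p)) = (\<lambda>_. 0)"
    by (rule frechet_derivative_at[symmetric]) (rule has_derivative_const)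
  finally show ?thesis .
qed

text \<open>Covariant derivatives of left-invariant fields are left-invariant. Linearity in
  \<open>y\<close> over the constants uses that derivatives of constants vanish in the Leibniz
  rule.\<close>

lemma invariant_connection_algebra:
  assumes N: "left_invariant_connection \<A> G N"
  obtains D where "\<And>x y. N (\<iota> x) (\<iota> y) = \<iota> (D x y)" "\<And>x. linear (D x)" "\<And>y. linear (\<lambda>x. D x y)"
proof -
  have aff: "affine_connection \<A> N"
    using N unfolding left_invariant_connection_def by blast
  have "N (\<iota> x) (\<iota> y) \<in> left_invariant_fields \<A> G" for x y
  proof -
    have "left_push G a (\<iota> z) = \<iota> z" for a z
      using \<iota>_left[of z] by (simp add: left_invariant_fields_def)
    then have "left_push G a (N (\<iota> x) (\<iota> y)) = N (\<iota> x) (\<iota> y)" for a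
      using N \<iota>_field[of x] \<iota>_field[of y] unfolding left_invariant_connection_def by metis
    moreover have "N (\<iota> x) (\<iota> y) \<in> vector_fields \<A>"
      using aff \<iota>_field[of x] \<iota>_field[of y] unfolding affine_connection_def by blast
    ultimately show ?thesis
      unfolding left_invariant_fields_def by blast
  qed
  then have "\<exists>z. N (\<iota> x) (\<iota> y) = \<iota> z" for x y
    using \<iota>_bij unfolding bij_betw_def by (metis rangeE)
  then obtain D where D: "\<And>x y. N (\<iota> x) (\<iota> y) = \<iota> (D x y)"
    by metis
  have add: "N (vf_add (\<iota> x) (\<iota> z)) (\<iota> y) = vf_add (N (\<iota> x) (\<iota> y)) (N (\<iota> z) (\<iota> y))"
    "N (\<iota> x) (vf_add (\<iota> y) (\<iota> z)) = vf_add (N (\<iota> x) (\<iota> y)) (N (\<iota> x) (\<iota> z))" for x y z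
    using aff \<iota>_field[of x] \<iota>_field[of y] \<iota>_field[of z] unfolding affine_connection_def by blast+
  have scale: "N (vf_scale (\<lambda>_. c) (\<iota> x)) (\<iota> y) = vf_scale (\<lambda>_. c) (N (\<iota> x) (\<iota> y))"
    "N (\<iota> x) (vf_scale (\<lambda>_. c) (\<iota> y)) = vf_add (vf_scale (\<lambda>p. \<iota> x p (\<lambda>_. c)) (\<iota> y)) (vf_scale (\<lambda>_. c) (N (\<iota> x) (\<iota> y)))"
    for c x y
    using aff \<iota>_field[of x] \<iota>_field[of y] smooth_fun_const[of c] unfolding affine_connection_def by blast+
  show ?thesis
  proof (rule that[of D])
    show "N (\<iota> x) (\<iota> y) = \<iota> (D x y)" for x y
      by (rule D)
    show "linear (D x)" for x
    proof (rule linearI)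
      fix y z c
      have "\<iota> (D x (y + z)) = \<iota> (D x y + D x z)"
        by (simp only: D[symmetric] \<iota>_add add)
      then show "D x (y + z) = D x y + D x z"
        by (simp only: \<iota>_eq_iff)
      have "\<iota> (D x (c *\<^sub>R y)) = \<iota> (c *\<^sub>R D x y)"
        unfolding \<iota>_scale D[symmetric] scale \<iota>_const by (simp add: vf_add_def vf_scale_def)
      then show "D x (c *\<^sub>R y) = c *\<^sub>R D x y"
        by (simp only: \<iota>_eq_iff)
    qed
    show "linear (\<lambda>x. D x y)" for y
    proof (rule linearI)
      fix x z c
      have "\<iota> (D (x + z) y) = \<iota> (D x y + D z y)"
        by (simp only: D[symmetric] \<iota>_add add)
      then show "D (x + z) y = D x y + D z y"
        by (simp only: \<iota>_eq_iff)
      have "\<iota> (D (c *\<^sub>R x) y) = \<iota> (c *\<^sub>R D x y)"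
        by (simp only: \<iota>_scale D[symmetric] scale)
      then show "D (c *\<^sub>R x) y = c *\<^sub>R D x y"
        by (simp only: \<iota>_eq_iff)
    qed
  qed
qed

lemma torsion_free_algebra:
  assumes "torsion_free \<A> N" and D: "\<And>x y. N (\<iota> x) (\<iota> y) = \<iota> (D x y)"
  shows "D x y - D y x = br x y"
proof -
  have "N (\<iota> x) (\<iota> y) = vf_add (N (\<iota> y) (\<iota> x)) (vf_bracket \<A> (\<iota> x) (\<iota> y))"
    using assms(1) \<iota>_field[of x] \<iota>_field[of y] unfolding torsion_free_def by blast
  then have "\<iota> (D x y) = \<iota> (D y x + br x y)"
    by (simp only: D \<iota>_add \<iota>_br)
  then show ?thesis
    by (simp add: \<iota>_eq_iff)
qed

lemma parallel_tensor_algebra: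
  assumes "parallel_tensor \<A> N (left_invariant_tensor \<iota> T)" and D: "\<And>x y. N (\<iota> x) (\<iota> y) = \<iota> (D x y)"
  shows "D x (T y) = T (D x y)"
proof -
  have T: "left_invariant_tensor \<iota> T (\<iota> z) = \<iota> (T z)" for z
  proof -
    have "(THE x. \<iota> x p = \<iota> z p) = z" for p
      by (rule the_equality) (auto dest: \<iota>_eq_at)
    then show ?thesis
      by (simp add: left_invariant_tensor_def)
  qed
  have "N (\<iota> x) (left_invariant_tensor \<iota> T (\<iota> y)) = left_invariant_tensor \<iota> T (N (\<iota> x) (\<iota> y))"
    using assms(1) \<iota>_field[of x] \<iota>_field[of y] unfolding parallel_tensor_def by blast
  then have "\<iota> (D x (T y)) = \<iota> (T (D x y))"
    by (simp only: T D)
  then show ?thesis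
    by (simp only: \<iota>_eq_iff)
qed

end

text \<open>The difference of the two products is a symmetric tensor \<open>S\<close> that commutes with
  \<open>I\<close> and \<open>K\<close> in its second argument, hence by symmetry in both. Then
  \<open>S (I x) (K y)\<close> equals both \<open>K I S x y\<close> and \<open>I K S x
  y\<close>, so anticommutation forces \<open>S = 0\<close>.\<close>

lemma obata_unique:
  fixes P Q :: "'v::real_vector \<Rightarrow> 'v \<Rightarrow> 'v"
  assumes tor: "\<And>x y. P x y - P y x = Q x y - Q y x"
    and I: "\<And>x y. P x (I y) = I (P x y)" "\<And>x y. Q x (I y) = I (Q x y)" "linear I" "\<And>x. I (I x) = - x"
    and K: "\<And>x y. P x (K y) = K (P x y)" "\<And>x y. Q x (K y) = K (Q x y)" "linear K" "\<And>x. K (K x) = - x"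
    and IK: "\<And>x. I (K x) = - K (I x)"
  shows "P x y = Q x y"
proof -
  define S where "S x y = P x y - Q x y" for x y
  have sym: "S x y = S y x" for x y
    using tor[of x y] by (simp add: S_def algebra_simps)
  have SI: "S x (I y) = I (S x y)" and SK: "S x (K y) = K (S x y)" for x y
    by (simp_all add: S_def I K linear_diff[OF I(3)] linear_diff[OF K(3)])
  have "S (I x) (K y) = K (I (S x y))"
    by (metis SI SK sym)
  moreover have "S (I x) (K y) = I (K (S x y))"
    by (metis SI SK sym)
  ultimately have "K (I (S x y)) = - K (I (S x y))"
    using IK by simp
  then have "K (I (S x y)) + K (I (S x y)) = 0"
    by (metis add.right_inverse)
  then have "K (I (S x y)) = 0"
    by (simp flip: scaleR_2)
  then have "S x y = 0"
    using I(4)[of "S x y"] K(4)[of "I (S x y)"] linear_0[OF I(3)] linear_0[OF K(3)] by simp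
  then show ?thesis
    by (simp add: S_def)
qed


section \<open>Holonomy of the complex product and Obata connections\<close>

context adapted_frame
begin

text \<open>Commuting with \<open>E\<close> preserves the \<open>+1\<close>-eigenspace; commuting with
  \<open>J\<close> then copies the action to the \<open>-1\<close>-eigenspace.\<close>

lemma connection_block:
  assumes D: "\<And>x. linear (D x)" "\<And>y. linear (\<lambda>x. D x y)"
    and DJ: "\<And>x y. D x (J y) = J (D x y)" and DE: "\<And>x y. D x (E y) = E (D x y)"
  obtains \<Gamma> where "linear \<Gamma>" "\<And>x. D x = R.block (\<Gamma> x)"
proof -
  define M where "M x a = fst (R.split (D x (\<Phi>R a)))" for x a
  have D\<Phi>: "D x (\<Phi>R a) = \<Phi>R (M x a)" for x a
  proof -
    obtain b c where bc: "D x (\<Phi>R a) = R.join (b, c)"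
      by (metis R.join_split surj_pair)
    have "E (D x (\<Phi>R a)) = D x (\<Phi>R a)"
      by (simp only: DE[symmetric] E_\<Phi>R)
    then have "R.join (b, - c) = R.join (b, c)"
      unfolding bc E_join .
    then have "(b, - c) = (b, c)"
      by (metis R.split_join)
    then have "c = 0"
      by (simp add: vec_eq_iff)
    then show ?thesis
      unfolding M_def bc R.split_join by (simp add: R_join linear_0[OF lin\<Phi>R] linear_0[OF linJ])
  qed
  have linM: "linear (M x)" for x
    unfolding M_def
    by (intro linearI) (simp_all add: linear_add[OF lin\<Phi>R] linear_scale[OF lin\<Phi>R] linear_add[OF D(1)] linear_scale[OF D(1)]
        linear_add[OF R.linear_split] linear_scale[OF R.linear_split])
  have linM2: "linear (\<lambda>x. M x a)" for a
    unfolding M_def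
    by (intro linearI) (simp_all add: linear_add[OF D(2)] linear_scale[OF D(2)]
        linear_add[OF R.linear_split] linear_scale[OF R.linear_split])
  have M: "matrix (M x) *v a = M x a" for x a
    by (rule matrix_works) (use linM[of x] in \<open>simp add: linear_def scalar_mult_eq_scaleR\<close>)
  have "linear (\<lambda>x. matrix (M x))"
    by (intro linearI) (simp_all add: matrix_def vec_eq_iff linear_add[OF linM2] linear_scale[OF linM2])
  moreover have "D x = R.block (matrix (M x))" for x
  proof
    fix w
    obtain a b where w: "w = R.join (a, b)"
      by (metis R.join_split surj_pair)
    show "D x w = R.block (matrix (M x)) w"
      unfolding w R.block_join M by (simp add: R_join linear_add[OF D(1)] DJ D\<Phi>)
  qed
  ultimately show ?thesis
    by (rule that)
qed

text \<open>The complex-linear extension of \<open>\<Gamma>\<close> to pairs \<open>(x, y)\<close>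
  standing for \<open>x + iy\<close>.\<close>

definition complexify_matrix :: "('g \<Rightarrow> real^'n^'n) \<Rightarrow> 'g \<times> 'g \<Rightarrow> complex^'n^'n" where
  "complexify_matrix \<Gamma> w = (\<chi> i j. Complex (\<Gamma> (fst w) $ i $ j) (\<Gamma> (snd w) $ i $ j))"

lemma linear_complexify_matrix: "linear \<Gamma> \<Longrightarrow> linear (complexify_matrix \<Gamma>)"
  unfolding complexify_matrix_def
  by (intro linearI) (simp_all add: vec_eq_iff linear_add linear_scale complex_eq_iff)

lemma trace_complexify_matrix:
  "Re (trace (complexify_matrix \<Gamma> w)) = trace (\<Gamma> (fst w))" "Im (trace (complexify_matrix \<Gamma> w)) = trace (\<Gamma> (snd w))"
  by (simp_all add: trace_def complexify_matrix_def)

text \<open>\<open>complexify_bracket D\<close> is the complex-bilinear extension of the product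
  \<open>D\<close>. Being complex-linear in both arguments, it is given by the complex-linear
  extension of the blocks.\<close>

lemma complexify_connection_block:
  assumes D: "\<And>x. D x = R.block (\<Gamma> x)"
  shows "complexify_bracket D w = C.block (complexify_matrix \<Gamma> w)"
proof
  fix u
  obtain x y where w: "w = (x, y)"
    by (cases w)
  obtain a b where u: "u = C.join (a, b)"
    by (metis C.join_split surj_pair)
  have re: "(\<chi> i. Re ((complexify_matrix \<Gamma> w *v a) $ i)) = \<Gamma> x *v (\<chi> i. Re (a $ i)) - \<Gamma> y *v (\<chi> i. Im (a $ i))"
    and im: "(\<chi> i. Im ((complexify_matrix \<Gamma> w *v a) $ i)) = \<Gamma> x *v (\<chi> i. Im (a $ i)) + \<Gamma> y *v (\<chi> i. Re (a $ i))" for a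
    by (simp_all add: w vec_eq_iff matrix_vector_mult_def complexify_matrix_def sum_subtractf sum.distrib)
  have diff: "R.join (p, q) - R.join (p', q') = R.join (p - p', q - q')"
    and sum: "R.join (p, q) + R.join (p', q') = R.join (p + p', q + q')" for p q p' q'
    using linear_diff[OF R.linear_join, of "(p, q)" "(p', q')"] linear_add[OF R.linear_join, of "(p, q)" "(p', q')"]
    by simp_all
  show "complexify_bracket D w u = C.block (complexify_matrix \<Gamma> w) u"
    unfolding u C.block_join unfolding C_join_eq re im
    by (simp add: w complexify_bracket_def D R.block_join diff sum)
qed

lemma R_block_frame: "R.block A (e j) = \<Phi>R (\<chi> i. A $ i $ j)" "R.block A (J (e j)) = J (\<Phi>R (\<chi> i. A $ i $ j))"
proof -
  have col: "A *v axis j 1 = (\<chi> i. A $ i $ j)"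
    by (simp add: vec_eq_iff matrix_vector_mult_axis)
  have "e j = R.join (axis j 1, 0)" "J (e j) = R.join (0, axis j 1)"
    by (simp_all add: R_join \<Phi>R_axis linear_0[OF lin\<Phi>R] linear_0[OF linJ])
  then show "R.block A (e j) = \<Phi>R (\<chi> i. A $ i $ j)" "R.block A (J (e j)) = J (\<Phi>R (\<chi> i. A $ i $ j))"
    by (simp_all add: R.block_join col) (simp_all add: R_join linear_0[OF lin\<Phi>R] linear_0[OF linJ])
qed

lemma R_block_SL: "R.block A \<in> SL_R_diag J e \<longleftrightarrow> det A = 1"
proof
  assume "R.block A \<in> SL_R_diag J e"
  then obtain A' where A': "det A' = 1" "\<And>j. R.block A (e j) = (\<Sum>i\<in>UNIV. A' $ i $ j *\<^sub>R e i)"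
    unfolding SL_R_diag_def by blast
  have "\<Phi>R (\<chi> i. A $ i $ j) = \<Phi>R (\<chi> i. A' $ i $ j)" for j
    using A'(2)[of j] by (simp add: R_block_frame \<Phi>R_def[of "\<chi> i. A' $ i $ j"])
  then have "R.join (\<chi> i. A $ i $ j, 0) = R.join (\<chi> i. A' $ i $ j, 0)" for j
    by (simp add: R_join)
  then have "A = A'"
    by (metis (no_types, lifting) R.split_join prod.inject vec_eq_iff vec_lambda_beta)
  then show "det A = 1"
    using A'(1) by simp
next
  assume "det A = 1"
  then show "R.block A \<in> SL_R_diag J e"
    unfolding SL_R_diag_def using R.linear_block[of A]
    by (intro CollectI conjI exI[of _ A] allI)
      (simp_all add: R_block_frame \<Phi>R_def linear_sum[OF linJ] linear_scale[OF linJ])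
qed

lemma conj_J_not_block: "conj_J \<noteq> C.block A" "(\<lambda>w. - conj_J w) \<noteq> C.block A"
proof -
  obtain w where w: "conj_J (mult_i w) \<noteq> mult_i (conj_J w)"
    using conj_J_not_complex by blast
  then show "conj_J \<noteq> C.block A"
    using block_commutes(3) by metis
  have "mult_i (- v) = - mult_i v" for v :: "'g \<times> 'g"
    by (cases v) (simp add: mult_i_def)
  then have "- conj_J (mult_i w) \<noteq> mult_i (- conj_J w)"
    using w by simp
  then show "(\<lambda>w. - conj_J w) \<noteq> C.block A"
    using block_commutes(3)[of A w] by metis
qed

text \<open>The image is proper because it consists of complex-linear maps, whereas \<open>conj_J\<close>
  is not complex-linear.\<close>

lemma image_GL_C:
  "proper_subgroup (C.block ` carrier GL_C) (GL_H J E)"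
  "topological_group_iso ((GL_H J E)\<lparr>carrier := C.block ` carrier GL_C\<rparr>) (GL_C :: (complex^'n^'n) monoid)"
proof -
  have "conj_J \<notin> C.block ` carrier GL_C"
    using conj_J_not_block(1) by blast
  then have "C.block ` carrier GL_C \<noteq> carrier (GL_H J E)"
    using conj_J_GL_H by metis
  then show "proper_subgroup (C.block ` carrier GL_C) (GL_H J E)"
    using blk.img_is_subgroup by (simp add: proper_subgroup_def)
  show "topological_group_iso ((GL_H J E)\<lparr>carrier := C.block ` carrier GL_C\<rparr>) (GL_C :: (complex^'n^'n) monoid)"
    by (rule block_topological_iso) (simp_all add: GL_C_def)
qed

text \<open>Here \<open>- conj_J\<close> witnesses properness, being a commutator that is not
  complex-linear.\<close>

lemma image_SL_C:
  "proper_subgroup (C.block ` carrier SL_C) (SL_H J E)"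
  "topological_group_iso ((SL_H J E)\<lparr>carrier := C.block ` carrier SL_C\<rparr>) (SL_C :: (complex^'n^'n) monoid)"
proof -
  have SL: "A \<in> carrier SL_C \<longleftrightarrow> det A = 1" for A :: "complex^'n^'n"
    by (simp add: SL_C_def)
  have "subgroup (carrier SL_C) (GL_C :: (complex^'n^'n) monoid)"
  proof (rule GL.subgroupI)
    show "carrier SL_C \<subseteq> carrier (GL_C :: (complex^'n^'n) monoid)"
      by (auto simp: SL invertible_det_nz)
    show "carrier SL_C \<noteq> ({} :: (complex^'n^'n) set)"
      using SL[of "mat 1"] by auto
    show "A \<otimes>\<^bsub>GL_C\<^esub> B \<in> carrier SL_C" if "A \<in> carrier SL_C" "B \<in> carrier SL_C" for A B :: "complex^'n^'n"
      using that by (simp add: SL det_mul)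
    show "inv\<^bsub>GL_C\<^esub> A \<in> carrier SL_C" if A: "A \<in> carrier SL_C" for A :: "complex^'n^'n"
    proof -
      have "A \<in> carrier GL_C"
        using A by (auto simp: SL invertible_det_nz)
      then have "det (A ** inv\<^bsub>GL_C\<^esub> A) = 1"
        using GL.r_inv[of A] by simp
      then show ?thesis
        using A by (simp add: SL det_mul)
    qed
  qed
  then have "subgroup (C.block ` carrier SL_C) (GL_H J E)"
    by (rule blk.subgroup_img_is_subgroup)
  moreover have "C.block ` carrier SL_C \<subseteq> derH"
    using block_det_1_derived by (auto simp: SL)
  ultimately have "subgroup (C.block ` carrier SL_C) (SL_H J E)"
    unfolding SL_H_def by (rule GLH.subgroup_incl[OF _ derH_subgroup])
  moreover have "C.block ` carrier SL_C \<noteq> carrier (SL_H J E)"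
  proof -
    have "(\<lambda>w. - conj_J w) \<notin> C.block ` carrier SL_C"
      using conj_J_not_block(2) by blast
    moreover have "(\<lambda>w. - conj_J w) \<in> carrier (SL_H J E)"
      using uminus_conj_J_derived by (simp add: SL_H_def)
    ultimately show ?thesis
      by metis
  qed
  ultimately show "proper_subgroup (C.block ` carrier SL_C) (SL_H J E)"
    by (simp add: proper_subgroup_def)
  show "topological_group_iso ((SL_H J E)\<lparr>carrier := C.block ` carrier SL_C\<rparr>) (SL_C :: (complex^'n^'n) monoid)"
    by (rule block_topological_iso) (simp_all add: SL_C_def SL_H_def)
qed

end

theorem corollary2p9:
  fixes br :: "'g::euclidean_space \<Rightarrow> 'g \<Rightarrow> 'g"
    and J E :: "'g \<Rightarrow> 'g"
    and e :: "'n::finite \<Rightarrow> 'g"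
    and \<A> :: "('m::{t2_space, second_countable_topology}, 'a::euclidean_space) chart set"
    and G :: "'m monoid"
    and \<iota> :: "'g \<Rightarrow> 'm vfield"
    and CP :: "'m vfield \<Rightarrow> 'm vfield \<Rightarrow> 'm vfield"
    and \<B> :: "('l::{t2_space, second_countable_topology}, 'b::euclidean_space) chart set"
    and Gh :: "'l monoid"
    and \<kappa> :: "'g \<times> 'g \<Rightarrow> 'l vfield"
    and Ob :: "'l vfield \<Rightarrow> 'l vfield \<Rightarrow> 'l vfield"
  assumes "lie_algebra br" and "DIM('g) = 2 * CARD('n)"
    and "complex_product_structure br J E"
    and "adapted_basis J E e"
    and "lie_group \<A> G" and "simply_connected (UNIV :: 'm set)"
    and "lie_algebra_of \<A> G br \<iota>"
    and "is_CP_connection \<A> G \<iota> J E CP"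
    and "lie_group \<B> Gh" and "simply_connected (UNIV :: 'l set)"
    and "lie_algebra_of \<B> Gh (complexify_bracket br) \<kappa>"
    and "is_Obata_connection \<B> Gh \<kappa> J E Ob"
  shows "(\<exists>K. proper_subgroup K (GL_H J E) \<and>
            topological_group_iso ((GL_H J E)\<lparr>carrier := K\<rparr>) (GL_C :: (complex^'n^'n) monoid) \<and>
            holonomy \<B> Gh \<kappa> Ob \<subseteq> K)
    \<and> (holonomy \<B> Gh \<kappa> Ob \<subseteq> carrier (SL_H J E) \<longleftrightarrow> holonomy \<A> G \<iota> CP \<subseteq> SL_R_diag J e)
    \<and> (holonomy \<B> Gh \<kappa> Ob \<subseteq> carrier (SL_H J E) \<longrightarrow>
        (\<exists>K. proper_subgroup K (SL_H J E) \<and>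
            topological_group_iso ((SL_H J E)\<lparr>carrier := K\<rparr>) (SL_C :: (complex^'n^'n) monoid) \<and>
            holonomy \<B> Gh \<kappa> Ob \<subseteq> K))"
proof -
  have cps: "linear J" "linear E" "\<forall>x. J (J x) = - x" "\<forall>x. E (E x) = x" "\<forall>x. J (E x) = - E (J x)"
    using assms(3) unfolding complex_product_structure_def by blast+
  have JJ: "J (J x) = - x" and EE: "E (E x) = x" and JE: "J (E x) = - E (J x)" for x
    by (rule spec[OF cps(3)], rule spec[OF cps(4)], rule spec[OF cps(5)])
  interpret F: adapted_frame J E e
    by (rule adapted_frame.intro[OF cps(1,2) JJ JE assms(4,2)])
  have br: "linear (br x)" "linear (\<lambda>x. br x y)" for x y
    using assms(1) unfolding lie_algebra_def by auto
  interpret G: lie_group_with_algebra \<A> G br \<iota>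
    using assms(5,7) by (intro lie_group_with_algebra.intro smooth_lie_group.intro smooth_manifold.intro
        lie_group_with_algebra_axioms.intro smooth_lie_group_axioms.intro) (simp_all add: lie_group_def)
  interpret H: lie_group_with_algebra \<B> Gh "complexify_bracket br" \<kappa>
    using assms(9,11) by (intro lie_group_with_algebra.intro smooth_lie_group.intro smooth_manifold.intro
        lie_group_with_algebra_axioms.intro smooth_lie_group_axioms.intro) (simp_all add: lie_group_def)
  have CP: "left_invariant_connection \<A> G CP" "torsion_free \<A> CP"
    "parallel_tensor \<A> CP (left_invariant_tensor \<iota> J)" "parallel_tensor \<A> CP (left_invariant_tensor \<iota> E)"
    using assms(8) unfolding is_CP_connection_def by blast+
  have Ob: "left_invariant_connection \<B> Gh Ob" "torsion_free \<B> Ob"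
    "parallel_tensor \<B> Ob (left_invariant_tensor \<kappa> (J1 J))" "parallel_tensor \<B> Ob (left_invariant_tensor \<kappa> (J2 E))"
    using assms(12) unfolding is_Obata_connection_def by blast+
  obtain D where D: "\<And>x y. CP (\<iota> x) (\<iota> y) = \<iota> (D x y)" "\<And>x. linear (D x)" "\<And>y. linear (\<lambda>x. D x y)"
    by (rule G.invariant_connection_algebra[OF CP(1)]) blast
  have DJ: "D x (J y) = J (D x y)" and DE: "D x (E y) = E (D x y)" and Dtor: "D x y - D y x = br x y" for x y
    by (rule G.parallel_tensor_algebra[OF CP(3) D(1)], rule G.parallel_tensor_algebra[OF CP(4) D(1)],
        rule G.torsion_free_algebra[OF CP(2) D(1)])
  obtain \<Gamma> where \<Gamma>: "linear \<Gamma>" "\<And>x. D x = F.R.block (\<Gamma> x)"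
    by (rule F.connection_block[OF D(2,3) DJ DE]) blast
  let ?\<Gamma> = "F.complexify_matrix \<Gamma>"
  \<comment> \<open>The Obata product is the complexification of \<open>D\<close>, by uniqueness.\<close>
  have Ob_D: "Ob (\<kappa> x) (\<kappa> y) = \<kappa> (complexify_bracket D x y)" for x y
  proof -
    obtain D' where D': "\<And>x y. Ob (\<kappa> x) (\<kappa> y) = \<kappa> (D' x y)"
      by (rule H.invariant_connection_algebra[OF Ob(1)]) blast
    have "D' x y = complexify_bracket D x y" for x y
    proof (rule obata_unique[where P = D' and Q = "complexify_bracket D" and I = "J1 J" and K = "J2 E"])
      show "D' x y - D' y x = complexify_bracket D x y - complexify_bracket D y x" for x y
      proof -
        have "complexify_bracket D x y - complexify_bracket D y x = complexify_bracket br x y"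
          by (cases x; cases y) (simp add: complexify_bracket_def algebra_simps flip: Dtor)
        then show ?thesis
          using H.torsion_free_algebra[OF Ob(2) D'] by simp
      qed
      show "D' x (J1 J y) = J1 J (D' x y)" "D' x (J2 E y) = J2 E (D' x y)" for x y
        by (rule H.parallel_tensor_algebra[OF Ob(3) D'], rule H.parallel_tensor_algebra[OF Ob(4) D'])
      show "complexify_bracket D x (J1 J y) = J1 J (complexify_bracket D x y)"
        "complexify_bracket D x (J2 E y) = J2 E (complexify_bracket D x y)" for x y
        unfolding F.complexify_connection_block[OF \<Gamma>(2)] by (rule F.block_commutes)+
      show "linear (J1 J)"
        by (rule F.linJ1)
      show "linear (J2 E)"
        unfolding J2_def mult_i_def by (intro linearI) (auto simp: linear_add[OF F.linE] linear_scale[OF F.linE])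
      show "J1 J (J1 J x) = - x" "J2 E (J2 E x) = - x" "J1 J (J2 E x) = - J2 E (J1 J x)" for x
        by (cases x; simp add: J1_def J2_def mult_i_def JJ EE JE linear_neg[OF F.linJ] linear_neg[OF F.linE])+
    qed
    then show ?thesis
      using D' by simp
  qed
  interpret TG: block_transport \<A> G br \<iota> F.\<Phi>R J D \<Gamma> CP
    by (intro block_transport.intro block_connection.intro block_connection_axioms.intro block_transport_axioms.intro
        G.lie_group_with_algebra_axioms F.R.block_space_axioms \<Gamma> D(1))
  interpret TH: block_transport \<B> Gh "complexify_bracket br" \<kappa> F.\<Phi>C "J1 J" "complexify_bracket D" ?\<Gamma> Ob
    by (intro block_transport.intro block_connection.intro block_connection_axioms.intro block_transport_axioms.intro
        H.lie_group_with_algebra_axioms F.C.block_space_axioms F.complexify_connection_block[OF \<Gamma>(2)]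
        F.linear_complexify_matrix[OF \<Gamma>(1)] Ob_D)
  \<comment> \<open>The real part of \<open>\<theta>\<close> at \<open>(x, y)\<close> is \<open>\<tau> x\<close>
    and the imaginary part is \<open>\<tau> y\<close>.\<close>
  let ?\<tau> = "\<lambda>x. trace (\<Gamma> x)" and ?\<theta> = "\<lambda>w. trace (?\<Gamma> w)"
  have lin\<tau>: "linear ?\<tau>" and lin\<theta>: "linear ?\<theta>"
    by (rule TG.linear_trace_form, rule TH.linear_trace_form)
  have linRe: "linear Re" and linIm: "linear Im"
    by (rule bounded_linear.linear[OF bounded_linear_Re], rule bounded_linear.linear[OF bounded_linear_Im])
  have SL_H: "carrier (SL_H J E) = F.derH"
    by (simp add: SL_H_def)
  have holOb: "\<exists>A c. P = F.C.block A \<and> line_integral \<B> \<kappa> ?\<theta> \<one>\<^bsub>Gh\<^esub> \<one>\<^bsub>Gh\<^esub> c \<and> det A = exp (- c)"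
    if "P \<in> holonomy \<B> Gh \<kappa> Ob" for P
    using TH.parallel_transport_block[of "\<one>\<^bsub>Gh\<^esub>" "\<one>\<^bsub>Gh\<^esub>" P] that unfolding holonomy_def by blast
  have holCP: "\<exists>A c. P = F.R.block A \<and> line_integral \<A> \<iota> ?\<tau> \<one>\<^bsub>G\<^esub> \<one>\<^bsub>G\<^esub> c \<and> det A = exp (- c)"
    if "P \<in> holonomy \<A> G \<iota> CP" for P
    using TG.parallel_transport_block[of "\<one>\<^bsub>G\<^esub>" "\<one>\<^bsub>G\<^esub>" P] that unfolding holonomy_def by blast
  \<comment> \<open>Both inclusions of holonomy groups turn out to be equivalent to this condition.\<close>
  let ?closed = "\<forall>x y. ?\<tau> (br x y) = 0"
  have closed_loops: "c = 0" if cl: ?closed and c: "line_integral \<B> \<kappa> ?\<theta> \<one>\<^bsub>Gh\<^esub> \<one>\<^bsub>Gh\<^esub> c" for c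
  proof -
    have "Re (?\<theta> (complexify_bracket br x y)) = 0" "Im (?\<theta> (complexify_bracket br x y)) = 0" for x y
      using cl by (cases x; cases y; simp add: F.trace_complexify_matrix complexify_bracket_def
          linear_add[OF lin\<tau>] linear_diff[OF lin\<tau>])+
    then have "Re c = 0" "Im c = 0"
      using H.closed_form_loop_integral[OF linear_compose[OF lin\<theta> linRe] _ assms(10) line_integral_linear_image[OF linRe lin\<theta> c]]
        H.closed_form_loop_integral[OF linear_compose[OF lin\<theta> linIm] _ assms(10) line_integral_linear_image[OF linIm lin\<theta> c]]
      by simp_all
    then show ?thesis
      by (simp add: complex_eq_iff)
  qed
  have closed_SL: "holonomy \<B> Gh \<kappa> Ob \<subseteq> F.C.block ` carrier SL_C" if ?closed
  proof
    fix P assume "P \<in> holonomy \<B> Gh \<kappa> Ob"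
    then obtain A c where A: "P = F.C.block A" "line_integral \<B> \<kappa> ?\<theta> \<one>\<^bsub>Gh\<^esub> \<one>\<^bsub>Gh\<^esub> c" "det A = exp (- c)"
      using holOb by blast
    then have "det A = 1"
      using closed_loops[OF that A(2)] by simp
    then show "P \<in> F.C.block ` carrier SL_C"
      using A(1) by (simp add: SL_C_def)
  qed
  have SL_sub: "F.C.block ` carrier SL_C \<subseteq> carrier (SL_H J E)"
    unfolding SL_H using F.block_det_1_derived by (auto simp: SL_C_def)
  \<comment> \<open>Only \<open>Re \<theta>\<close> is accessible here, as membership in \<open>SL(n, H)\<close>
    determines \<open>det A\<close> only up to a phase. Brackets of real elements suffice to
    recover \<open>\<tau>\<close>.\<close>
  have Ob_closed: ?closed if sub: "holonomy \<B> Gh \<kappa> Ob \<subseteq> carrier (SL_H J E)"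
  proof (intro allI)
    fix x y
    have "(Re \<circ> ?\<theta>) (complexify_bracket br (x, 0) (y, 0)) = 0"
    proof (rule H.loop_integrals_vanish_imp_closed[OF linear_compose[OF lin\<theta> linRe]])
      fix d assume "line_integral \<B> \<kappa> (Re \<circ> ?\<theta>) \<one>\<^bsub>Gh\<^esub> \<one>\<^bsub>Gh\<^esub> d"
      then obtain c where c: "line_integral \<B> \<kappa> ?\<theta> \<one>\<^bsub>Gh\<^esub> \<one>\<^bsub>Gh\<^esub> c" "d = Re c"
        using line_integral_linear_preimage[OF linRe lin\<theta>] by blast
      obtain A where A: "parallel_transport \<B> \<kappa> Ob \<one>\<^bsub>Gh\<^esub> \<one>\<^bsub>Gh\<^esub> (F.C.block A)" "det A = exp (- c)"
        using TH.line_integral_parallel_transport[OF c(1)] by blast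
      have "F.C.block A \<in> F.derH"
        using A(1) sub unfolding holonomy_def SL_H by blast
      moreover have "invertible A"
        using A(2) by (simp add: invertible_det_nz)
      ultimately have "cmod (exp (- c)) = 1"
        using F.block_derived_norm_det[of A] A(2) by simp
      then show "d = 0"
        by (simp add: c(2))
    qed
    moreover have "complexify_bracket br (x, 0) (y, 0) = (br x y, 0)"
      by (simp add: complexify_bracket_def linear_0[OF br(1)] linear_0[OF br(2)])
    ultimately show "?\<tau> (br x y) = 0"
      by (simp add: F.trace_complexify_matrix)
  qed
  have CP_iff: "holonomy \<A> G \<iota> CP \<subseteq> SL_R_diag J e \<longleftrightarrow> ?closed"
  proof
    assume sub: "holonomy \<A> G \<iota> CP \<subseteq> SL_R_diag J e"
    show ?closed
    proof (intro allI)
      fix x y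
      show "?\<tau> (br x y) = 0"
      proof (rule G.loop_integrals_vanish_imp_closed[OF lin\<tau>])
        fix c assume c: "line_integral \<A> \<iota> ?\<tau> \<one>\<^bsub>G\<^esub> \<one>\<^bsub>G\<^esub> c"
        obtain A where A: "parallel_transport \<A> \<iota> CP \<one>\<^bsub>G\<^esub> \<one>\<^bsub>G\<^esub> (F.R.block A)" "det A = exp (- c)"
          using TG.line_integral_parallel_transport[OF c] by blast
        have "F.R.block A \<in> SL_R_diag J e"
          using A(1) sub unfolding holonomy_def by blast
        then have "exp (- c) = 1"
          using A(2) by (simp add: F.R_block_SL)
        then show "c = 0"
          by simp
      qed
    qed
  next
    assume cl: ?closed
    show "holonomy \<A> G \<iota> CP \<subseteq> SL_R_diag J e"
    proof
      fix P assume "P \<in> holonomy \<A> G \<iota> CP"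
      then obtain A c where A: "P = F.R.block A" "line_integral \<A> \<iota> ?\<tau> \<one>\<^bsub>G\<^esub> \<one>\<^bsub>G\<^esub> c" "det A = exp (- c)"
        using holCP by blast
      have "c = 0"
        by (rule G.closed_form_loop_integral[OF lin\<tau> _ assms(6) A(2)]) (use cl in blast)
      then show "P \<in> SL_R_diag J e"
        using A(1,3) by (simp add: F.R_block_SL)
    qed
  qed
  have "holonomy \<B> Gh \<kappa> Ob \<subseteq> F.C.block ` carrier GL_C"
  proof
    fix P assume "P \<in> holonomy \<B> Gh \<kappa> Ob"
    then obtain A c where A: "P = F.C.block A" "det A = exp (- c)"
      using holOb by blast
    then show "P \<in> F.C.block ` carrier GL_C"
      by (simp add: invertible_det_nz)
  qed
  then have part1: "\<exists>K. proper_subgroup K (GL_H J E) \<and>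
            topological_group_iso ((GL_H J E)\<lparr>carrier := K\<rparr>) (GL_C :: (complex^'n^'n) monoid) \<and>
            holonomy \<B> Gh \<kappa> Ob \<subseteq> K"
    by (intro exI[of _ "F.C.block ` carrier GL_C"] conjI F.image_GL_C)
  have part2: "holonomy \<B> Gh \<kappa> Ob \<subseteq> carrier (SL_H J E) \<longleftrightarrow> holonomy \<A> G \<iota> CP \<subseteq> SL_R_diag J e"
    unfolding CP_iff using Ob_closed closed_SL SL_sub by blast
  have part3: "\<exists>K. proper_subgroup K (SL_H J E) \<and>
            topological_group_iso ((SL_H J E)\<lparr>carrier := K\<rparr>) (SL_C :: (complex^'n^'n) monoid) \<and>
            holonomy \<B> Gh \<kappa> Ob \<subseteq> K" if "holonomy \<B> Gh \<kappa> Ob \<subseteq> carrier (SL_H J E)"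
    by (intro exI[of _ "F.C.block ` carrier SL_C"] conjI F.image_SL_C closed_SL Ob_closed that)
  show ?thesis
    using part1 part2 part3 by (intro conjI impI)
qed

end
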